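(* Let $F=(V,E)$ be a simple bigraph with $m=|E|$ edges. Let $W:[0,1]^2\to\mathbb{R}$ be a bounded measurable function with $\int_{[0,1]^2} W=1$, $0\le W\le 2$ and $\|W-1\|_\square\le 2^{-8m}$. Then $t(F,W)\ge 1$.
   Context: A bigraph is a finite bipartite graph with a fixed ordered bipartition $(A,B)$ of its node set. For a bigraph $F$ with bipartition $(A,B)$, each edge $e$ has an endpoint $a(e)\in A$ and an endpoint $b(e)\in B$. For a bounded measurable function $W:[0,1]^2\to\mathbb{R}$ (not necessarily symmetric) define $$t(F,W)=\int_{[0,1]^{V(F)}}\prod_{e\in E(F)}W(x_{a(e)},y_{b(e)})\prod_{i\in A}dx_i\prod_{j\in B}dy_j .$$ The cut norm of a bounded measurable $U:[0,1]^2\to\mathbb{R}$ is $\|U\|_\square=\sup_{S,T\subseteq[0,1]}\left|\int_{S\times T}U(x,y)\,dx\,dy\right|$, where $S,T$ range over measurable sets. *)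

theory Defs
  imports "HOL-Analysis.Analysis"
begin

text \<open>Edges are abstract objects with endpoint maps, as in the formula for the density below,
  so that parallel edges are possible in a bigraph and are excluded by simplicity.\<close>

record ('v, 'e) bigraph =
  left_nodes :: "'v set"
  right_nodes :: "'v set"
  edges :: "'e set"
  left_end :: "'e \<Rightarrow> 'v"
  right_end :: "'e \<Rightarrow> 'v"

definition is_bigraph :: "('v, 'e) bigraph \<Rightarrow> bool" where
  "is_bigraph F \<longleftrightarrow>
     finite (left_nodes F) \<and> finite (right_nodes F) \<and> finite (edges F) \<and>
     left_nodes F \<inter> right_nodes F = {} \<and>
     left_end F \<in> edges F \<rightarrow> left_nodes F \<and> right_end F \<in> edges F \<rightarrow> right_nodes F"

definition simple_bigraph :: "('v, 'e) bigraph \<Rightarrow> bool" where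
  "simple_bigraph F \<longleftrightarrow>
     is_bigraph F \<and> inj_on (\<lambda>e. (left_end F e, right_end F e)) (edges F)"

abbreviation unit_square :: "(real \<times> real) set" where
  "unit_square \<equiv> {0..1} \<times> {0..1}"

text \<open>Functions on the unit square are total functions whose values outside the square
  are never used. Measurability is Lebesgue measurability throughout, which includes the
  Borel case.\<close>

definition bounded_measurable_kernel :: "(real \<Rightarrow> real \<Rightarrow> real) \<Rightarrow> bool" where
  "bounded_measurable_kernel W \<longleftrightarrow>
     (\<lambda>(x, y). W x y) \<in> borel_measurable (lebesgue_on unit_square) \<and>
     bounded ((\<lambda>(x, y). W x y) ` unit_square)"

text \<open>Lebesgue measure on the cube with coordinates indexed by \<open>V\<close>. The completion is needed
  because the product sigma-algebra does not make the density integrand measurable when the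
  kernel is only Lebesgue measurable.\<close>

definition cube_measure :: "'v set \<Rightarrow> ('v \<Rightarrow> real) measure" where
  "cube_measure V = completion (\<Pi>\<^sub>M v\<in>V. restrict_space lborel {0..1})"

text \<open>The two node classes are disjoint, so a single point \<open>z\<close> of the cube carries both
  the coordinates \<open>x\<^sub>i\<close> (left nodes) and \<open>y\<^sub>j\<close> (right nodes).\<close>

definition hom_density :: "('v, 'e) bigraph \<Rightarrow> (real \<Rightarrow> real \<Rightarrow> real) \<Rightarrow> real" where
  "hom_density F W =
     (\<integral>z. (\<Prod>e\<in>edges F. W (z (left_end F e)) (z (right_end F e)))
       \<partial>cube_measure (left_nodes F \<union> right_nodes F))"

text \<open>For a bounded measurable kernel the supremum is over a bounded nonempty set of reals,
  hence a genuine supremum.\<close>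

definition cut_norm :: "(real \<Rightarrow> real \<Rightarrow> real) \<Rightarrow> real" where
  "cut_norm U =
     (SUP (S, T) \<in> {S. S \<in> sets lebesgue \<and> S \<subseteq> {0..1}} \<times> {T. T \<in> sets lebesgue \<and> T \<subseteq> {0..1}}.
        \<bar>set_lebesgue_integral lebesgue (S \<times> T) (\<lambda>(x, y). U x y)\<bar>)"

end

theory Submission
  imports Defs
begin

text \<open>
  Put \<open>U = W - 1\<close>. Expanding the product over the edges gives \<open>t(F, W)\<close> as the sum of the signed
  densities \<open>t(D, U)\<close> over all edge subsets \<open>D\<close>, and the empty set contributes 1. Let \<open>m\<close>
  be the number of edges. Here \<open>\<bar>U\<bar> \<le> 1\<close>, the integral of \<open>U\<close> is 0, and integrating \<open>U\<close> against a product of two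
  \<open>[-1, 1]\<close>-valued functions of one variable gives at most \<open>\<eta> = 4 \<sqdot> 2\<^sup>-\<^sup>8\<^sup>m\<close>. The task is to
  show that the terms with \<open>D\<close> nonempty have a nonnegative sum.

  Some of these terms are collected into nonnegative groups, with total \<open>P\<close>. Fix a nonempty set \<open>A\<close>
  of left nodes with \<open>c\<close> common neighbours, and let \<open>L\<close> be the integral over \<open>y\<close> of the product of
  the \<open>U(x\<^sub>a, y)\<close>. The complete bipartite subgraphs \<open>A \<times> B\<close> with at least two nodes in \<open>B\<close> together
  contribute the average of \<open>(1 + L)\<^sup>c - 1 - c L\<close>, which is nonnegative by Bernoulli's inequality and
  at least the average of \<open>L\<^sup>2\<close> if \<open>c \<ge> 2\<close> (\<open>star_sum_bounds\<close>). Grouping is essential: for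
  kernels close to \<open>\<plusminus>\<close> the character table of a large power of \<open>\<int>/2\<close>, a single biclique can be
  negative and about as large as a four-cycle. Stars centred at right nodes are treated in the same
  way, and the density of an even cycle is a mean of squares. Consequently \<open>P\<close> is at least the mean square of the degree function of
  \<open>U\<close> at every node of degree at least two, and at least the density of every even cycle of \<open>F\<close>.

  All other nonempty terms are at most \<open>\<kappa> P\<close> in absolute value, with \<open>\<kappa> = \<surd>\<eta> = 2 \<sqdot> 2\<^sup>-\<^sup>4\<^sup>m\<close>
  (\<open>charged_bound\<close>). There are at most \<open>2\<^sup>m\<close> of them, and \<open>2\<^sup>m \<kappa> \<le> 1\<close> as soon as \<open>m \<ge> 1\<close>, so they
  cannot outweigh \<open>P\<close>. For this bound, \<open>D\<close> is compared with a cherry or a cycle that it contains: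

  \<^item> An isolated edge makes the density zero. Any other leaf yields a factor that is the degree function
    at its neighbour. Two leaves give two such factors, and edges elsewhere make the remaining
    average small; a path with three edges has too few of them and is treated by the norm of \<open>U\<close> on
    \<open>L\<^sup>2\<close>. If there is one
    leaf and a cycle, Cauchy--Schwarz separates the degree function from the rest, which is estimated
    by the cycle. A forest has two leaves, so nothing else can happen.

  \<^item> Without leaves, take a shortest cycle. It has no chords, so once the coordinates off the cycle
    are fixed, all further edges act as weights at single vertices of the cycle, and such a weighted
    cycle is bounded by the unweighted one (\<open>path_sq_le\<close>, \<open>chordless_cycle_bound\<close>). This alone gives
    no gain. In girth at least six the gain comes from an edge off the cycle whose neighbours on the
    cycle form at most one antipodal pair (\<open>far_edge_bound\<close>). In girth four, \<open>D\<close> is not a biclique,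
    so some node sees one but not both of two nodes on one side of a four-cycle
    (\<open>four_cycle_bound\<close>), or some edge is not adjacent to a four-cycle at all.

  These estimates are carried out for matrices, where every average is a finite sum. A kernel is
  reduced to this case by averaging it over the cells of an \<open>n \<times> n\<close> grid: this preserves the range
  and the mean, does not increase the cut norm, and changes the kernel by little in \<open>L\<^sup>1\<close> if \<open>n\<close> is
  suitable (\<open>step_approximation\<close>), hence changes its densities by little.
\<close>

section \<open>Averages over finitely many coordinates\<close>

definition avg :: "nat \<Rightarrow> (nat \<Rightarrow> real) \<Rightarrow> real" where
  "avg n f = (\<Sum>x<n. f x) / real n"

lemma avg_add: "avg n (\<lambda>x. f x + g x) = avg n f + avg n g"
  by (simp add: avg_def sum.distrib add_divide_distrib)
lemma avg_cmult: "avg n (\<lambda>x. c * f x) = c * avg n f"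
  by (simp add: avg_def sum_distrib_left)
lemma avg_multc: "avg n (\<lambda>x. f x * c) = avg n f * c"
  by (simp add: avg_def sum_distrib_right)
lemma avg_mono: "(\<And>x. f x \<le> g x) \<Longrightarrow> avg n f \<le> avg n g"
  by (simp add: avg_def divide_right_mono sum_mono)
lemma avg_const: "n > 0 \<Longrightarrow> avg n (\<lambda>x. c) = c"
  by (simp add: avg_def)
lemma avg_abs: "\<bar>avg n f\<bar> \<le> avg n (\<lambda>x. \<bar>f x\<bar>)"
  by (simp add: avg_def divide_right_mono)
lemma avg_swap: "avg n (\<lambda>x. avg m (\<lambda>y. f x y)) = avg m (\<lambda>y. avg n (\<lambda>x. f x y))"
  by (simp add: avg_def sum_divide_distrib[symmetric]) (subst sum.swap, simp add: mult.commute)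
lemma avg_nonneg: "(\<And>x. 0 \<le> f x) \<Longrightarrow> 0 \<le> avg n f"
  by (simp add: avg_def sum_nonneg)
lemma avg_square_prod: "avg n f * avg n g = avg n (\<lambda>x. avg n (\<lambda>y. f x * g y))"
  by (simp add: avg_cmult avg_multc)
lemma avg_CS: "(avg n (\<lambda>x. f x * g x))\<^sup>2 \<le> avg n (\<lambda>x. (f x)\<^sup>2) * avg n (\<lambda>x. (g x)\<^sup>2)"
  unfolding avg_def power_divide times_divide_times_eq power2_eq_square[of "real n"]
  by (intro divide_right_mono Cauchy_Schwarz_ineq_sum) auto

text \<open>Averaging out the coordinates in \<open>X\<close> while keeping the others: the result is again a function of
  the whole assignment, so this is a conditional expectation. Iterated integration becomes composition
  of these operators.\<close>

definition Av :: "nat \<Rightarrow> 'v set \<Rightarrow> (('v \<Rightarrow> nat) \<Rightarrow> real) \<Rightarrow> ('v \<Rightarrow> nat) \<Rightarrow> real" where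
  "Av n X F z = (\<Sum>y\<in>PiE X (\<lambda>_. {..<n}). F (override_on z y X)) / real n ^ card X"

definition indep :: "(('v \<Rightarrow> nat) \<Rightarrow> real) \<Rightarrow> 'v set \<Rightarrow> bool" where
  "indep F X \<longleftrightarrow> (\<forall>z. \<forall>v\<in>X. \<forall>x. F (z(v := x)) = F z)"

lemma Av_empty [simp]: "Av n {} F = F"
  by (rule ext) (simp add: Av_def)

lemma Av_insert_aux:
  assumes "finite X" "v \<notin> X"
  shows "Av n (insert v X) F z = avg n (\<lambda>x. (\<Sum>g\<in>PiE X (\<lambda>_. {..<n}). F ((override_on z g X)(v := x))) / real n ^ card X)"
proof -
  have "(\<Sum>y\<in>PiE (insert v X) (\<lambda>_. {..<n}). F (override_on z y (insert v X)))
     = (\<Sum>(x,g)\<in>{..<n} \<times> PiE X (\<lambda>_. {..<n}). F (override_on z (g(v := x)) (insert v X)))"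
    unfolding PiE_insert_eq using assms
    by (subst sum.reindex[OF inj_combinator]) (auto simp: case_prod_unfold)
  also have "\<dots> = (\<Sum>x<n. \<Sum>g\<in>PiE X (\<lambda>_. {..<n}). F (override_on z (g(v := x)) (insert v X)))"
    by (rule sum.cartesian_product[symmetric])
  also have "\<dots> = (\<Sum>x<n. \<Sum>g\<in>PiE X (\<lambda>_. {..<n}). F ((override_on z g X)(v := x)))"
    using assms by (intro sum.cong arg_cong[of _ _ F]) (auto simp: override_on_def fun_eq_iff)
  finally show ?thesis
    using assms by (simp add: Av_def avg_def sum_divide_distrib[symmetric] mult.commute)
qed

lemma Av_insert:
  assumes "finite X" "v \<notin> X"
  shows "Av n (insert v X) F z = avg n (\<lambda>x. Av n X F (z(v := x)))"
proof -
  have "(override_on z g X)(v := x) = override_on (z(v := x)) g X" for g x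
    using assms by (auto simp: override_on_def fun_eq_iff)
  then show ?thesis by (simp add: Av_insert_aux[OF assms]) (simp add: Av_def)
qed

lemma Av_sing: "Av n {v} F z = avg n (\<lambda>x. F (z(v := x)))"
  using Av_insert[of "{}" v n F z] by simp

lemma Av_Un:
  assumes "finite X" "finite Y" "X \<inter> Y = {}"
  shows "Av n (X \<union> Y) F = Av n X (Av n Y F)"
proof
  fix z show "Av n (X \<union> Y) F z = Av n X (Av n Y F) z"
    using assms(1,3)
  proof (induction X arbitrary: z rule: finite_induct)
    case (insert v X)
    then show ?case using assms(2) by (simp add: Av_insert)
  qed simp
qed

lemma Av_split_outer: "finite X \<Longrightarrow> Y \<subseteq> X \<Longrightarrow> Av n X F = Av n (X - Y) (Av n Y F)"
  using Av_Un[of "X - Y" Y n F] by (simp add: finite_subset Un_absorb2 Diff_disjoint Int_commute)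
lemma Av_split_inner: "finite X \<Longrightarrow> Y \<subseteq> X \<Longrightarrow> Av n X F = Av n Y (Av n (X - Y) F)"
  using Av_Un[of Y "X - Y" n F] by (simp add: finite_subset Un_absorb1)

lemma Av_add: "Av n X (\<lambda>z. F z + G z) z = Av n X F z + Av n X G z"
  by (simp add: Av_def sum.distrib add_divide_distrib)
lemma Av_sum: "Av n X (\<lambda>z. \<Sum>i\<in>I. F i z) z = (\<Sum>i\<in>I. Av n X (F i) z)"
  unfolding Av_def by (subst sum.swap) (simp add: sum_divide_distrib)
lemma Av_cmult: "Av n X (\<lambda>z. c * F z) z = c * Av n X F z"
  by (simp add: Av_def sum_distrib_left)
lemma Av_mono: "(\<And>z. F z \<le> G z) \<Longrightarrow> Av n X F z \<le> Av n X G z"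
  by (simp add: Av_def divide_right_mono sum_mono)
lemma Av_nonneg: "(\<And>z. 0 \<le> F z) \<Longrightarrow> 0 \<le> Av n X F z"
  by (simp add: Av_def sum_nonneg)
lemma Av_abs: "\<bar>Av n X F z\<bar> \<le> Av n X (\<lambda>z. \<bar>F z\<bar>) z"
  by (simp add: Av_def divide_right_mono)
lemma Av_const: "n > 0 \<Longrightarrow> finite X \<Longrightarrow> Av n X (\<lambda>z. c) z = c"
  by (simp add: Av_def card_PiE)
lemma Av_bound: "n > 0 \<Longrightarrow> finite X \<Longrightarrow> (\<And>z. \<bar>F z\<bar> \<le> c) \<Longrightarrow> \<bar>Av n X F z\<bar> \<le> c"
  using Av_mono[of "\<lambda>z. \<bar>F z\<bar>" "\<lambda>_. c" n X z] Av_abs[of n X F z] by (simp add: Av_const)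
lemma Av_CS: "(Av n X (\<lambda>z. F z * G z) z)\<^sup>2 \<le> Av n X (\<lambda>z. (F z)\<^sup>2) z * Av n X (\<lambda>z. (G z)\<^sup>2) z"
  unfolding Av_def power_divide times_divide_times_eq power2_eq_square[of "real n ^ card X"]
  by (intro divide_right_mono Cauchy_Schwarz_ineq_sum) auto

lemma indep_override:
  assumes "indep G X" "finite X" shows "G (override_on z y X) = G z"
proof -
  have "\<forall>Y. finite Y \<longrightarrow> Y \<subseteq> X \<longrightarrow> G (override_on z y Y) = G z"
  proof (intro allI impI)
    fix Y assume "finite Y" "Y \<subseteq> X"
    then show "G (override_on z y Y) = G z"
    proof (induction Y rule: finite_induct)
      case (insert v Y)
      have *: "override_on z y (insert v Y) = (override_on z y Y)(v := y v)"
        by (auto simp: override_on_def)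
      show ?case using insert assms(1) unfolding * by (auto simp del: fun_upd_apply simp: indep_def)
    qed simp
  qed
  then show ?thesis using assms(2) by simp
qed

lemma Av_mult_indep:
  assumes "indep G X" "finite X"
  shows "Av n X (\<lambda>z. G z * F z) z = G z * Av n X F z"
  using indep_override[OF assms] by (simp add: Av_def sum_distrib_left)
lemma Av_mult_indep2:
  assumes "indep G X" "finite X"
  shows "Av n X (\<lambda>z. F z * G z) z = Av n X F z * G z"
  using Av_mult_indep[OF assms, of n F z] by (simp add: mult.commute)
lemma Av_indep:
  assumes "n > 0" "indep G X" "finite X" shows "Av n X G z = G z"
  using Av_mult_indep[OF assms(2,3), of n "\<lambda>_. 1" z] assms by (simp add: Av_const)

lemma indep_mono: "indep F X \<Longrightarrow> Y \<subseteq> X \<Longrightarrow> indep F Y"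
  by (auto simp: indep_def)
lemma indep_mult: "indep F X \<Longrightarrow> indep G X \<Longrightarrow> indep (\<lambda>z. F z * G z) X"
  by (auto simp: indep_def)
lemma indep_comp: "indep F X \<Longrightarrow> indep (\<lambda>z. h (F z)) X"
  by (auto simp: indep_def)
lemma indep_prod: "(\<And>i. i \<in> I \<Longrightarrow> indep (F i) X) \<Longrightarrow> indep (\<lambda>z. \<Prod>i\<in>I. F i z) X"
  by (auto simp: indep_def intro!: prod.cong)
lemma indep_const: "indep (\<lambda>_. c) X"
  by (simp add: indep_def)
lemma indep_Av:
  assumes "indep F (Y - X)" shows "indep (Av n X F) Y"
  unfolding indep_def
proof (intro allI ballI)
  fix z v x assume v: "v \<in> Y"
  show "Av n X F (z(v := x)) = Av n X F z"
  proof (cases "v \<in> X")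
    case True
    then have "override_on (z(v := x)) y X = override_on z y X" for y
      by (auto simp: override_on_def)
    then show ?thesis by (simp add: Av_def)
  next
    case False
    then have "override_on (z(v := x)) y X = (override_on z y X)(v := x)" for y
      by (auto simp: override_on_def)
    then show ?thesis using assms v False by (simp add: Av_def indep_def)
  qed
qed

text \<open>The sign of an inner average is constant in the coordinates that are averaged out, so it can be
  moved inside. In this way absolute values become averages with an extra weight, to which smallness
  of signed averages applies.\<close>

lemma Av_cond_abs:
  assumes "finite X" "finite Y" "X \<inter> Y = {}"
  shows "Av n X (\<lambda>z. \<bar>Av n Y F z\<bar>) z = Av n (X \<union> Y) (\<lambda>z. sgn (Av n Y F z) * F z) z"
proof -
  have "indep (\<lambda>z. sgn (Av n Y F z)) Y"
    by (intro indep_comp[of "Av n Y F" Y sgn] indep_Av) (simp add: indep_def)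
  then have "Av n Y (\<lambda>z. sgn (Av n Y F z) * F z) z = \<bar>Av n Y F z\<bar>" for z
    using assms(2) by (subst Av_mult_indep) (simp_all add: sgn_mult_self_eq abs_sgn[of "Av n Y F z"] mult.commute)
  then have "Av n Y (\<lambda>z. sgn (Av n Y F z) * F z) = (\<lambda>z. \<bar>Av n Y F z\<bar>)" ..
  then show ?thesis using assms by (simp add: Av_Un)
qed

section \<open>Bounded kernels on a finite square\<close>

text \<open>What is kept of \<open>W - 1\<close> for a cell average of \<open>W\<close>. A bound on the cut norm is used in the form in
  which arbitrary weights in \<open>[-1, 1]\<close> replace indicators of sets.\<close>

locale signed_kernel =
  fixes n :: nat and U :: "nat \<Rightarrow> nat \<Rightarrow> real" and eta :: real
  assumes n_pos: "n > 0"
    and U_bound: "\<bar>U x y\<bar> \<le> 1"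
    and U_mean: "avg n (\<lambda>x. avg n (\<lambda>y. U x y)) = 0"
    and U_cut: "(\<And>x. \<bar>p x\<bar> \<le> 1) \<Longrightarrow> (\<And>y. \<bar>q y\<bar> \<le> 1) \<Longrightarrow>
      \<bar>avg n (\<lambda>x. avg n (\<lambda>y. U x y * p x * q y))\<bar> \<le> eta"
begin

text \<open>The kernel read from a node on the side \<open>s\<close>: \<open>U\<close> for a left node and its transpose for a right
  node. All estimates are then proved for both sides at once.\<close>

definition M :: "bool \<Rightarrow> nat \<Rightarrow> nat \<Rightarrow> real" where
  "M s x y = (if s then U x y else U y x)"

lemma M_flip: "M (\<not> s) x y = M s y x"
  by (simp add: M_def)
lemma M_bound: "\<bar>M s x y\<bar> \<le> 1"
  by (simp add: M_def U_bound)
lemma M_mean: "avg n (\<lambda>x. avg n (\<lambda>y. M s x y)) = 0"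
  using U_mean avg_swap[of n n U] by (cases s) (simp_all add: M_def)
lemma M_cut:
  assumes "\<And>x. \<bar>p x\<bar> \<le> 1" "\<And>y. \<bar>q y\<bar> \<le> 1"
  shows "\<bar>avg n (\<lambda>x. avg n (\<lambda>y. M s x y * p x * q y))\<bar> \<le> eta"
proof (cases s)
  case False
  have "avg n (\<lambda>x. avg n (\<lambda>y. M s x y * p x * q y)) = avg n (\<lambda>y. avg n (\<lambda>x. U y x * q y * p x))"
    using False by (subst avg_swap) (simp add: M_def mult_ac)
  then show ?thesis using U_cut[of q p] assms by simp
qed (use U_cut[of p q] assms in \<open>simp add: M_def\<close>)

lemma eta_nonneg: "0 \<le> eta"
  using U_cut[of "\<lambda>_. 0" "\<lambda>_. 0"] by simp

text \<open>The kernel of a path that starts on the side \<open>s\<close> and whose inner vertices carry the weights \<open>ws\<close>;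
  as an operator, an alternating product of \<open>U\<close>, its transpose, and diagonal matrices.\<close>

fun path_kernel :: "bool \<Rightarrow> (nat \<Rightarrow> real) list \<Rightarrow> nat \<Rightarrow> nat \<Rightarrow> real" where
  "path_kernel s [] x y = M s x y"
| "path_kernel s (w # ws) x y = avg n (\<lambda>p. M s x p * w p * path_kernel (\<not> s) ws p y)"

text \<open>The squared Hilbert--Schmidt norm of a weighted path. If all weights are 1, this is the density of
  the cycle formed by two copies of the path.\<close>

definition path_sq :: "bool \<Rightarrow> (nat \<Rightarrow> real) list \<Rightarrow> real" where
  "path_sq s ws = avg n (\<lambda>x. avg n (\<lambda>y. (path_kernel s ws x y)\<^sup>2))"

definition end_side :: "bool \<Rightarrow> (nat \<Rightarrow> real) list \<Rightarrow> bool" where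
  "end_side s ws = (if even (length ws) then s else \<not> s)"

definition unit_weights :: "(nat \<Rightarrow> real) list \<Rightarrow> bool" where
  "unit_weights ws \<longleftrightarrow> (\<forall>w\<in>set ws. \<forall>x. \<bar>w x\<bar> \<le> 1)"

lemma avg_bound: "(\<And>x. \<bar>f x\<bar> \<le> c) \<Longrightarrow> \<bar>avg n f\<bar> \<le> c"
  using avg_mono[of "\<lambda>x. \<bar>f x\<bar>" "\<lambda>_. c" n] avg_abs[of n f] n_pos by (simp add: avg_const)

lemma mult_abs_le1: "\<bar>a\<bar> \<le> 1 \<Longrightarrow> \<bar>b\<bar> \<le> 1 \<Longrightarrow> \<bar>a * b\<bar> \<le> (1::real)"
  by (simp add: abs_mult mult_le_one)

lemma path_kernel_bound: "unit_weights ws \<Longrightarrow> \<bar>path_kernel s ws x y\<bar> \<le> 1"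
  by (induction ws arbitrary: s x)
     (auto simp: M_bound unit_weights_def intro!: avg_bound mult_abs_le1)

lemma path_kernel_snoc:
  "path_kernel s (ws @ [w]) x y = avg n (\<lambda>q. path_kernel s ws x q * w q * M (end_side (\<not> s) ws) q y)"
proof (induction ws arbitrary: s x)
  case (Cons v ws)
  have "path_kernel s ((v # ws) @ [w]) x y
      = avg n (\<lambda>p. avg n (\<lambda>q. M s x p * v p * (path_kernel (\<not> s) ws p q * w q * M (end_side s ws) q y)))"
    using Cons[of "\<not> s"] by (simp add: avg_cmult)
  also have "\<dots> = avg n (\<lambda>q. avg n (\<lambda>p. M s x p * v p * path_kernel (\<not> s) ws p q * (w q * M (end_side s ws) q y)))"
    by (subst avg_swap) (simp add: mult_ac)
  also have "\<dots> = avg n (\<lambda>q. avg n (\<lambda>p. M s x p * v p * path_kernel (\<not> s) ws p q) * (w q * M (end_side s ws) q y))"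
    by (simp only: avg_multc)
  finally show ?case by (simp add: end_side_def mult_ac)
qed (simp add: end_side_def)

lemma path_sq_nonneg: "0 \<le> path_sq s ws"
  by (simp add: path_sq_def avg_nonneg)

lemma path_sq_le1: "unit_weights ws \<Longrightarrow> path_sq s ws \<le> 1"
proof -
  assume "unit_weights ws"
  then have "\<bar>path_sq s ws\<bar> \<le> 1"
    unfolding path_sq_def
    by (intro avg_bound) (metis path_kernel_bound abs_power2 power2_abs abs_le_square_iff abs_ge_zero abs_of_nonneg one_power2 abs_one)
  then show ?thesis by simp
qed

lemma avg2_CS:
  "(avg n (\<lambda>x. avg n (\<lambda>y. f x y * g x y)))\<^sup>2
    \<le> avg n (\<lambda>x. avg n (\<lambda>y. (f x y)\<^sup>2)) * avg n (\<lambda>x. avg n (\<lambda>y. (g x y)\<^sup>2))"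
proof -
  have eq: "avg n (\<lambda>x. avg n (\<lambda>y. h x y)) = (\<Sum>(x,y)\<in>{..<n}\<times>{..<n}. h x y) / (real n)\<^sup>2" for h
    by (simp add: avg_def sum_divide_distrib[symmetric] sum.cartesian_product power2_eq_square)
  show ?thesis
    unfolding eq power_divide times_divide_times_eq power2_eq_square[of "(real n)\<^sup>2"]
    using Cauchy_Schwarz_ineq_sum[of "\<lambda>(x,y). f x y" "\<lambda>(x,y). g x y" "{..<n}\<times>{..<n}"]
    by (intro divide_right_mono) (auto simp: case_prod_unfold)
qed

lemma avg4_rearrange:
  "avg n (\<lambda>x. avg n (\<lambda>y. avg n (\<lambda>p. avg n (\<lambda>q. h x y p q))))
   = avg n (\<lambda>p. avg n (\<lambda>q. avg n (\<lambda>y. avg n (\<lambda>x. h x y p q))))"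
proof -
  have "avg n (\<lambda>x. avg n (\<lambda>y. avg n (\<lambda>p. avg n (\<lambda>q. h x y p q))))
     = avg n (\<lambda>y. avg n (\<lambda>x. avg n (\<lambda>p. avg n (\<lambda>q. h x y p q))))"
    by (rule avg_swap)
  also have "\<dots> = avg n (\<lambda>y. avg n (\<lambda>p. avg n (\<lambda>x. avg n (\<lambda>q. h x y p q))))"
    by (subst avg_swap) (rule refl)
  also have "\<dots> = avg n (\<lambda>p. avg n (\<lambda>y. avg n (\<lambda>q. avg n (\<lambda>x. h x y p q))))"
    by (subst avg_swap, subst (3) avg_swap) (rule refl)
  also have "\<dots> = avg n (\<lambda>p. avg n (\<lambda>q. avg n (\<lambda>y. avg n (\<lambda>x. h x y p q))))"
    by (subst (2) avg_swap) (rule refl)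
  finally show ?thesis .
qed

text \<open>The square of a path kernel is a cycle whose weights are symmetric about the axis through the two
  end vertices. Cutting this cycle at the neighbouring antipodal pair of vertices gives two different
  paths, each of which has a weight 1 that comes from an end vertex of the original path.\<close>

lemma path_sq_rotate_eq:
  assumes "length us = length vs" and eq: "w # us = vs @ [v]"
  shows "path_sq s (w # us)
    = avg n (\<lambda>p. avg n (\<lambda>q. w p * v q * (path_kernel (\<not> s) (us @ [\<lambda>_. 1]) p q * path_kernel (\<not> s) ((\<lambda>_. 1) # vs) p q)))"
proof -
  let ?e = "end_side (\<not> s) vs"
  have "path_sq s (w # us)
     = avg n (\<lambda>x. avg n (\<lambda>y. path_kernel s (w # us) x y * path_kernel s (vs @ [v]) x y))"
    using eq by (simp add: path_sq_def power2_eq_square)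
  also have "\<dots> = avg n (\<lambda>x. avg n (\<lambda>y. avg n (\<lambda>p. avg n (\<lambda>q.
        M s x p * w p * path_kernel (\<not> s) us p y * (path_kernel s vs x q * v q * M ?e q y)))))"
    by (simp add: path_kernel_snoc avg_cmult avg_multc)
  also have "\<dots> = avg n (\<lambda>p. avg n (\<lambda>q. avg n (\<lambda>y. avg n (\<lambda>x.
        M s x p * w p * path_kernel (\<not> s) us p y * (path_kernel s vs x q * v q * M ?e q y)))))"
    by (rule avg4_rearrange)
  also have "\<dots> = avg n (\<lambda>p. avg n (\<lambda>q. avg n (\<lambda>y. avg n (\<lambda>x.
        w p * v q * ((path_kernel (\<not> s) us p y * M ?e q y) * (M s x p * path_kernel s vs x q)))))) "
    by (simp add: mult_ac)
  also have "\<dots> = avg n (\<lambda>p. avg n (\<lambda>q. w p * v q *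
        (avg n (\<lambda>y. path_kernel (\<not> s) us p y * M ?e q y) * avg n (\<lambda>x. M s x p * path_kernel s vs x q))))"
    by (simp only: avg_cmult avg_multc)
  also have "(\<lambda>p q. avg n (\<lambda>x. M s x p * path_kernel s vs x q)) = path_kernel (\<not> s) ((\<lambda>_. 1) # vs)"
    using M_flip[of s] by (intro ext) simp
  then have "(\<lambda>p q. avg n (\<lambda>x. M s x p * path_kernel s vs x q)) = path_kernel (\<not> s) ((\<lambda>_. 1) # vs)" .
  moreover have "(\<lambda>p q. avg n (\<lambda>y. path_kernel (\<not> s) us p y * M ?e q y)) = path_kernel (\<not> s) (us @ [\<lambda>_. 1])"
    using M_flip[of ?e] assms(1) by (intro ext) (auto simp: path_kernel_snoc end_side_def M_def)
  ultimately show ?thesis by (simp add: fun_eq_iff)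
qed

text \<open>Cauchy--Schwarz for the rotated cycle. The first factor has one more trailing weight 1 than before;
  the second factor is only known to be another weighted path of the same length.\<close>

lemma path_sq_rotate:
  assumes "length us = length vs" and eq: "w # us = vs @ [v]" and "unit_weights (w # us)"
  shows "(path_sq s (w # us))\<^sup>2 \<le> path_sq (\<not> s) (us @ [\<lambda>_. 1]) * path_sq (\<not> s) ((\<lambda>_. 1) # vs)"
proof -
  have w: "\<bar>w x\<bar> \<le> 1" "\<bar>v x\<bar> \<le> 1" for x
    using assms(3) unfolding unit_weights_def by simp (metis assms(3) eq in_set_conv_decomp unit_weights_def)
  have "(path_sq s (w # us))\<^sup>2 \<le>
     avg n (\<lambda>p. avg n (\<lambda>q. (w p * v q * path_kernel (\<not> s) (us @ [\<lambda>_. 1]) p q)\<^sup>2)) * path_sq (\<not> s) ((\<lambda>_. 1) # vs)"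
    unfolding path_sq_rotate_eq[OF assms(1,2)] path_sq_def[of "\<not> s" "_ # vs"] mult.assoc[symmetric]
    by (rule avg2_CS)
  also have "(w p * v q * path_kernel (\<not> s) (us @ [\<lambda>_. 1]) p q)\<^sup>2 \<le> (path_kernel (\<not> s) (us @ [\<lambda>_. 1]) p q)\<^sup>2" for p q
  proof -
    have "(w p * v q)\<^sup>2 \<le> 1"
      using mult_abs_le1[OF w(1)[of p] w(2)[of q]] by (simp add: abs_square_le_1)
    then show ?thesis
      by (simp add: power_mult_distrib[of "w p * v q"] mult_left_le_one_le)
  qed
  then have "avg n (\<lambda>p. avg n (\<lambda>q. (w p * v q * path_kernel (\<not> s) (us @ [\<lambda>_. 1]) p q)\<^sup>2))
      \<le> path_sq (\<not> s) (us @ [\<lambda>_. 1])"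
    unfolding path_sq_def by (intro avg_mono)
  finally show ?thesis using path_sq_nonneg by (simp add: mult_right_mono)
qed

text \<open>Weights in \<open>[-1, 1]\<close> do not increase the norm of a path beyond the larger of its two unweighted
  norms. Let \<open>s\<^sub>k\<close> be the supremum over all weighted paths with at least \<open>k\<close> trailing weights 1.
  Rotation gives \<open>s\<^sub>k\<^sup>2 \<le> s\<^sub>k\<^sub>+\<^sub>1 s\<^sub>0\<close>, so if \<open>s\<^sub>k\<close> equals \<open>s\<^sub>0\<close> then so does \<open>s\<^sub>k\<^sub>+\<^sub>1\<close>. In the end all
  weights are 1.\<close>

theorem path_sq_le:
  assumes "unit_weights ws"
    and g: "\<And>s. path_sq s (replicate (length ws) (\<lambda>_. 1)) \<le> g"
  shows "path_sq s ws \<le> g"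
proof -
  define l where "l = length ws"
  define A where "A k = {path_sq s (us @ replicate k (\<lambda>_. 1)) | s us. length us + k = l \<and> unit_weights us}" for k
  have uw: "unit_weights us \<Longrightarrow> unit_weights (us @ replicate k (\<lambda>_. 1))" for us k
    by (auto simp: unit_weights_def)
  have bdd: "bdd_above (A k)" for k
    unfolding A_def by (rule bdd_aboveI[of _ 1]) (auto intro: path_sq_le1 uw)
  have sub: "A k \<subseteq> A 0" for k
  proof
    fix t assume "t \<in> A k"
    then obtain s us where "t = path_sq s (us @ replicate k (\<lambda>_. 1))" "length us + k = l" "unit_weights us"
      by (auto simp: A_def)
    then show "t \<in> A 0" unfolding A_def
      by (intro CollectI exI[of _ s] exI[of _ "us @ replicate k (\<lambda>_. 1)"]) (auto intro: uw)
  qed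
  define Sp where "Sp = Sup (A 0)"
  have in_A: "path_sq s' us \<le> Sp" if "length us = l" "unit_weights us" for s' us
    unfolding Sp_def using that by (intro cSup_upper bdd) (auto simp: A_def)
  have ne: "A k \<noteq> {}" if "k \<le> l" for k
    \<comment> \<open>The zero weights serve as a witness that the supremum is over a nonempty set.\<close>
    using that by (auto simp: A_def unit_weights_def intro!: exI[of _ "replicate (l - k) (\<lambda>_. 0)"])
  have Sp0: "0 \<le> Sp"
    using in_A[OF l_def[symmetric] assms(1), of s] path_sq_nonneg[of s ws] by linarith
  have key: "k \<le> l \<Longrightarrow> Sp \<le> Sup (A k)" for k
  proof (induction k)
    case (Suc k)
    define T where "T = Sup (A (Suc k))"
    have T: "t \<le> T" if "t \<in> A (Suc k)" for t unfolding T_def using that by (intro cSup_upper bdd)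
    have T0: "0 \<le> T"
      using ne[OF Suc.prems] T by (fastforce simp: A_def intro: order_trans[OF path_sq_nonneg])
    have *: "t\<^sup>2 \<le> T * Sp" "t \<ge> 0" if tA: "t \<in> A k" for t
    proof -
      obtain s us where t: "t = path_sq s (us @ replicate k (\<lambda>_. 1))" "length us + k = l" "unit_weights us"
        using tA by (auto simp: A_def)
      show "t \<ge> 0" using t path_sq_nonneg by simp
      obtain w us' where us: "us = w # us'" using t Suc.prems by (cases us) auto
      let ?L = "us' @ replicate k (\<lambda>_. 1::real)"
      obtain vs v where vs: "w # ?L = vs @ [v]" by (metis rev_exhaust list.distinct(1))
      then have len: "length ?L = length vs"
        by (metis length_append_singleton length_Cons Suc_inject)
      have u1: "unit_weights (w # ?L)" using uw[OF t(3), of k] us by simp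
      have u2: "unit_weights ((\<lambda>_. 1) # vs)" using u1 unfolding vs by (auto simp: unit_weights_def)
      have "t\<^sup>2 \<le> path_sq (\<not> s) (?L @ [\<lambda>_. 1]) * path_sq (\<not> s) ((\<lambda>_. 1) # vs)"
        using path_sq_rotate[OF len vs u1, of s] t us by simp
      also have "\<dots> \<le> T * Sp"
      proof (intro mult_mono T0 path_sq_nonneg)
        have "?L @ [\<lambda>_. 1] = us' @ replicate (Suc k) (\<lambda>_. 1)"
          by (simp add: replicate_append_same)
        moreover have "unit_weights us'" using t us by (auto simp: unit_weights_def)
        ultimately show "path_sq (\<not> s) (?L @ [\<lambda>_. 1]) \<le> T"
          using t us by (intro T) (auto simp: A_def)
        show "path_sq (\<not> s) ((\<lambda>_. 1) # vs) \<le> Sp"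
          using t us len by (intro in_A u2) simp
      qed
      finally show "t\<^sup>2 \<le> T * Sp" .
    qed
    have "t \<le> sqrt (T * Sp)" if "t \<in> A k" for t
      using *[OF that] by (simp add: real_le_rsqrt)
    then have "Sup (A k) \<le> sqrt (T * Sp)"
      using ne[of k] Suc.prems by (intro cSup_least) auto
    then have "Sp \<le> sqrt (T * Sp)" using Suc by simp
    then have "Sp * Sp \<le> T * Sp"
      using Sp0 T0 by (metis power2_eq_square power_mono real_sqrt_pow2 mult_nonneg_nonneg)
    then show ?case using Sp0 T0 unfolding T_def by (cases "Sp = 0") auto
  qed (simp add: Sp_def)
  have "Sup (A l) \<le> g"
    using ne[of l] g by (intro cSup_least) (auto simp: A_def l_def)
  then show ?thesis
    using key[of l] in_A[OF l_def[symmetric] assms(1), of s] by simp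
qed

end

context signed_kernel
begin

definition codeg :: "bool \<Rightarrow> nat \<Rightarrow> nat \<Rightarrow> real" where
  "codeg s y y' = avg n (\<lambda>x. M s x y * M s x y')"

lemma codeg_sym: "codeg s y y' = codeg s y' y"
  by (simp add: codeg_def mult.commute)

lemma codeg_L1: "avg n (\<lambda>y'. \<bar>codeg s y y'\<bar>) \<le> eta"
proof -
  have "avg n (\<lambda>y'. \<bar>codeg s y y'\<bar>)
      = avg n (\<lambda>x. avg n (\<lambda>y'. M s x y' * M s x y * sgn (codeg s y y')))"
    by (subst avg_swap) (simp add: abs_sgn avg_multc[symmetric] codeg_def mult_ac)
  also have "\<bar>\<dots>\<bar> \<le> eta"
    by (rule M_cut) (simp_all add: M_bound abs_sgn_eq)
  finally show ?thesis by simp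
qed

text \<open>A kernel that is small against bounded functions is also small as an operator on \<open>L\<^sup>2\<close>: its
  square has rows of small \<open>L\<^sup>1\<close> norm by \<open>codeg_L1\<close>, and Schur's test applies.\<close>

lemma operator_bound:
  "(avg n (\<lambda>x. avg n (\<lambda>y. f x * g y * M s x y)))\<^sup>2 \<le> eta * avg n (\<lambda>x. (f x)\<^sup>2) * avg n (\<lambda>y. (g y)\<^sup>2)"
proof -
  define T where "T x = avg n (\<lambda>y. g y * M s x y)" for x
  have "avg n (\<lambda>x. (T x)\<^sup>2) = avg n (\<lambda>x. avg n (\<lambda>y. avg n (\<lambda>y'. g y * g y' * (M s x y * M s x y'))))"
    by (simp add: power2_eq_square T_def avg_square_prod mult_ac)
  also have "\<dots> = avg n (\<lambda>y. avg n (\<lambda>y'. avg n (\<lambda>x. g y * g y' * (M s x y * M s x y'))))"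
    by (subst avg_swap, subst (2) avg_swap) (rule refl)
  also have "\<dots> = avg n (\<lambda>y. avg n (\<lambda>y'. g y * g y' * codeg s y y'))"
    by (simp only: avg_cmult codeg_def)
  also have "\<dots> \<le> avg n (\<lambda>y. avg n (\<lambda>y'. (g y)\<^sup>2 * \<bar>codeg s y y'\<bar> / 2 + (g y')\<^sup>2 * \<bar>codeg s y y'\<bar> / 2))"
  proof (intro avg_mono)
    fix y y'
    have "\<bar>g y * g y'\<bar> \<le> ((g y)\<^sup>2 + (g y')\<^sup>2) / 2"
      using sum_squares_bound[of "\<bar>g y\<bar>" "\<bar>g y'\<bar>"] by (simp add: abs_mult)
    from mult_right_mono[OF this, of "\<bar>codeg s y y'\<bar>"]
    show "g y * g y' * codeg s y y' \<le> (g y)\<^sup>2 * \<bar>codeg s y y'\<bar> / 2 + (g y')\<^sup>2 * \<bar>codeg s y y'\<bar> / 2"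
      by (simp add: abs_mult[symmetric] field_simps)
  qed
  also have "\<dots> = avg n (\<lambda>y. avg n (\<lambda>y'. (g y)\<^sup>2 * \<bar>codeg s y y'\<bar> / 2))
       + avg n (\<lambda>y'. avg n (\<lambda>y. (g y')\<^sup>2 * \<bar>codeg s y' y\<bar> / 2))"
    by (subst (3) avg_swap) (simp add: avg_add codeg_sym)
  also have "\<dots> = avg n (\<lambda>y. (g y)\<^sup>2 * avg n (\<lambda>y'. \<bar>codeg s y y'\<bar>))"
    by (simp only: mult_2[symmetric] avg_cmult[symmetric]) simp
  also have "\<dots> \<le> avg n (\<lambda>y. eta * (g y)\<^sup>2)"
    using codeg_L1 by (intro avg_mono) (simp add: mult.commute[of eta] mult_left_mono)
  finally have T: "avg n (\<lambda>x. (T x)\<^sup>2) \<le> eta * avg n (\<lambda>y. (g y)\<^sup>2)" by (simp add: avg_cmult)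
  have "avg n (\<lambda>x. avg n (\<lambda>y. f x * g y * M s x y)) = avg n (\<lambda>x. f x * T x)"
    by (simp add: T_def avg_cmult mult.assoc)
  then have "(avg n (\<lambda>x. avg n (\<lambda>y. f x * g y * M s x y)))\<^sup>2 \<le> avg n (\<lambda>x. (f x)\<^sup>2) * avg n (\<lambda>x. (T x)\<^sup>2)"
    using avg_CS by simp
  also have "\<dots> \<le> avg n (\<lambda>x. (f x)\<^sup>2) * (eta * avg n (\<lambda>y. (g y)\<^sup>2))"
    using T by (intro mult_left_mono avg_nonneg) auto
  finally show ?thesis by (simp add: mult_ac)
qed

lemma path2_sq_eq:
  "avg n (\<lambda>x. avg n (\<lambda>x'. (avg n (\<lambda>y. M s x y * M s x' y * h y))\<^sup>2))
    = avg n (\<lambda>y. avg n (\<lambda>y'. h y * h y' * (codeg s y y')\<^sup>2))"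
proof -
  have "avg n (\<lambda>x. avg n (\<lambda>x'. (avg n (\<lambda>y. M s x y * M s x' y * h y))\<^sup>2))
     = avg n (\<lambda>x. avg n (\<lambda>x'. avg n (\<lambda>y. avg n (\<lambda>y'. h y * h y' * ((M s x y * M s x y') * (M s x' y * M s x' y'))))))"
    by (simp add: power2_eq_square avg_square_prod mult_ac)
  also have "\<dots> = avg n (\<lambda>y. avg n (\<lambda>y'. avg n (\<lambda>x'. avg n (\<lambda>x. h y * h y' * ((M s x y * M s x y') * (M s x' y * M s x' y'))))))"
    by (rule avg4_rearrange)
  also have "\<dots> = avg n (\<lambda>y. avg n (\<lambda>y'. h y * h y' * (codeg s y y')\<^sup>2))"
    by (simp only: avg_cmult avg_multc power2_eq_square codeg_def)
  finally show ?thesis .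
qed

text \<open>For paths of length two the weight at the middle vertex can be kept to the first power, because the
  kernel of the resulting form in the weights, the squared codegree, is nonnegative. This matters when
  the weight is not small at each point but only after averaging over a further coordinate.\<close>

lemma path2_sq_bound:
  assumes "\<And>y. \<bar>h y\<bar> \<le> 1"
  shows "avg n (\<lambda>x. avg n (\<lambda>x'. (avg n (\<lambda>y. M s x y * M s x' y * h y))\<^sup>2))
    \<le> avg n (\<lambda>y. \<bar>h y\<bar> * avg n (\<lambda>y'. (codeg s y y')\<^sup>2))"
  unfolding path2_sq_eq avg_cmult[symmetric]
proof (intro avg_mono mult_right_mono)
  fix y y'
  have "h y * h y' \<le> \<bar>h y\<bar> * \<bar>h y'\<bar>" by (simp add: abs_mult[symmetric])
  also have "\<dots> \<le> \<bar>h y\<bar> * 1" using assms by (intro mult_left_mono) auto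
  finally show "h y * h y' \<le> \<bar>h y\<bar>" by simp
qed auto

lemma codeg_sq_eq: "avg n (\<lambda>y. avg n (\<lambda>y'. (codeg s y y')\<^sup>2)) = path_sq s [\<lambda>_. 1]"
  using path2_sq_eq[of s "\<lambda>_. 1"] by (simp add: path_sq_def M_flip)

end

section \<open>Edge products and signed densities\<close>

locale bip_kernel = signed_kernel n U eta
  for n U eta +
  fixes side :: "'v \<Rightarrow> bool"
begin

text \<open>Edges are unordered pairs here, so that left and right nodes enter symmetrically; the sides of a
  node are recovered from the predicate \<open>side\<close>.\<close>

definition bip :: "'v set set \<Rightarrow> bool" where
  "bip D \<longleftrightarrow> finite D \<and> (\<forall>e\<in>D. \<exists>u v. e = {u, v} \<and> side u \<and> \<not> side v)"

text \<open>The value of the kernel at an edge. The definite descriptions select its left and its right end.\<close>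

definition fac :: "'v set \<Rightarrow> ('v \<Rightarrow> nat) \<Rightarrow> real" where
  "fac e z = U (z (THE u. u \<in> e \<and> side u)) (z (THE v. v \<in> e \<and> \<not> side v))"

definition edge_prod :: "'v set set \<Rightarrow> ('v \<Rightarrow> nat) \<Rightarrow> real" where
  "edge_prod D z = (\<Prod>e\<in>D. fac e z)"

text \<open>The signed density. It does not depend on the base point, nor on further averaging over isolated
  nodes, by \<open>t_eq\<close>.\<close>

definition t :: "'v set set \<Rightarrow> real" where
  "t D = Av n (\<Union>D) (edge_prod D) (\<lambda>_. 0)"

definition inc :: "'v set set \<Rightarrow> 'v \<Rightarrow> 'v set set" where
  "inc D v = {e \<in> D. v \<in> e}"

definition deg_fun :: "bool \<Rightarrow> nat \<Rightarrow> real" where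
  "deg_fun s x = avg n (\<lambda>y. M s x y)"

definition alpha :: "bool \<Rightarrow> real" where
  "alpha s = avg n (\<lambda>x. (deg_fun s x)\<^sup>2)"

lemma fac_eq:
  assumes "side u \<noteq> side v" shows "fac {u, v} z = M (side u) (z u) (z v)"
proof (cases "side u")
  case True
  then have "(THE x. x \<in> {u, v} \<and> side x) = u" "(THE x. x \<in> {u, v} \<and> \<not> side x) = v"
    using assms by (intro the_equality; auto)+
  then show ?thesis using True by (simp add: fac_def M_def)
next
  case False
  then have "(THE x. x \<in> {u, v} \<and> side x) = v" "(THE x. x \<in> {u, v} \<and> \<not> side x) = u"
    using assms by (intro the_equality; auto)+
  then show ?thesis using False by (simp add: fac_def M_def)
qed

lemma fac_bound: "\<bar>fac e z\<bar> \<le> 1"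
  by (simp add: fac_def U_bound)
lemma edge_prod_bound: "\<bar>edge_prod D z\<bar> \<le> 1"
  by (simp add: edge_prod_def abs_prod fac_bound prod_le_1)

lemma bip_edge:
  assumes "bip D" "{u, v} \<in> D" shows "side u \<noteq> side v" "u \<noteq> v"
  using assms by (auto simp: bip_def doubleton_eq_iff)
lemma bip_edgeE:
  assumes "bip D" "e \<in> D" "u \<in> e" obtains v where "e = {u, v}" "side u \<noteq> side v" "u \<noteq> v"
proof -
  obtain x y where "e = {x, y}" "side x" "\<not> side y" using assms by (auto simp: bip_def)
  then show ?thesis using that[of x] that[of y] assms(3) by (auto simp: insert_commute)
qed
lemma bip_subset: "bip D \<Longrightarrow> D' \<subseteq> D \<Longrightarrow> bip D'"
  by (auto simp: bip_def finite_subset)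
lemma bip_finite: "bip D \<Longrightarrow> finite D"
  by (simp add: bip_def)
lemma bip_finite_Un: "bip D \<Longrightarrow> finite (\<Union>D)"
  by (fastforce simp: bip_def)

lemma fac_indep: 
  assumes "bip D" "e \<in> D" "e \<inter> X = {}" shows "indep (fac e) X"
proof -
  obtain u v where e: "e = {u, v}" "side u" "\<not> side v" using assms by (auto simp: bip_def)
  then show ?thesis using assms(3) by (auto simp: indep_def fac_eq)
qed

lemma edge_prod_indep:
  assumes "bip D" "D' \<subseteq> D" "\<And>e. e \<in> D' \<Longrightarrow> e \<inter> X = {}" shows "indep (edge_prod D') X"
  unfolding edge_prod_def using assms(2,3) by (intro indep_prod fac_indep[OF assms(1)]) blast+

lemma edge_prod_split:
  assumes "finite D" "D' \<subseteq> D" shows "edge_prod D z = edge_prod D' z * edge_prod (D - D') z"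
  using prod.subset_diff[OF assms(2,1)] by (simp add: edge_prod_def mult.commute)
lemma edge_prod_Un:
  assumes "finite D" "finite D'" "D \<inter> D' = {}" shows "edge_prod (D \<union> D') z = edge_prod D z * edge_prod D' z"
  using assms by (simp add: edge_prod_def prod.union_disjoint)
lemma edge_prod_insert: "finite D \<Longrightarrow> e \<notin> D \<Longrightarrow> edge_prod (insert e D) z = fac e z * edge_prod D z"
  by (simp add: edge_prod_def)
lemma edge_prod_empty [simp]: "edge_prod {} z = 1"
  by (simp add: edge_prod_def)

lemma t_eq:
  assumes "bip D" "finite X" "\<Union>D \<subseteq> X" shows "Av n X (edge_prod D) z = t D"
proof -
  have i: "indep (edge_prod D) (X - \<Union>D)" by (rule edge_prod_indep[OF assms(1)]) auto
  have "Av n X (edge_prod D) z = Av n (\<Union>D) (Av n (X - \<Union>D) (edge_prod D)) z"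
    using assms by (simp add: Av_split_inner)
  also have "Av n (X - \<Union>D) (edge_prod D) = edge_prod D"
    using i assms n_pos by (auto simp: Av_indep fun_eq_iff)
  also have "Av n (\<Union>D) (edge_prod D) z = Av n (\<Union>D) (edge_prod D) (\<lambda>_. 0)"
  proof -
    have "finite Y \<Longrightarrow> indep (Av n (\<Union>D) (edge_prod D)) Y" for Y
      by (rule indep_Av, rule edge_prod_indep[OF assms(1)]) auto
    note * = this
    have "Av n (\<Union>D) (edge_prod D) (override_on z (\<lambda>_. 0) (\<Union>D)) = Av n (\<Union>D) (edge_prod D) z" for z
      using *[OF bip_finite_Un[OF assms(1)]] bip_finite_Un[OF assms(1)] by (rule indep_override)
    moreover have "edge_prod D (override_on (override_on z (\<lambda>_. 0) (\<Union>D)) y (\<Union>D)) = edge_prod D (override_on (\<lambda>_. 0) y (\<Union>D))" for y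
    proof (unfold edge_prod_def, intro prod.cong refl)
      fix e assume "e \<in> D"
      then obtain u v where "e = {u, v}" "side u" "\<not> side v" using assms by (auto simp: bip_def)
      moreover from this \<open>e \<in> D\<close> have "u \<in> \<Union>D" "v \<in> \<Union>D" by auto
      ultimately show "fac e (override_on (override_on z (\<lambda>_. 0) (\<Union>D)) y (\<Union>D)) = fac e (override_on (\<lambda>_. 0) y (\<Union>D))"
        by (simp add: fac_eq override_on_def)
    qed
    then have "Av n (\<Union>D) (edge_prod D) (override_on z (\<lambda>_. 0) (\<Union>D)) = Av n (\<Union>D) (edge_prod D) (\<lambda>_. 0)"
      by (simp add: Av_def)
    ultimately show ?thesis by simp
  qed
  finally show ?thesis by (simp add: t_def)
qed

text \<open>A single edge makes an average small: if all coordinates other than those of \<open>u\<close> and \<open>v\<close> are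
  fixed, every other factor depends on at most one of these two coordinates, because there are no
  parallel edges. The weight \<open>G\<close> may depend on \<open>u\<close> but not on \<open>v\<close>, and \<open>H\<close> the other way round.\<close>

lemma weighted_edge_average_small:
  assumes D: "bip D" "{u, v} \<in> D" and X: "finite X" "u \<in> X" "v \<in> X"
    and G: "indep G {v}" "\<And>z. \<bar>G z\<bar> \<le> 1" and H: "indep H {u}" "\<And>z. \<bar>H z\<bar> \<le> 1"
  shows "\<bar>Av n X (\<lambda>z. G z * H z * edge_prod D z) z0\<bar> \<le> eta"
proof -
  note uv = bip_edge[OF D]
  define Du where "Du = inc D u - {{u, v}}"
  define Dv where "Dv = D - inc D u"
  have Dsplit: "edge_prod D z = fac {u, v} z * edge_prod Du z * edge_prod Dv z" for z
  proof -
    have "edge_prod D z = edge_prod (inc D u) z * edge_prod Dv z"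
      unfolding Dv_def by (rule edge_prod_split) (auto simp: inc_def bip_finite[OF D(1)])
    also have "edge_prod (inc D u) z = fac {u, v} z * edge_prod Du z"
    proof -
      have "edge_prod (inc D u) z = edge_prod {{u, v}} z * edge_prod Du z"
        unfolding Du_def using D by (intro edge_prod_split) (auto simp: inc_def bip_finite[OF D(1)])
      then show ?thesis by (simp add: edge_prod_def)
    qed
    finally show ?thesis by simp
  qed
  have iu: "indep (edge_prod Du) {v}"
  proof (rule edge_prod_indep[OF D(1)])
    fix e assume "e \<in> Du"
    then have e: "e \<in> D" "u \<in> e" "e \<noteq> {u, v}" unfolding Du_def inc_def by blast+
    obtain v' where v': "e = {u, v'}" by (rule bip_edgeE[OF D(1) e(1,2)])
    show "e \<inter> {v} = {}" using e(3) uv(2) unfolding v' by blast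
  next
    show "Du \<subseteq> D" unfolding Du_def inc_def by blast
  qed
  have iv: "indep (edge_prod Dv) {u}"
    by (rule edge_prod_indep[OF D(1)]) (auto simp: Dv_def inc_def)
  have iuv: "\<bar>Av n {u, v} (\<lambda>z. G z * H z * edge_prod D z) z\<bar> \<le> eta" for z
  proof -
    define p where "p x = G (z(u := x)) * edge_prod Du (z(u := x))" for x
    define q where "q y = H (z(v := y)) * edge_prod Dv (z(v := y))" for y
    have "Av n {u, v} (\<lambda>z. G z * H z * edge_prod D z) z
       = avg n (\<lambda>x. avg n (\<lambda>y. M (side u) x y * p x * q y))"
    proof -
      have "G (z(u := x, v := y)) * H (z(u := x, v := y)) * edge_prod D (z(u := x, v := y)) = M (side u) x y * p x * q y" for x y
      proof -
        have "G (z(u := x, v := y)) = G (z(u := x))" "edge_prod Du (z(u := x, v := y)) = edge_prod Du (z(u := x))"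
          using G(1) iu by (auto simp: indep_def)
        moreover have "H (z(u := x, v := y)) = H (z(v := y))" "edge_prod Dv (z(u := x, v := y)) = edge_prod Dv (z(v := y))"
          using H(1) iv uv(2) unfolding fun_upd_twist[OF uv(2)] by (auto simp: indep_def)
        ultimately show ?thesis unfolding Dsplit p_def q_def using uv by (simp add: fac_eq)
      qed
      then show ?thesis using uv(2) by (simp add: Av_insert Av_sing)
    qed
    also have "\<bar>\<dots>\<bar> \<le> eta"
      by (intro M_cut) (auto simp: p_def q_def intro!: mult_abs_le1 G H edge_prod_bound)
    finally show ?thesis .
  qed
  have "Av n X (\<lambda>z. G z * H z * edge_prod D z) z0 = Av n (X - {u, v}) (Av n {u, v} (\<lambda>z. G z * H z * edge_prod D z)) z0"
    using X by (subst Av_split_outer[where Y="{u, v}"]) auto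
  then show ?thesis using Av_bound[OF n_pos, of "X - {u, v}" _ eta z0] iuv X by simp
qed

corollary edge_average_small:
  assumes "bip D" "{u, v} \<in> D" "finite X" "u \<in> X" "v \<in> X"
  shows "\<bar>Av n X (edge_prod D) z0\<bar> \<le> eta"
  using weighted_edge_average_small[OF assms, of "\<lambda>_. 1" "\<lambda>_. 1"] by (simp add: indep_const)

text \<open>A vertex of degree one can be integrated out; what remains is the degree function at its neighbour.\<close>

lemma Av_leaf:
  assumes "bip D" "inc D w = {{a, w}}"
  shows "Av n {w} (edge_prod D) z = deg_fun (side a) (z a) * edge_prod (D - {{a, w}}) z"
proof -
  have aw: "{a, w} \<in> D" using assms by (auto simp: inc_def)
  note s = bip_edge[OF assms(1) aw]
  have i: "indep (edge_prod (D - {{a, w}})) {w}"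
    by (rule edge_prod_indep[OF assms(1)]) (use assms(2) in \<open>auto simp: inc_def\<close>)
  have "edge_prod D = (\<lambda>z. fac {a, w} z * edge_prod (D - {{a, w}}) z)"
    using edge_prod_split[OF bip_finite[OF assms(1)], of "{{a, w}}"] aw by (auto simp: edge_prod_def fun_eq_iff)
  then have "Av n {w} (edge_prod D) z = Av n {w} (\<lambda>z. fac {a, w} z * edge_prod (D - {{a, w}}) z) z"
    by simp
  also have "\<dots> = Av n {w} (fac {a, w}) z * edge_prod (D - {{a, w}}) z"
    using i by (simp add: Av_mult_indep2)
  also have "Av n {w} (fac {a, w}) z = deg_fun (side a) (z a)"
    using s by (simp add: Av_sing fac_eq deg_fun_def)
  finally show ?thesis .
qed

lemma Av_leaf2:
  assumes "bip D" "inc D w = {{a, w}}" "inc D w' = {{a', w'}}" "w \<noteq> w'" "a \<noteq> w'"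
  shows "Av n {w, w'} (edge_prod D) z
    = deg_fun (side a) (z a) * deg_fun (side a') (z a') * edge_prod (D - {{a, w}, {a', w'}}) z"
proof -
  have ne: "{a, w} \<noteq> {a', w'}" using assms by (auto simp: doubleton_eq_iff)
  have 1: "bip (D - {{a, w}})" using assms(1) by (rule bip_subset) auto
  have 2: "inc (D - {{a, w}}) w' = {{a', w'}}"
    using assms(3) ne by (auto simp: inc_def)
  have D': "D - {{a, w}} - {{a', w'}} = D - {{a, w}, {a', w'}}" by auto
  have "Av n {w, w'} (edge_prod D) = Av n {w'} (Av n {w} (edge_prod D))"
    using Av_Un[of "{w'}" "{w}" n "edge_prod D"] assms(4) by (simp add: insert_commute)
  also have "Av n {w} (edge_prod D) = (\<lambda>z. deg_fun (side a) (z a) * edge_prod (D - {{a, w}}) z)"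
    by (rule ext) (rule Av_leaf[OF assms(1,2)])
  finally have "Av n {w, w'} (edge_prod D) z = Av n {w'} (\<lambda>z. deg_fun (side a) (z a) * edge_prod (D - {{a, w}}) z) z"
    by simp
  also have "\<dots> = deg_fun (side a) (z a) * Av n {w'} (edge_prod (D - {{a, w}})) z"
    by (rule Av_mult_indep) (use assms(5) in \<open>auto simp: indep_def\<close>)
  finally show ?thesis using Av_leaf[OF 1 2, of z] by (simp add: D')
qed

text \<open>The mean of the kernel is zero.\<close>

lemma t_isolated_edge:
  assumes "bip D" "inc D w = {{a, w}}" "inc D a = {{a, w}}"
  shows "t D = 0"
proof -
  have aw: "{a, w} \<in> D" using assms by (auto simp: inc_def)
  note s = bip_edge[OF assms(1) aw]
  let ?X = "\<Union>D"
  have "t D = Av n (?X - {a, w}) (Av n {a} (Av n {w} (edge_prod D))) (\<lambda>_. 0)"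
  proof -
    have "Av n ?X (edge_prod D) = Av n (?X - {a, w}) (Av n {a, w} (edge_prod D))"
      using aw bip_finite_Un[OF assms(1)] by (intro Av_split_outer) auto
    moreover have "Av n {a, w} (edge_prod D) = Av n {a} (Av n {w} (edge_prod D))"
      using s Av_Un[of "{a}" "{w}" n "edge_prod D"] by (simp add: insert_commute)
    ultimately show ?thesis by (simp add: t_def)
  qed
  moreover have "Av n {a} (Av n {w} (edge_prod D)) = (\<lambda>_. 0)"
  proof
    fix z
    have i: "indep (edge_prod (D - {{a, w}})) {a}"
      by (rule edge_prod_indep[OF assms(1)]) (use assms(3) in \<open>auto simp: inc_def\<close>)
    have "Av n {a} (Av n {w} (edge_prod D)) z = Av n {a} (\<lambda>z. deg_fun (side a) (z a) * edge_prod (D - {{a, w}}) z) z"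
      by (simp add: Av_leaf[OF assms(1,2), THEN ext])
    also have "\<dots> = Av n {a} (\<lambda>z. deg_fun (side a) (z a)) z * edge_prod (D - {{a, w}}) z"
      using i by (simp add: Av_mult_indep2)
    also have "Av n {a} (\<lambda>z. deg_fun (side a) (z a)) z = 0"
      by (simp add: Av_sing deg_fun_def M_mean)
    finally show "Av n {a} (Av n {w} (edge_prod D)) z = 0" by simp
  qed
  ultimately show ?thesis by (simp add: Av_def)
qed

lemma alpha_nonneg: "0 \<le> alpha s"
  by (simp add: alpha_def avg_nonneg)

lemma edge_off:
  assumes "bip D" "inc D w = {{a, w}}" "e \<in> D" "a \<notin> e"
  shows "w \<notin> e"
  using assms by (auto simp: inc_def)

lemma Av_deg1_sq: "Av n {a} (\<lambda>z. (deg_fun (side a) (z a))\<^sup>2) z = alpha (side a)"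
  by (simp add: Av_sing alpha_def)

text \<open>Two leaves at \<open>a\<close> produce the square of the degree function at \<open>a\<close>. For a fixed value at \<open>a\<close> the
  average of everything else is small because of an edge that avoids \<open>a\<close>.\<close>

lemma two_leaves_bound:
  assumes D: "bip D" and w: "inc D w = {{a, w}}" "inc D w' = {{a, w'}}" "w \<noteq> w'"
    and e: "e \<in> D" "a \<notin> e"
  shows "\<bar>t D\<bar> \<le> eta * alpha (side a)"
proof -
  let ?X = "\<Union>D" and ?D2 = "D - {{a, w}, {a, w'}}"
  have fin: "finite ?X" by (rule bip_finite_Un[OF D])
  have aw: "{a, w} \<in> D" "{a, w'} \<in> D" using w by (auto simp: inc_def)
  note s = bip_edge(2)[OF D aw(1)] bip_edge(2)[OF D aw(2)]
  define R where "R = ?X - {a, w, w'}"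
  obtain u where "u \<in> e" using D e by (auto simp: bip_def)
  then obtain v where uv: "e = {u, v}" using bip_edgeE[OF D e(1)] by metis
  have wR: "w \<notin> e" "w' \<notin> e" using edge_off[OF D w(1) e] edge_off[OF D w(2) e] by auto
  have uvR: "u \<in> R" "v \<in> R" using uv e wR unfolding R_def by auto
  have eD2: "{u, v} \<in> ?D2" using uv e by auto
  have XX: "?X = {a} \<union> (R \<union> {w, w'})" using aw by (auto simp: R_def)
  have "t D = Av n {a} (Av n R (Av n {w, w'} (edge_prod D))) (\<lambda>_. 0)"
    unfolding t_def XX using s fin
    by (subst Av_Un, (auto simp: R_def)[3]) (subst Av_Un, auto simp: R_def)
  also have "Av n {w, w'} (edge_prod D) = (\<lambda>z. (deg_fun (side a) (z a))\<^sup>2 * edge_prod ?D2 z)"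
    by (rule ext, subst Av_leaf2[OF D w]) (use s in \<open>auto simp: power2_eq_square\<close>)
  also have "Av n R \<dots> = (\<lambda>z. (deg_fun (side a) (z a))\<^sup>2 * Av n R (edge_prod ?D2) z)"
    by (intro ext Av_mult_indep) (use fin in \<open>auto simp: R_def indep_def\<close>)
  finally have "\<bar>t D\<bar> \<le> Av n {a} (\<lambda>z. \<bar>(deg_fun (side a) (z a))\<^sup>2 * Av n R (edge_prod ?D2) z\<bar>) (\<lambda>_. 0)"
    by (simp add: Av_abs)
  also have "\<dots> \<le> Av n {a} (\<lambda>z. eta * (deg_fun (side a) (z a))\<^sup>2) (\<lambda>_. 0)"
  proof (rule Av_mono)
    fix z
    have "\<bar>Av n R (edge_prod ?D2) z\<bar> \<le> eta"
      by (rule edge_average_small[OF bip_subset[OF D] eD2]) (use fin uvR in \<open>auto simp: R_def\<close>)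
    then show "\<bar>(deg_fun (side a) (z a))\<^sup>2 * Av n R (edge_prod ?D2) z\<bar> \<le> eta * (deg_fun (side a) (z a))\<^sup>2"
      by (simp add: abs_mult mult.commute[of eta] mult_left_mono)
  qed
  also have "\<dots> = eta * alpha (side a)" by (simp only: Av_cmult Av_deg1_sq)
  finally show ?thesis .
qed

text \<open>The sign of the conditional average is a weight that does not depend on \<open>v\<close>, so the edge still
  makes the average small.\<close>

lemma conditional_average_small:
  assumes D: "bip D" and e: "{u, v} \<in> D" and fin: "finite X" "finite Y" and disj: "X \<inter> Y = {}"
    and uv: "u \<in> X \<union> Y" "v \<in> Y"
  shows "Av n X (\<lambda>z. \<bar>Av n Y (edge_prod D) z\<bar>) z \<le> eta"
proof -
  have i: "indep (\<lambda>z. sgn (Av n Y (edge_prod D) z)) {v}"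
    by (intro indep_comp[of "Av n Y (edge_prod D)" "{v}" sgn] indep_Av) (use uv in \<open>auto simp: indep_def\<close>)
  have "Av n X (\<lambda>z. \<bar>Av n Y (edge_prod D) z\<bar>) z = Av n (X \<union> Y) (\<lambda>z. sgn (Av n Y (edge_prod D) z) * 1 * edge_prod D z) z"
    using Av_cond_abs[OF fin disj] by simp
  also have "\<bar>\<dots>\<bar> \<le> eta"
    by (rule weighted_edge_average_small[OF D e _ _ _ i]) (use fin uv in \<open>simp_all add: indep_const abs_sgn_eq\<close>)
  then have "Av n (X \<union> Y) (\<lambda>z. sgn (Av n Y (edge_prod D) z) * 1 * edge_prod D z) z \<le> eta"
    by linarith
  finally show ?thesis .
qed

end

section \<open>Graphs with leaves\<close>

context bip_kernel
begin

text \<open>Two leaves at different nodes produce \<open>f(x) g(y) k(x, y)\<close>, where \<open>k\<close> is the conditional average of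
  the remaining edges. By \<open>2 \<bar>f g\<bar> \<le> f\<^sup>2 + g\<^sup>2\<close> it suffices that \<open>k\<close> has small \<open>L\<^sup>1\<close> norm in either
  variable when the other one is fixed, and this needs a remaining edge that avoids the fixed node.\<close>

lemma separate_leaves_bound:
  assumes D: "bip D" and w: "inc D w = {{a, w}}" "inc D w' = {{a', w'}}"
    and dist: "w \<noteq> w'" "a \<noteq> a'" "a \<noteq> w'" "a' \<noteq> w"
    and e: "e \<in> D - {{a, w}, {a', w'}}" "a \<notin> e" and e': "e' \<in> D - {{a, w}, {a', w'}}" "a' \<notin> e'"
  shows "\<bar>t D\<bar> \<le> eta * (alpha (side a) + alpha (side a')) / 2"
proof -
  let ?X = "\<Union>D" and ?D2 = "D - {{a, w}, {a', w'}}"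
  let ?f = "\<lambda>z. deg_fun (side a) (z a)" and ?g = "\<lambda>z. deg_fun (side a') (z a')"
  have fin: "finite ?X" by (rule bip_finite_Un[OF D])
  have aw: "{a, w} \<in> D" "{a', w'} \<in> D" using w unfolding inc_def by blast+
  note s = bip_edge(2)[OF D aw(1)] bip_edge(2)[OF D aw(2)]
  define R where "R = ?X - {a, a', w, w'}"
  define k where "k = Av n R (edge_prod ?D2)"
  have D2: "bip ?D2" using D by (rule bip_subset) auto
  have wD: "b = {a, w}" if "b \<in> D" "w \<in> b" for b using that w(1) unfolding inc_def by blast
  have wD': "b = {a', w'}" if "b \<in> D" "w' \<in> b" for b using that w(2) unfolding inc_def by blast
  have wD2: "w \<notin> b" "w' \<notin> b" if "b \<in> ?D2" for b using that wD[of b] wD'[of b] by blast+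
  have cond: "Av n {y} (\<lambda>z. \<bar>k z\<bar>) z \<le> eta"
    if xy: "{x, y} = {a, a'}" "x \<noteq> y" and b: "b \<in> ?D2" "x \<notin> b" for x y z b
  proof -
    obtain u v where uv: "b = {u, v}" "side u" "\<not> side v" using D2 b(1) unfolding bip_def by blast
    have sub: "u \<in> ?X" "v \<in> ?X" using uv b by auto
    have nw: "u \<notin> {w, w'}" "v \<notin> {w, w'}" using wD2[OF b(1)] uv by auto
    have yR: "{y} \<inter> R = {}" using xy by (auto simp: R_def)
    have in1: "u \<in> {y} \<union> R" "v \<in> {y} \<union> R" using sub nw b(2) uv xy by (auto simp: R_def doubleton_eq_iff)
    have uv2: "{u, v} \<in> ?D2" "{v, u} \<in> ?D2" using b uv by (auto simp: insert_commute)
    have ne: "u \<noteq> v" using uv by auto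
    have finR: "finite R" using fin by (simp add: R_def)
    show ?thesis
    proof (cases "v = y")
      case True
      then have "u \<in> R" using in1 ne by auto
      then show ?thesis unfolding k_def
        using conditional_average_small[OF D2 uv2(2) _ finR yR] in1 by auto
    next
      case False
      then have "v \<in> R" using in1 by auto
      then show ?thesis unfolding k_def
        using conditional_average_small[OF D2 uv2(1) _ finR yR] in1 by auto
    qed
  qed
  have XX: "?X = {a, a'} \<union> (R \<union> {w, w'})" using aw by (auto simp: R_def)
  have "t D = Av n {a, a'} (Av n R (Av n {w, w'} (edge_prod D))) (\<lambda>_. 0)"
    unfolding t_def XX using s dist fin
    by (subst Av_Un, (auto simp: R_def)[3]) (subst Av_Un, auto simp: R_def)
  also have "Av n {w, w'} (edge_prod D) = (\<lambda>z. (?f z * ?g z) * edge_prod ?D2 z)"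
    by (rule ext, subst Av_leaf2[OF D w]) (use dist in \<open>auto simp: mult_ac\<close>)
  also have "Av n R \<dots> = (\<lambda>z. (?f z * ?g z) * k z)"
    unfolding k_def by (intro ext Av_mult_indep) (use fin in \<open>auto simp: R_def indep_def\<close>)
  finally have "\<bar>t D\<bar> \<le> Av n {a, a'} (\<lambda>z. \<bar>(?f z * ?g z) * k z\<bar>) (\<lambda>_. 0)"
    by (simp add: Av_abs)
  also have "\<dots> \<le> Av n {a, a'} (\<lambda>z. (1/2) * ((?f z)\<^sup>2 * \<bar>k z\<bar> + (?g z)\<^sup>2 * \<bar>k z\<bar>)) (\<lambda>_. 0)"
  proof (rule Av_mono)
    fix z
    have "\<bar>?f z * ?g z\<bar> \<le> ((?f z)\<^sup>2 + (?g z)\<^sup>2) / 2"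
      using sum_squares_bound[of "\<bar>?f z\<bar>" "\<bar>?g z\<bar>"] by (simp add: abs_mult)
    from mult_right_mono[OF this, of "\<bar>k z\<bar>"]
    show "\<bar>?f z * ?g z * k z\<bar> \<le> (1/2) * ((?f z)\<^sup>2 * \<bar>k z\<bar> + (?g z)\<^sup>2 * \<bar>k z\<bar>)"
      by (simp add: abs_mult field_simps)
  qed
  also have "\<dots> = (Av n {a, a'} (\<lambda>z. (?f z)\<^sup>2 * \<bar>k z\<bar>) (\<lambda>_. 0) + Av n {a, a'} (\<lambda>z. (?g z)\<^sup>2 * \<bar>k z\<bar>) (\<lambda>_. 0)) / 2"
    by (simp only: Av_cmult Av_add)
  also have "Av n {a, a'} (\<lambda>z. (?f z)\<^sup>2 * \<bar>k z\<bar>) (\<lambda>_. 0) \<le> eta * alpha (side a)"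
  proof -
    have "Av n {a, a'} (\<lambda>z. (?f z)\<^sup>2 * \<bar>k z\<bar>) (\<lambda>_. 0) = Av n {a} (Av n {a'} (\<lambda>z. (?f z)\<^sup>2 * \<bar>k z\<bar>)) (\<lambda>_. 0)"
      using dist Av_Un[of "{a}" "{a'}" n] by (simp add: insert_commute)
    also have "Av n {a'} (\<lambda>z. (?f z)\<^sup>2 * \<bar>k z\<bar>) = (\<lambda>z. (?f z)\<^sup>2 * Av n {a'} (\<lambda>z. \<bar>k z\<bar>) z)"
      by (intro ext Av_mult_indep) (use dist in \<open>auto simp: indep_def\<close>)
    also have "Av n {a} \<dots> (\<lambda>_. 0) \<le> Av n {a} (\<lambda>z. eta * (?f z)\<^sup>2) (\<lambda>_. 0)"
      using cond[of a a' e] e dist by (intro Av_mono) (simp add: mult.commute[of eta] mult_left_mono)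
    finally show ?thesis by (simp only: Av_cmult Av_deg1_sq)
  qed
  also have "Av n {a, a'} (\<lambda>z. (?g z)\<^sup>2 * \<bar>k z\<bar>) (\<lambda>_. 0) \<le> eta * alpha (side a')"
  proof -
    have "Av n {a, a'} (\<lambda>z. (?g z)\<^sup>2 * \<bar>k z\<bar>) (\<lambda>_. 0) = Av n {a'} (Av n {a} (\<lambda>z. (?g z)\<^sup>2 * \<bar>k z\<bar>)) (\<lambda>_. 0)"
      using dist Av_Un[of "{a'}" "{a}" n] by (simp add: insert_commute)
    also have "Av n {a} (\<lambda>z. (?g z)\<^sup>2 * \<bar>k z\<bar>) = (\<lambda>z. (?g z)\<^sup>2 * Av n {a} (\<lambda>z. \<bar>k z\<bar>) z)"
      by (intro ext Av_mult_indep) (use dist in \<open>auto simp: indep_def\<close>)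
    also have "Av n {a'} \<dots> (\<lambda>_. 0) \<le> Av n {a'} (\<lambda>z. eta * (?g z)\<^sup>2) (\<lambda>_. 0)"
      using cond[of a' a e'] e' dist by (intro Av_mono) (simp add: mult.commute[of eta] mult_left_mono insert_commute)
    finally show ?thesis by (simp only: Av_cmult Av_deg1_sq)
  qed
  finally show ?thesis by (simp add: field_simps)
qed

text \<open>In a path with three edges the only remaining edge joins the neighbours of both leaves, so fixing
  either of them leaves nothing to average. Here the norm of \<open>U\<close> on \<open>L\<^sup>2\<close> is used.\<close>

lemma three_edge_path_bound:
  assumes D: "bip D" and w: "inc D w = {{a, w}}" "inc D w' = {{a', w'}}"
    and dist: "w \<noteq> w'" "a \<noteq> a'" "a \<noteq> w'" "a' \<noteq> w"
    and D2: "D - {{a, w}, {a', w'}} = {{a, a'}}"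
  shows "(t D)\<^sup>2 \<le> eta * alpha (side a) * alpha (side a')"
proof -
  have aw: "{a, w} \<in> D" "{a', w'} \<in> D" "{a, a'} \<in> D" using w D2 unfolding inc_def by blast+
  note s = bip_edge(2)[OF D aw(1)] bip_edge(2)[OF D aw(2)] bip_edge(1)[OF D aw(3)]
  have "D = {{a, a'}, {a, w}, {a', w'}}" using aw D2 by blast
  then have XX: "\<Union>D = {a, a'} \<union> {w, w'}" by auto
  have "t D = Av n {a, a'} (Av n {w, w'} (edge_prod D)) (\<lambda>_. 0)"
    unfolding t_def XX using s dist by (subst Av_Un) auto
  also have "Av n {w, w'} (edge_prod D)
      = (\<lambda>z. deg_fun (side a) (z a) * deg_fun (side a') (z a') * M (side a) (z a) (z a'))"
    by (rule ext, subst Av_leaf2[OF D w]) (use dist s in \<open>auto simp: D2 edge_prod_def fac_eq\<close>)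
  also have "Av n {a, a'} \<dots> (\<lambda>_. 0) = avg n (\<lambda>x. avg n (\<lambda>y. deg_fun (side a) x * deg_fun (side a') y * M (side a) x y))"
    using dist by (simp add: Av_insert Av_sing)
  finally show ?thesis
    using operator_bound[of "deg_fun (side a)" "deg_fun (side a')" "side a"] by (simp add: alpha_def)
qed

end

section \<open>Chordless cycles\<close>

fun path_edges :: "'v list \<Rightarrow> 'v set set" where
  "path_edges (x # y # zs) = insert {x, y} (path_edges (y # zs))"
| "path_edges _ = {}"

lemma path_edges_subset: "e \<in> path_edges xs \<Longrightarrow> e \<subseteq> set xs"
  by (induction xs rule: path_edges.induct) auto
lemma finite_pedges: "finite (path_edges xs)"
  by (induction xs rule: path_edges.induct) auto
lemma path_edges_cover: "x \<in> set xs \<Longrightarrow> 2 \<le> length xs \<Longrightarrow> \<exists>b\<in>path_edges xs. x \<in> b"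
proof (induction xs rule: path_edges.induct)
  case (1 y z zs)
  then show ?case by (cases zs) auto
qed auto

lemma cycle_vertex_covered:
  assumes "x \<in> set (p # q # is @ js)"
  shows "\<exists>b\<in>path_edges (p # is @ [q]) \<union> path_edges (p # js @ [q]). x \<in> b"
proof (cases "x \<in> set (p # is @ [q])")
  case True
  then have "\<exists>b\<in>path_edges (p # is @ [q]). x \<in> b" by (rule path_edges_cover) simp
  then show ?thesis by blast
next
  case False
  then have "x \<in> set (p # js @ [q])" using assms by auto
  then have "\<exists>b\<in>path_edges (p # js @ [q]). x \<in> b" by (rule path_edges_cover) simp
  then show ?thesis by blast
qed

lemma path_edges_meets: "e \<in> path_edges (p # is @ [q]) \<Longrightarrow> is \<noteq> [] \<Longrightarrow> e \<inter> set is \<noteq> {}"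
proof (induction "is" arbitrary: p)
  case (Cons c cs) then show ?case by (cases cs) auto
qed simp

context bip_kernel
begin

fun alt :: "'v list \<Rightarrow> bool" where
  "alt (x # y # zs) \<longleftrightarrow> side x \<noteq> side y \<and> alt (y # zs)"
| "alt _ \<longleftrightarrow> True"

lemma alt_bip: "bip D \<Longrightarrow> path_edges xs \<subseteq> D \<Longrightarrow> alt xs"
  by (induction xs rule: path_edges.induct) (auto dest: bip_edge)

lemma bip_pedges: "alt xs \<Longrightarrow> bip (path_edges xs)"
proof (induction xs rule: path_edges.induct)
  case (1 x y zs)
  have "\<exists>u v. {x, y} = {u, v} \<and> side u \<and> \<not> side v"
    using 1(2) by (cases "side x") (auto intro: exI[of _ x] exI[of _ y])
  then show ?case using 1 by (simp add: bip_def)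
qed (auto simp: bip_def)

text \<open>Integrating out the inner vertices of a path one by one. The weight at an inner vertex may depend
  on the coordinates off the path, which are fixed.\<close>

lemma Av_path:
  assumes "distinct (p # is @ [q])" "alt (p # is @ [q])"
    and "\<And>c. c \<in> set is \<Longrightarrow> indep (W c) (set is - {c})"
  shows "Av n (set is) (\<lambda>z. edge_prod (path_edges (p # is @ [q])) z * (\<Prod>c\<in>set is. W c z)) z
    = path_kernel (side p) (map (\<lambda>c x. W c (z(c := x))) is) (z p) (z q)"
  using assms
proof (induction "is" arbitrary: p z)
  case Nil
  then show ?case by (simp add: edge_prod_def fac_eq)
next
  case (Cons c cs)
  define F where "F z = edge_prod (path_edges (c # cs @ [q])) z * (\<Prod>c\<in>set cs. W c z)" for z
  have sides: "side p \<noteq> side c" "alt (c # cs @ [q])" using Cons.prems(2) by auto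
  have d: "distinct (c # cs @ [q])" "c \<notin> set cs" "p \<noteq> c" "c \<noteq> q" "p \<notin> set cs" using Cons.prems(1) by auto
  have "{p, c} \<notin> path_edges (c # cs @ [q])"
    using path_edges_subset[of "{p, c}" "c # cs @ [q]"] Cons.prems(1) by auto
  then have split: "edge_prod (path_edges (p # (c # cs) @ [q])) z * (\<Prod>c\<in>set (c # cs). W c z)
      = (fac {p, c} z * W c z) * F z" for z
    using d(2) by (simp add: edge_prod_insert finite_pedges F_def)
  have i: "indep (\<lambda>z. fac {p, c} z * W c z) (set cs)"
  proof (rule indep_mult)
    show "indep (fac {p, c}) (set cs)"
      using sides(1) d by (auto simp: indep_def fac_eq)
    show "indep (W c) (set cs)"
      using Cons.prems(3)[of c] d(2) by (rule_tac indep_mono) auto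
  qed
  have IH: "Av n (set cs) F z = path_kernel (side c) (map (\<lambda>c x. W c (z(c := x))) cs) (z c) (z q)" for z
    unfolding F_def
  proof (rule Cons.IH[OF d(1) sides(2)])
    fix c' assume "c' \<in> set cs"
    then show "indep (W c') (set cs - {c'})" using Cons.prems(3)[of c'] by (auto intro: indep_mono)
  qed
  have W: "map (\<lambda>c' y. W c' (z(c := x, c' := y))) cs = map (\<lambda>c' y. W c' (z(c' := y))) cs" for x
  proof (rule map_cong[OF refl], rule ext)
    fix c' y assume c': "c' \<in> set cs"
    then have ne: "c \<noteq> c'" using d(2) by auto
    have "indep (W c') {c}" using Cons.prems(3)[of c'] c' ne by (auto intro: indep_mono)
    then show "W c' (z(c := x, c' := y)) = W c' (z(c' := y))"
      unfolding fun_upd_twist[OF ne] by (simp add: indep_def)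
  qed
  have "Av n (set (c # cs)) (\<lambda>z. edge_prod (path_edges (p # (c # cs) @ [q])) z * (\<Prod>c\<in>set (c # cs). W c z)) z
     = avg n (\<lambda>x. Av n (set cs) (\<lambda>z. (fac {p, c} z * W c z) * F z) (z(c := x)))"
    unfolding split using d(2) by (simp add: Av_insert)
  also have "\<dots> = avg n (\<lambda>x. fac {p, c} (z(c := x)) * W c (z(c := x)) * Av n (set cs) F (z(c := x)))"
    using i by (simp add: Av_mult_indep)
  also have "\<dots> = avg n (\<lambda>x. M (side p) (z p) x * W c (z(c := x)) *
      path_kernel (\<not> side p) (map (\<lambda>c' y. W c' (z(c' := y))) cs) x (z q))"
    unfolding IH W using sides(1) d by (simp add: fac_eq W)
  finally show ?case by (simp only: list.map path_kernel.simps)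
qed

text \<open>One of the two arcs between antipodal vertices \<open>p\<close> and \<open>q\<close> of a chordless cycle. Every edge that
  meets the interior of the arc and is not on it leads to a vertex off the cycle, so with the
  coordinates off the cycle fixed it is a weight at a single vertex.\<close>

lemma half_path_sq:
  assumes D: "bip D" and sub: "path_edges (p # is @ [q]) \<subseteq> D" and dist: "distinct (p # is @ [q])" and ne: "is \<noteq> []"
    and chord: "\<And>e. e \<in> D \<Longrightarrow> e \<inter> set is \<noteq> {} \<Longrightarrow> e \<subseteq> set (p # is @ [q]) \<Longrightarrow> e \<in> path_edges (p # is @ [q])"
    and g: "\<And>s. path_sq s (replicate (length is) (\<lambda>_. 1)) \<le> g"
  shows "Av n {p, q} (\<lambda>z. (Av n (set is) (edge_prod {e \<in> D. e \<inter> set is \<noteq> {}}) z)\<^sup>2) z \<le> g"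
proof -
  let ?E = "{e \<in> D. e \<inter> set is \<noteq> {}}" and ?P = "path_edges (p # is @ [q])"
  define W where "W c = edge_prod (inc D c - ?P)" for c
  have fin: "finite D" using D by (rule bip_finite)
  have PE: "?P \<subseteq> ?E" using sub path_edges_meets[OF _ ne] by blast
  have O: "?E - ?P = (\<Union>c\<in>set is. inc D c - ?P)" by (auto simp: inc_def)
  have one: "e \<inter> set (p # is @ [q]) = {c}" if c: "c \<in> set is" and e: "e \<in> inc D c - ?P" for c e
  proof -
    have e': "e \<in> D" "c \<in> e" "e \<notin> ?P" using e unfolding inc_def by blast+
    obtain v where v: "e = {c, v}" by (rule bip_edgeE[OF D e'(1,2)])
    have "v \<notin> set (p # is @ [q])" using chord[OF e'(1)] e'(3) c v by auto
    then show ?thesis using v c by auto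
  qed
  have prodE: "edge_prod ?E z = edge_prod ?P z * (\<Prod>c\<in>set is. W c z)" for z
  proof -
    have "edge_prod ?E z = edge_prod ?P z * edge_prod (?E - ?P) z"
      using PE fin by (intro edge_prod_split) auto
    also have "edge_prod (?E - ?P) z = (\<Prod>c\<in>set is. W c z)"
      unfolding O W_def edge_prod_def
    proof (rule prod.UNION_disjoint)
      show "\<forall>c\<in>set is. finite (inc D c - ?P)" using fin by (simp add: inc_def)
      show "\<forall>c\<in>set is. \<forall>c'\<in>set is. c \<noteq> c' \<longrightarrow> (inc D c - ?P) \<inter> (inc D c' - ?P) = {}"
      proof (intro ballI impI)
        fix c c' assume c: "c \<in> set is" "c' \<in> set is" "c \<noteq> c'"
        show "(inc D c - ?P) \<inter> (inc D c' - ?P) = {}"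
        proof (rule ccontr)
          assume "(inc D c - ?P) \<inter> (inc D c' - ?P) \<noteq> {}"
          then obtain e where "e \<in> inc D c - ?P" "e \<in> inc D c' - ?P" by blast
          with one[OF c(1)] one[OF c(2)] have "{c} = {c'}" by metis
          then show False using c by simp
        qed
      qed
    qed simp
    finally show ?thesis .
  qed
  have Wi: "indep (W c) (set (p # is @ [q]) - {c})" if "c \<in> set is" for c
    unfolding W_def
  proof (rule edge_prod_indep[OF D])
    fix e assume "e \<in> inc D c - ?P"
    from one[OF that this] show "e \<inter> (set (p # is @ [q]) - {c}) = {}" by blast
  qed (auto simp: inc_def)
  define ws where "ws z = map (\<lambda>c x. W c (z(c := x))) is" for z
  have alt: "alt (p # is @ [q])" using alt_bip[OF D sub] .
  have Av_is: "Av n (set is) (edge_prod ?E) z = path_kernel (side p) (ws z) (z p) (z q)" for z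
    unfolding prodE[THEN ext] ws_def
    by (rule Av_path[OF dist alt]) (use Wi in \<open>auto intro: indep_mono\<close>)
  have wsz: "ws (z(p := x, q := y)) = ws z" for x y
    unfolding ws_def
  proof (rule map_cong[OF refl], rule ext)
    fix c x' assume c: "c \<in> set is"
    then have ne: "p \<noteq> c" "q \<noteq> c" using dist by auto
    have "indep (W c) {p, q}" using Wi[OF c] ne by (auto intro: indep_mono)
    then show "W c (z(p := x, q := y, c := x')) = W c (z(c := x'))"
      unfolding fun_upd_twist[OF ne(2)] fun_upd_twist[OF ne(1)] by (simp add: indep_def)
  qed
  have "p \<noteq> q" using dist by auto
  then have "Av n {p, q} (\<lambda>z. (Av n (set is) (edge_prod ?E) z)\<^sup>2) z = path_sq (side p) (ws z)"
    using wsz by (simp add: Av_is Av_insert Av_sing path_sq_def)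
  also have "\<dots> \<le> g"
  proof (rule path_sq_le)
    show "unit_weights (ws z)" by (auto simp: unit_weights_def ws_def W_def edge_prod_bound)
    show "path_sq s (replicate (length (ws z)) (\<lambda>_. 1)) \<le> g" for s using g by (simp add: ws_def)
  qed
  finally show ?thesis .
qed

text \<open>A cycle of even length is given by two antipodal vertices and the interiors of the two arcs between
  them, because every later estimate cuts it at such a pair.\<close>

definition chordless_cycle :: "'v set set \<Rightarrow> 'v \<Rightarrow> 'v list \<Rightarrow> 'v \<Rightarrow> 'v list \<Rightarrow> bool" where
  "chordless_cycle D p is q js \<longleftrightarrow>
     path_edges (p # is @ [q]) \<union> path_edges (p # js @ [q]) \<subseteq> D \<and> distinct (p # q # is @ js) \<and>
     length is = length js \<and> is \<noteq> [] \<and>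
     (\<forall>e\<in>D. e \<subseteq> set (p # q # is @ js) \<longrightarrow> e \<in> path_edges (p # is @ [q]) \<union> path_edges (p # js @ [q]))"

text \<open>Absence of chords separates the edges into those that meet the first arc, those that meet the second
  arc, and the rest. After integrating out both interiors, the two arcs are functions of the antipodal
  pair, each with square mean at most \<open>g\<close>. The extra weight may depend on the antipodal pair as well;
  this is what later allows a small factor to be inserted.\<close>

theorem chordless_cycle_bound:
  assumes D: "bip D" and C: "chordless_cycle D p is q js"
    and X: "finite X" "set (p # q # is @ js) \<subseteq> X"
    and phi: "\<And>z. \<bar>phi z\<bar> \<le> c" "indep phi (set is \<union> set js)"
    and g: "\<And>s. path_sq s (replicate (length is) (\<lambda>_. 1)) \<le> g"
  shows "\<bar>Av n X (\<lambda>z. phi z * edge_prod D z) z0\<bar> \<le> c * g"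
proof -
  let ?P1 = "path_edges (p # is @ [q])" and ?P2 = "path_edges (p # js @ [q])"
  have sub: "?P1 \<subseteq> D" "?P2 \<subseteq> D" and dist: "distinct (p # q # is @ js)" and len: "length is = length js" "is \<noteq> []" "js \<noteq> []"
    and chord: "\<And>e. e \<in> D \<Longrightarrow> e \<subseteq> set (p # q # is @ js) \<Longrightarrow> e \<in> ?P1 \<union> ?P2"
    using C unfolding chordless_cycle_def by auto
  have c0: "0 \<le> c" using phi(1)[of z0] by linarith
  define E1 where "E1 = {e \<in> D. e \<inter> set is \<noteq> {}}"
  define E2 where "E2 = {e \<in> D. e \<inter> set js \<noteq> {}}"
  define E0 where "E0 = D - E1 - E2"
  have fin: "finite D" by (rule bip_finite[OF D])
  have in1: "e \<in> ?P1" if "e \<in> D" "e \<inter> set is \<noteq> {}" "e \<subseteq> set (p # q # is @ js)" for e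
    using chord[OF that(1,3)] that(2) path_edges_subset[of e "p # js @ [q]"] dist by auto
  have in2: "e \<in> ?P2" if "e \<in> D" "e \<inter> set js \<noteq> {}" "e \<subseteq> set (p # q # is @ js)" for e
    using chord[OF that(1,3)] that(2) path_edges_subset[of e "p # is @ [q]"] dist by auto
  have in1': "e \<in> ?P1" if "e \<in> D" "e \<inter> set is \<noteq> {}" "e \<subseteq> set (p # is @ [q])" for e
    using in1[OF that(1,2)] that(3) by auto
  have in2': "e \<in> ?P2" if "e \<in> D" "e \<inter> set js \<noteq> {}" "e \<subseteq> set (p # js @ [q])" for e
    using in2[OF that(1,2)] that(3) by auto
  have disj: "E1 \<inter> E2 = {}"
  proof (rule ccontr)
    assume "E1 \<inter> E2 \<noteq> {}"
    then obtain e i j where e: "e \<in> D" "i \<in> e" "i \<in> set is" "j \<in> e" "j \<in> set js" by (auto simp: E1_def E2_def)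
    obtain v where "e = {i, v}" by (rule bip_edgeE[OF D e(1,2)])
    moreover have "i \<noteq> j" using e dist by auto
    ultimately have "e = {i, j}" using e(4) by auto
    then have "e \<in> ?P1" using in1[OF e(1)] e by auto
    then show False using path_edges_subset[of e "p # is @ [q]"] e dist by auto
  qed
  have split: "edge_prod D z = edge_prod E0 z * (edge_prod E1 z * edge_prod E2 z)" for z
  proof -
    have "edge_prod D z = edge_prod (E1 \<union> E2) z * edge_prod (D - (E1 \<union> E2)) z"
      by (rule edge_prod_split[OF fin]) (auto simp: E1_def E2_def)
    moreover have "edge_prod (E1 \<union> E2) z = edge_prod E1 z * edge_prod E2 z"
      by (rule edge_prod_Un) (use fin disj in \<open>auto simp: E1_def E2_def\<close>)
    moreover have "D - (E1 \<union> E2) = E0" by (auto simp: E0_def)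
    ultimately show ?thesis by simp
  qed
  define P where "P = Av n (set is) (edge_prod E1)"
  define Q where "Q = Av n (set js) (edge_prod E2)"
  have iE2: "indep (edge_prod E2) (set is)"
    by (rule edge_prod_indep[OF D]) (use disj in \<open>auto simp: E1_def E2_def\<close>)
  have iP: "indep P (set js)"
    unfolding P_def by (rule indep_Av, rule edge_prod_indep[OF D]) (use disj in \<open>auto simp: E1_def E2_def\<close>)
  have iE0: "indep (\<lambda>z. phi z * edge_prod E0 z) (set is \<union> set js)"
    by (rule indep_mult[OF phi(2)], rule edge_prod_indep[OF D]) (auto simp: E0_def E1_def E2_def)
  have ints: "Av n (set js \<union> set is) (\<lambda>z. phi z * edge_prod D z) z = (phi z * edge_prod E0 z) * (P z * Q z)" for z
  proof -
    have "Av n (set js \<union> set is) (\<lambda>z. phi z * edge_prod D z) z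
       = Av n (set js \<union> set is) (\<lambda>z. (phi z * edge_prod E0 z) * (edge_prod E1 z * edge_prod E2 z)) z"
      unfolding split by (simp add: mult.assoc)
    also have "\<dots> = (phi z * edge_prod E0 z) * Av n (set js \<union> set is) (\<lambda>z. edge_prod E1 z * edge_prod E2 z) z"
      using iE0 by (intro Av_mult_indep) (auto simp: Un_commute)
    also have "Av n (set js \<union> set is) (\<lambda>z. edge_prod E1 z * edge_prod E2 z)
        = Av n (set js) (Av n (set is) (\<lambda>z. edge_prod E1 z * edge_prod E2 z))"
      using dist by (intro Av_Un) auto
    also have "Av n (set is) (\<lambda>z. edge_prod E1 z * edge_prod E2 z) = (\<lambda>z. P z * edge_prod E2 z)"
      unfolding P_def using iE2 by (intro ext Av_mult_indep2) auto
    also have "Av n (set js) \<dots> z = P z * Q z"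
      unfolding Q_def using iP by (intro Av_mult_indep) auto
    finally show ?thesis .
  qed
  have pq: "\<bar>Av n {p, q} (Av n (set js \<union> set is) (\<lambda>z. phi z * edge_prod D z)) z\<bar> \<le> c * g" for z
  proof -
    have P2: "Av n {p, q} (\<lambda>z. (P z)\<^sup>2) z \<le> g"
      unfolding P_def E1_def
      by (rule half_path_sq[OF D sub(1) _ len(2) in1' g]) (use dist in auto)
    have Q2: "Av n {p, q} (\<lambda>z. (Q z)\<^sup>2) z \<le> g"
      unfolding Q_def E2_def
      by (rule half_path_sq[OF D sub(2) _ len(3) in2' g[unfolded len(1)]]) (use dist in auto)
    have "\<bar>Av n {p, q} (Av n (set js \<union> set is) (\<lambda>z. phi z * edge_prod D z)) z\<bar>
      \<le> Av n {p, q} (\<lambda>z. \<bar>(phi z * edge_prod E0 z) * (P z * Q z)\<bar>) z"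
      unfolding ints[THEN ext] by (rule Av_abs)
    also have "\<dots> \<le> Av n {p, q} (\<lambda>z. c * ((1/2) * ((P z)\<^sup>2 + (Q z)\<^sup>2))) z"
    proof (rule Av_mono)
      fix z
      have "\<bar>phi z * edge_prod E0 z\<bar> \<le> c * 1"
        unfolding abs_mult using phi(1) edge_prod_bound c0 by (intro mult_mono) auto
      moreover have "\<bar>P z * Q z\<bar> \<le> (1/2) * ((P z)\<^sup>2 + (Q z)\<^sup>2)"
        using sum_squares_bound[of "\<bar>P z\<bar>" "\<bar>Q z\<bar>"] by (simp add: abs_mult)
      ultimately have "\<bar>phi z * edge_prod E0 z\<bar> * \<bar>P z * Q z\<bar> \<le> (c * 1) * ((1/2) * ((P z)\<^sup>2 + (Q z)\<^sup>2))"
        using c0 by (intro mult_mono) auto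
      then show "\<bar>(phi z * edge_prod E0 z) * (P z * Q z)\<bar> \<le> c * ((1/2) * ((P z)\<^sup>2 + (Q z)\<^sup>2))"
        by (simp add: abs_mult)
    qed
    also have "\<dots> = c * ((1/2) * (Av n {p, q} (\<lambda>z. (P z)\<^sup>2) z + Av n {p, q} (\<lambda>z. (Q z)\<^sup>2) z))"
      by (simp only: Av_cmult Av_add)
    also have "\<dots> \<le> c * g" using P2 Q2 c0 by (intro mult_left_mono) auto
    finally show ?thesis .
  qed
  let ?C = "{p, q} \<union> (set js \<union> set is)"
  have "Av n X (\<lambda>z. phi z * edge_prod D z) = Av n (X - ?C) (Av n ?C (\<lambda>z. phi z * edge_prod D z))"
    using X by (intro Av_split_outer) auto
  also have "Av n ?C (\<lambda>z. phi z * edge_prod D z) = Av n {p, q} (Av n (set js \<union> set is) (\<lambda>z. phi z * edge_prod D z))"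
    using dist by (intro Av_Un) auto
  finally have "Av n X (\<lambda>z. phi z * edge_prod D z) z0
     = Av n (X - ?C) (Av n {p, q} (Av n (set js \<union> set is) (\<lambda>z. phi z * edge_prod D z))) z0" by simp
  then show ?thesis using Av_bound[OF n_pos _ pq, where X="X - ?C" and z=z0] X by simp
qed

end

lemma path_edges_append: "path_edges (xs @ a # ys) = path_edges (xs @ [a]) \<union> path_edges (a # ys)"
proof (induction xs rule: path_edges.induct)
  case ("2_2" v) then show ?case by (cases ys) auto
qed auto

lemma path_edges_rev: "path_edges (rev xs) = path_edges xs"
proof (induction xs rule: path_edges.induct)
  case (1 x y zs)
  have "path_edges (rev (x # y # zs)) = path_edges (rev zs @ [y]) \<union> path_edges [y, x]"
    using path_edges_append[of "rev zs" y "[x]"] by simp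
  then show ?case using 1 by (auto simp: insert_commute)
qed auto

context bip_kernel
begin

text \<open>Integrating out both arcs gives the square of the path kernel.\<close>

lemma t_cycle:
  assumes alt: "alt (p # is @ [q])" "alt (p # js @ [q])" and dist: "distinct (p # q # is @ js)"
    and len: "length is = length js" "is \<noteq> []"
  shows "t (path_edges (p # is @ [q]) \<union> path_edges (p # js @ [q])) = path_sq (side p) (replicate (length is) (\<lambda>_. 1))"
proof -
  let ?P1 = "path_edges (p # is @ [q])" and ?P2 = "path_edges (p # js @ [q])" and ?w = "replicate (length is) (\<lambda>_. 1)"
  have bip: "bip (?P1 \<union> ?P2)" using bip_pedges[OF alt(1)] bip_pedges[OF alt(2)] by (auto simp: bip_def)
  have disj: "?P1 \<inter> ?P2 = {}"
  proof (rule ccontr)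
    assume "?P1 \<inter> ?P2 \<noteq> {}"
    then obtain e where e: "e \<in> ?P1" "e \<in> ?P2" by blast
    then have "e \<inter> set is \<noteq> {}" using path_edges_meets[OF e(1) len(2)] by simp
    then show False using path_edges_subset[OF e(2)] dist by auto
  qed
  have half: "Av n (set ks) (edge_prod (path_edges (p # ks @ [q]))) z = path_kernel (side p) (replicate (length ks) (\<lambda>_. 1)) (z p) (z q)"
    if "distinct (p # ks @ [q])" "alt (p # ks @ [q])" for ks z
  proof -
    have "Av n (set ks) (\<lambda>z. edge_prod (path_edges (p # ks @ [q])) z * (\<Prod>c\<in>set ks. 1)) z
      = path_kernel (side p) (map (\<lambda>c x. 1) ks) (z p) (z q)"
      by (rule Av_path[OF that]) (simp add: indep_const)
    then show ?thesis by (simp add: map_replicate_const)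
  qed
  have h1: "Av n (set is) (edge_prod ?P1) z = path_kernel (side p) ?w (z p) (z q)" for z
    using half[OF _ alt(1)] dist by auto
  have h2: "Av n (set js) (edge_prod ?P2) z = path_kernel (side p) ?w (z p) (z q)" for z
    using half[OF _ alt(2)] dist len by auto
  have "e \<inter> set is = {}" if "e \<in> ?P2" for e using path_edges_subset[OF that] dist by auto
  then have 1: "indep (edge_prod ?P2) (set is)" by (intro edge_prod_indep[OF bip]) auto
  have "e \<inter> set js = {}" if "e \<in> ?P1" for e using path_edges_subset[OF that] dist by auto
  then have 2: "indep (edge_prod ?P1) (set js)" by (intro edge_prod_indep[OF bip]) auto
  have "\<Union>(?P1 \<union> ?P2) \<subseteq> {p, q} \<union> (set js \<union> set is)"
    by (auto dest!: path_edges_subset)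
  then have "t (?P1 \<union> ?P2) = Av n ({p, q} \<union> (set js \<union> set is)) (edge_prod (?P1 \<union> ?P2)) (\<lambda>_. 0)"
    using t_eq[OF bip] by (metis finite_Un finite_set finite.emptyI finite.insertI)
  also have "\<dots> = Av n {p, q} (Av n (set js) (Av n (set is) (edge_prod (?P1 \<union> ?P2)))) (\<lambda>_. 0)"
    using dist by (subst Av_Un, (auto)[3]) (subst Av_Un, auto)
  also have "edge_prod (?P1 \<union> ?P2) = (\<lambda>z. edge_prod ?P1 z * edge_prod ?P2 z)"
    by (intro ext edge_prod_Un finite_pedges disj)
  also have "Av n (set is) \<dots> = (\<lambda>z. Av n (set is) (edge_prod ?P1) z * edge_prod ?P2 z)"
    using 1 by (intro ext Av_mult_indep2) auto
  also have "Av n (set js) \<dots> = (\<lambda>z. Av n (set is) (edge_prod ?P1) z * Av n (set js) (edge_prod ?P2) z)"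
    using 2 by (intro ext Av_mult_indep indep_Av) (auto intro: indep_mono)
  also have "\<dots> = (\<lambda>z. (path_kernel (side p) ?w (z p) (z q))\<^sup>2)"
    by (simp only: h1 h2 power2_eq_square)
  also have "Av n {p, q} \<dots> (\<lambda>_. 0) = path_sq (side p) ?w"
    using dist by (simp add: Av_insert Av_sing path_sq_def)
  finally show ?thesis .
qed

text \<open>Cutting the cycle at the next antipodal pair changes the side on which the arcs begin, so both path
  norms agree with the density of the cycle.\<close>

lemma t_cycle':
  assumes alt: "alt (p # is @ [q])" "alt (p # js @ [q])" and dist: "distinct (p # q # is @ js)"
    and len: "length is = length js" "is \<noteq> []"
  shows "t (path_edges (p # is @ [q]) \<union> path_edges (p # js @ [q])) = path_sq s (replicate (length is) (\<lambda>_. 1))"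
proof (cases "s = side p")
  case True then show ?thesis using t_cycle[OF assms] by simp
next
  case False
  obtain i is' where i: "is = i # is'" using len by (cases "is") auto
  obtain js' j where j: "js = js' @ [j]" using len by (cases js rule: rev_cases) auto
  let ?E = "path_edges (p # is @ [q]) \<union> path_edges (p # js @ [q])"
  have e1: "path_edges (i # (is' @ [q]) @ [j]) = path_edges (i # is' @ [q]) \<union> {{q, j}}"
    using path_edges_append[of "i # is'" q "[j]"] by simp
  have e2: "path_edges (i # (p # js') @ [j]) = insert {i, p} (path_edges (p # js' @ [j]))"
    by simp
  have e3: "path_edges (p # js @ [q]) = path_edges (p # js' @ [j]) \<union> {{j, q}}"
    using path_edges_append[of "p # js'" j "[q]"] j by simp
  have E: "?E = path_edges (i # (is' @ [q]) @ [j]) \<union> path_edges (i # (p # js') @ [j])"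
    unfolding e1 e2 e3 i by (auto simp: insert_commute)
  have b: "bip ?E" using bip_pedges[OF alt(1)] bip_pedges[OF alt(2)] by (auto simp: bip_def)
  have "t ?E = path_sq (side i) (replicate (length (is' @ [q])) (\<lambda>_. 1))"
    unfolding E
  proof (rule t_cycle)
    show "alt (i # (is' @ [q]) @ [j])" "alt (i # (p # js') @ [j])"
      by (rule alt_bip[OF b], subst E, blast)+
  qed (use dist len i j in auto)
  moreover have "side i = s" using False alt(1) i by auto
  ultimately show ?thesis using i by simp
qed

lemma chordless_cycle_t:
  assumes "bip D" "chordless_cycle D p is q js"
  shows "t (path_edges (p # is @ [q]) \<union> path_edges (p # js @ [q])) = path_sq s (replicate (length is) (\<lambda>_. 1))"
  using assms by (intro t_cycle' alt_bip[OF assms(1)]) (auto simp: chordless_cycle_def)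

lemma chordless_cycle_subset:
  assumes "chordless_cycle D p is q js" "D' \<subseteq> D"
    "path_edges (p # is @ [q]) \<union> path_edges (p # js @ [q]) \<subseteq> D'"
  shows "chordless_cycle D' p is q js"
  using assms unfolding chordless_cycle_def by blast

end

section \<open>Smallness in the presence of a cycle\<close>

context bip_kernel
begin

text \<open>The density is the average of \<open>f h\<close>, where \<open>f\<close> is the degree function at \<open>a\<close> and \<open>h\<close> is the
  conditional average of the remaining edges. Cauchy--Schwarz leaves the mean of \<open>h\<^sup>2\<close>. One factor
  \<open>\<bar>h\<bar>\<close> is small at every point because of an edge avoiding \<open>a\<close>, and the mean of the other one is a
  density with a sign weight at \<open>a\<close>, which the cycle bounds. The vertex \<open>a\<close> may lie on the cycle if it
  is one of the two antipodal vertices at which the cycle is cut.\<close>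

lemma leaf_cycle_bound:
  assumes D: "bip D" and w: "inc D w = {{a, w}}" and e: "e \<in> D" "a \<notin> e"
    and C: "chordless_cycle (D - {{a, w}}) p is q js" and a: "a \<notin> set is \<union> set js"
    and g: "\<And>s. path_sq s (replicate (length is) (\<lambda>_. 1)) \<le> g"
  shows "(t D)\<^sup>2 \<le> alpha (side a) * (eta * g)"
proof -
  let ?X = "\<Union>D" and ?D' = "D - {{a, w}}"
  have fin: "finite ?X" by (rule bip_finite_Un[OF D])
  have aw: "{a, w} \<in> D" using w unfolding inc_def by blast
  note s = bip_edge(2)[OF D aw]
  define R where "R = ?X - {a, w}"
  define h where "h = Av n R (edge_prod ?D')"
  have D': "bip ?D'" using D by (rule bip_subset) auto
  have finR: "finite R" "{a} \<inter> R = {}" "w \<notin> R" using fin by (auto simp: R_def)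
  have wD': "w \<notin> b" if "b \<in> ?D'" for b using that w unfolding inc_def by blast
  have CsubD': "path_edges (p # is @ [q]) \<union> path_edges (p # js @ [q]) \<subseteq> ?D'" using C unfolding chordless_cycle_def by blast
  have Csub: "set (p # q # is @ js) \<subseteq> {a} \<union> R"
  proof
    fix x assume "x \<in> set (p # q # is @ js)"
    then have "\<exists>b\<in>?D'. x \<in> b" using cycle_vertex_covered[of x p q "is" js] CsubD' by blast
    then show "x \<in> {a} \<union> R" using wD' by (auto simp: R_def)
  qed
  have tD: "t D = Av n {a} (\<lambda>z. deg_fun (side a) (z a) * h z) (\<lambda>_. 0)"
  proof -
    have XX: "?X = {a} \<union> (R \<union> {w})" using aw by (auto simp: R_def)
    have "t D = Av n {a} (Av n R (Av n {w} (edge_prod D))) (\<lambda>_. 0)"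
      unfolding t_def XX using s fin finR
      by (subst Av_Un, (auto simp: R_def)[3]) (subst Av_Un, auto simp: R_def)
    also have "Av n {w} (edge_prod D) = (\<lambda>z. deg_fun (side a) (z a) * edge_prod ?D' z)"
      by (intro ext Av_leaf[OF D w])
    also have "Av n R \<dots> = (\<lambda>z. deg_fun (side a) (z a) * h z)"
      unfolding h_def using finR by (intro ext Av_mult_indep) (auto simp: indep_def)
    finally show ?thesis .
  qed
  obtain u v where uv: "e = {u, v}" using D e(1) unfolding bip_def by blast
  have "w \<notin> e" by (rule edge_off[OF D w e])
  then have uvR: "u \<in> R" "v \<in> R" "{u, v} \<in> ?D'" using e uv by (auto simp: R_def)
  have h_small: "\<bar>h z\<bar> \<le> eta" for z
    unfolding h_def by (rule edge_average_small[OF D' uvR(3) finR(1) uvR(1,2)])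
  have h_avg: "Av n {a} (\<lambda>z. \<bar>h z\<bar>) z \<le> 1 * g" for z
  proof -
    have "Av n {a} (\<lambda>z. \<bar>h z\<bar>) z = Av n ({a} \<union> R) (\<lambda>z. sgn (h z) * edge_prod ?D' z) z"
      unfolding h_def using Av_cond_abs[OF _ finR(1,2)] by simp
    also have "\<dots> \<le> \<bar>\<dots>\<bar>" by simp
    also have "\<dots> \<le> 1 * g"
    proof (rule chordless_cycle_bound[OF D' C _ Csub])
      have "indep (\<lambda>z. sgn (h z)) R"
        unfolding h_def by (intro indep_comp[of _ _ sgn] indep_Av) (simp add: indep_def)
      then show "indep (\<lambda>z. sgn (h z)) (set is \<union> set js)"
        by (rule indep_mono) (use Csub a in auto)
    qed (use finR g in \<open>auto simp: abs_sgn_eq\<close>)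
    finally show ?thesis .
  qed
  have "(t D)\<^sup>2 \<le> Av n {a} (\<lambda>z. (deg_fun (side a) (z a))\<^sup>2) (\<lambda>_. 0) * Av n {a} (\<lambda>z. (h z)\<^sup>2) (\<lambda>_. 0)"
    unfolding tD by (rule Av_CS)
  also have "\<dots> \<le> alpha (side a) * (eta * g)"
    unfolding Av_deg1_sq
  proof (rule mult_left_mono[OF _ alpha_nonneg])
    have "Av n {a} (\<lambda>z. (h z)\<^sup>2) (\<lambda>_. 0) \<le> Av n {a} (\<lambda>z. eta * \<bar>h z\<bar>) (\<lambda>_. 0)"
    proof (rule Av_mono)
      fix z show "(h z)\<^sup>2 \<le> eta * \<bar>h z\<bar>"
        using mult_right_mono[OF h_small[of z], of "\<bar>h z\<bar>"] by (simp add: power2_eq_square)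
    qed
    also have "\<dots> = eta * Av n {a} (\<lambda>z. \<bar>h z\<bar>) (\<lambda>_. 0)" by (rule Av_cmult)
    also have "\<dots> \<le> eta * g" using h_avg eta_nonneg by (intro mult_left_mono) auto
    finally show "Av n {a} (\<lambda>z. (h z)\<^sup>2) (\<lambda>_. 0) \<le> eta * g" .
  qed
  finally show ?thesis .
qed

text \<open>All edges at \<open>u\<close> or \<open>v\<close> are averaged over \<open>u\<close> and \<open>v\<close> first. This yields a weight that is small at
  every point and depends, among the coordinates on the cycle, only on the antipodal pair.\<close>

lemma far_edge_bound:
  assumes D: "bip D" and C: "chordless_cycle D p is q js" and uv: "{u, v} \<in> D"
    and off: "u \<notin> set (p # q # is @ js)" "v \<notin> set (p # q # is @ js)"
    and far: "\<And>e. e \<in> D \<Longrightarrow> u \<in> e \<or> v \<in> e \<Longrightarrow> e \<inter> (set is \<union> set js) = {}"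
    and g: "\<And>s. path_sq s (replicate (length is) (\<lambda>_. 1)) \<le> g"
  shows "\<bar>t D\<bar> \<le> eta * g"
proof -
  let ?X = "\<Union>D"
  define E1 where "E1 = {e \<in> D. u \<in> e \<or> v \<in> e}"
  define phi where "phi = Av n {u, v} (edge_prod E1)"
  have fin: "finite ?X" by (rule bip_finite_Un[OF D])
  have E1: "bip E1" "bip (D - E1)" "{u, v} \<in> E1" "E1 \<subseteq> D"
    using D uv by (auto intro: bip_subset simp: E1_def)
  have Csub: "path_edges (p # is @ [q]) \<union> path_edges (p # js @ [q]) \<subseteq> D - E1"
  proof
    fix b assume b: "b \<in> path_edges (p # is @ [q]) \<union> path_edges (p # js @ [q])"
    then have "b \<subseteq> set (p # q # is @ js)" by (auto dest!: path_edges_subset)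
    moreover have "b \<in> D" using b C unfolding chordless_cycle_def by blast
    ultimately show "b \<in> D - E1" using off by (auto simp: E1_def)
  qed
  have Cv: "set (p # q # is @ js) \<subseteq> ?X - {u, v}"
  proof
    fix x assume x: "x \<in> set (p # q # is @ js)"
    have "\<exists>b\<in>path_edges (p # is @ [q]) \<union> path_edges (p # js @ [q]). x \<in> b"
      by (rule cycle_vertex_covered[OF x])
    then show "x \<in> ?X - {u, v}" using Csub off x by blast
  qed
  have "t D = Av n (?X - {u, v}) (Av n {u, v} (edge_prod D)) (\<lambda>_. 0)"
    unfolding t_def using fin uv by (subst Av_split_outer[where Y="{u, v}"]) auto
  also have "edge_prod D = (\<lambda>z. edge_prod E1 z * edge_prod (D - E1) z)"
    using E1 bip_finite[OF D] by (intro ext edge_prod_split) auto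
  also have "Av n {u, v} \<dots> = (\<lambda>z. phi z * edge_prod (D - E1) z)"
    unfolding phi_def by (intro ext Av_mult_indep2 edge_prod_indep[OF D]) (auto simp: E1_def)
  finally have tD: "t D = Av n (?X - {u, v}) (\<lambda>z. phi z * edge_prod (D - E1) z) (\<lambda>_. 0)" .
  show ?thesis unfolding tD
  proof (rule chordless_cycle_bound[OF E1(2) chordless_cycle_subset[OF C _ Csub] _ Cv])
    show "\<bar>phi z\<bar> \<le> eta" for z
      unfolding phi_def by (rule edge_average_small[OF E1(1,3)]) auto
    show "indep phi (set is \<union> set js)"
      unfolding phi_def by (rule indep_Av, rule edge_prod_indep[OF D E1(4)]) (use far in \<open>auto simp: E1_def\<close>)
  qed (use fin g in auto)
qed

text \<open>The vertex \<open>u\<close> is adjacent to \<open>b1\<close> but not to \<open>b0\<close>. Cauchy--Schwarz in all coordinates other than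
  those of \<open>b0\<close>, \<open>b1\<close> and \<open>u\<close> separates the path through \<open>b0\<close>, which costs at most the density of the
  four-cycle, from the path through \<open>b1\<close> together with \<open>u\<close>. Squaring the latter gives a four-cycle
  with weights at \<open>b1\<close> and at its copy, each containing the average over \<open>u\<close> of the edges at \<open>u\<close>. This
  average is not small at every point, since \<open>u\<close> could act like a leaf. It is small in the mean over
  the coordinate of a second neighbour \<open>b2\<close> of \<open>u\<close>.\<close>

lemma four_cycle_bound:
  assumes D: "bip D" and E: "{a0, b0} \<in> D" "{a1, b0} \<in> D" "{a0, b1} \<in> D" "{a1, b1} \<in> D"
    and ne: "a0 \<noteq> a1" "b0 \<noteq> b1" "u \<noteq> a0" "u \<noteq> a1"
    and u: "{u, b1} \<in> D" "{u, b0} \<notin> D" "{u, b2} \<in> D" "b2 \<noteq> b1"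
    and g: "\<And>s. path_sq s [\<lambda>_. 1] \<le> g"
  shows "(t D)\<^sup>2 \<le> eta * (g * g)"
proof -
  let ?X = "\<Union>D"
  have fin: "finite ?X" "finite D" by (rule bip_finite_Un[OF D], rule bip_finite[OF D])
  define s where "s = side a0"
  have sides: "side a0 = s" "side a1 = s" "side u = s" "side b0 = (\<not> s)" "side b1 = (\<not> s)" "side b2 = (\<not> s)"
    using bip_edge(1)[OF D E(1)] bip_edge(1)[OF D E(2)] bip_edge(1)[OF D E(3)] bip_edge(1)[OF D E(4)]
      bip_edge(1)[OF D u(1)] bip_edge(1)[OF D u(3)] by (auto simp: s_def)
  have g0: "0 \<le> g" using g[of True] path_sq_nonneg[of True "[\<lambda>_. 1]"] by linarith
  have neq: "a0 \<noteq> b0" "a0 \<noteq> b1" "a0 \<noteq> b2" "a1 \<noteq> b0" "a1 \<noteq> b1" "a1 \<noteq> b2" "u \<noteq> b0" "u \<noteq> b1" "u \<noteq> b2" "b2 \<noteq> b0"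
    using sides u(2,3) by auto
  have same: "x = y" if "e \<in> D" "x \<in> e" "y \<in> e" "side x = side y" for e x y
    using bip_edgeE[OF D that(1,2)] that by auto
  define E1 where "E1 = {e \<in> D. b1 \<in> e \<or> u \<in> e}"
  define E0 where "E0 = {e \<in> D. e \<inter> {b0} \<noteq> {}}"
  define E2 where "E2 = D - E0 - E1"
  have noub: "\<not> (u \<in> e \<and> b0 \<in> e)" if "e \<in> D" for e
  proof
    assume "u \<in> e \<and> b0 \<in> e"
    then have "e = {u, b0}" using bip_edgeE[OF D that, of u] neq by auto
    then show False using that u(2) by simp
  qed
  have disj: "E0 \<inter> E1 = {}"
  proof (rule ccontr)
    assume "E0 \<inter> E1 \<noteq> {}"
    then obtain e where "e \<in> D" "b0 \<in> e" "b1 \<in> e \<or> u \<in> e" by (auto simp: E0_def E1_def)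
    then show False using noub same[of e b0 b1] sides ne by auto
  qed
  define Q0 where "Q0 = Av n {b0} (edge_prod E0)"
  define Q1 where "Q1 = Av n {b1, u} (edge_prod E1)"
  define R where "R = ?X - {b0, b1, u}"
  have finR: "finite R" using fin by (simp add: R_def)
  have tD: "t D = Av n R (\<lambda>z. (edge_prod E2 z * Q0 z) * Q1 z) (\<lambda>_. 0)"
  proof -
    have XX: "?X = R \<union> ({b1, u} \<union> {b0})" using E u by (auto simp: R_def)
    have "t D = Av n R (Av n {b1, u} (Av n {b0} (edge_prod D))) (\<lambda>_. 0)"
      unfolding t_def XX using fin neq ne
      by (subst Av_Un, (auto simp: R_def)[3]) (subst Av_Un, auto simp: R_def)
    also have "edge_prod D = (\<lambda>z. (edge_prod E2 z * edge_prod E1 z) * edge_prod E0 z)"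
    proof
      fix z
      have "edge_prod D z = edge_prod (E0 \<union> E1) z * edge_prod (D - (E0 \<union> E1)) z"
        by (rule edge_prod_split[OF fin(2)]) (auto simp: E0_def E1_def)
      moreover have "edge_prod (E0 \<union> E1) z = edge_prod E0 z * edge_prod E1 z"
        by (rule edge_prod_Un) (use fin disj in \<open>auto simp: E0_def E1_def\<close>)
      moreover have "D - (E0 \<union> E1) = E2" by (auto simp: E2_def)
      ultimately show "edge_prod D z = (edge_prod E2 z * edge_prod E1 z) * edge_prod E0 z" by simp
    qed
    also have "Av n {b0} \<dots> = (\<lambda>z. (edge_prod E2 z * edge_prod E1 z) * Q0 z)"
      unfolding Q0_def
      by (intro ext Av_mult_indep indep_mult edge_prod_indep[OF D]) (use disj in \<open>auto simp: E0_def E1_def E2_def\<close>)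
    also have "\<dots> = (\<lambda>z. (edge_prod E2 z * Q0 z) * edge_prod E1 z)" by (simp add: mult_ac)
    also have "Av n {b1, u} \<dots> = (\<lambda>z. (edge_prod E2 z * Q0 z) * Q1 z)"
      unfolding Q1_def Q0_def
    proof (intro ext Av_mult_indep indep_mult)
      show "indep (edge_prod E2) {b1, u}" by (rule edge_prod_indep[OF D]) (auto simp: E2_def E1_def)
      show "indep (Av n {b0} (edge_prod E0)) {b1, u}"
        by (rule indep_Av, rule edge_prod_indep[OF D]) (use disj in \<open>auto simp: E0_def E1_def\<close>)
    qed simp
    finally show ?thesis .
  qed
  have inR: "a0 \<in> R" "a1 \<in> R" "b2 \<in> R" using E u ne neq by (auto simp: R_def)
  have Q0: "Av n R (\<lambda>z. (Q0 z)\<^sup>2) z \<le> g" for z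
  proof -
    have pe: "path_edges (a0 # [b0] @ [a1]) = {{a0, b0}, {a1, b0}}" by (auto simp: insert_commute)
    have "Av n {a0, a1} (\<lambda>z. (Av n (set [b0]) (edge_prod {e \<in> D. e \<inter> set [b0] \<noteq> {}}) z)\<^sup>2) z \<le> g" for z
    proof (rule half_path_sq[OF D])
      fix e assume e: "e \<in> D" "e \<inter> set [b0] \<noteq> {}" "e \<subseteq> set (a0 # [b0] @ [a1])"
      then have "b0 \<in> e" by simp
      from bip_edgeE[OF D e(1) this] obtain v where "e = {b0, v}" "b0 \<noteq> v" by metis
      then show "e \<in> path_edges (a0 # [b0] @ [a1])" using e(3) unfolding pe by (auto simp: insert_commute)
    qed (use E ne neq g in \<open>auto simp: insert_commute\<close>)
    then have *: "Av n {a0, a1} (\<lambda>z. (Q0 z)\<^sup>2) z \<le> g" for z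
      by (simp add: Q0_def E0_def)
    have "Av n R (\<lambda>z. (Q0 z)\<^sup>2) z = Av n (R - {a0, a1}) (Av n {a0, a1} (\<lambda>z. (Q0 z)\<^sup>2)) z"
      using inR finR by (subst Av_split_outer[where Y="{a0, a1}"]) auto
    also have "\<dots> \<le> Av n (R - {a0, a1}) (\<lambda>_. g) z" by (rule Av_mono) (rule *)
    finally show ?thesis using finR by (simp add: Av_const n_pos)
  qed
  define O1 where "O1 = inc D b1 - {{a0, b1}, {a1, b1}, {u, b1}}"
  define G where "G = Av n {u} (edge_prod (inc D u))"
  define H where "H z = edge_prod O1 z * G z" for z
  have incu: "bip (inc D u)" using D by (rule bip_subset) (auto simp: inc_def)
  have G1: "\<bar>G z\<bar> \<le> 1" for z
    unfolding G_def by (rule Av_bound[OF n_pos]) (auto simp: edge_prod_bound)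
  have HG: "\<bar>H z\<bar> \<le> \<bar>G z\<bar>" for z
    unfolding H_def abs_mult using edge_prod_bound[of O1 z] by (simp add: mult_left_le_one_le)
  have Hi: "indep H {a0, a1}"
    unfolding H_def G_def
  proof (intro indep_mult indep_Av)
    show "indep (edge_prod O1) {a0, a1}"
    proof (rule edge_prod_indep[OF D])
      fix e assume "e \<in> O1"
      then have e: "e \<in> D" "b1 \<in> e" "e \<notin> {{a0, b1}, {a1, b1}, {u, b1}}" unfolding O1_def inc_def by blast+
      from bip_edgeE[OF D e(1,2)] obtain v where "e = {b1, v}" by metis
      then show "e \<inter> {a0, a1} = {}" using e(3) neq by (auto simp: insert_commute)
    qed (auto simp: O1_def inc_def)
    show "indep (edge_prod (inc D u)) ({a0, a1} - {u})"
    proof (rule edge_prod_indep[OF D])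
      fix e assume "e \<in> inc D u"
      then have e: "e \<in> D" "u \<in> e" unfolding inc_def by blast+
      show "e \<inter> ({a0, a1} - {u}) = {}"
        using same[OF e(1) e(2), of a0] same[OF e(1) e(2), of a1] sides ne by auto
    qed (auto simp: inc_def)
  qed
  \<comment> \<open>The edges at \<open>b1\<close> that lead neither into the four-cycle nor to \<open>u\<close> form the factor \<open>O1\<close>.\<close>
  have Q1_eq: "Q1 z = avg n (\<lambda>y. M s (z a0) y * M s (z a1) y * H (z(b1 := y)))" for z
  proof -
    have E1: "E1 = {{a0, b1}, {a1, b1}} \<union> (O1 \<union> inc D u)"
      using E u by (auto simp: E1_def O1_def inc_def insert_commute)
    have d1: "{{a0, b1}, {a1, b1}} \<inter> (O1 \<union> inc D u) = {}"
      using ne neq by (auto simp: O1_def inc_def)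
    have d2: "O1 \<inter> inc D u = {}"
    proof (rule ccontr)
      assume "O1 \<inter> inc D u \<noteq> {}"
      then obtain e where e: "e \<in> D" "b1 \<in> e" "u \<in> e" "e \<noteq> {u, b1}" unfolding O1_def inc_def by blast
      from bip_edgeE[OF D e(1,3)] obtain v where "e = {u, v}" by metis
      then show False using e neq by auto
    qed
    have p: "edge_prod E1 = (\<lambda>z. (fac {a0, b1} z * fac {a1, b1} z * edge_prod O1 z) * edge_prod (inc D u) z)"
    proof
      fix z
      have "edge_prod E1 z = edge_prod {{a0, b1}, {a1, b1}} z * (edge_prod O1 z * edge_prod (inc D u) z)"
        unfolding E1 using d1 d2 fin(2) by (subst edge_prod_Un, (auto simp: O1_def inc_def)[3]) (subst edge_prod_Un, auto simp: O1_def inc_def)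
      moreover have "{a0, b1} \<noteq> {a1, b1}" using ne by (auto simp: doubleton_eq_iff)
      then have "edge_prod {{a0, b1}, {a1, b1}} z = fac {a0, b1} z * fac {a1, b1} z"
        by (simp add: edge_prod_def)
      ultimately show "edge_prod E1 z = (fac {a0, b1} z * fac {a1, b1} z * edge_prod O1 z) * edge_prod (inc D u) z" by simp
    qed
    have O1u: "e \<inter> {u} = {}" if "e \<in> O1" for e using d2 that by (auto simp: O1_def inc_def)
    have "Q1 z = Av n {b1} (Av n {u} (edge_prod E1)) z"
      unfolding Q1_def using Av_Un[of "{b1}" "{u}" n "edge_prod E1"] neq by (simp add: insert_commute)
    also have "Av n {u} (edge_prod E1) = (\<lambda>z. fac {a0, b1} z * fac {a1, b1} z * edge_prod O1 z * G z)"
      unfolding G_def p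
    proof (intro ext Av_mult_indep indep_mult)
      show "indep (edge_prod O1) {u}" by (rule edge_prod_indep[OF D]) (use O1u in \<open>auto simp: O1_def inc_def\<close>)
      show "indep (fac {a0, b1}) {u}" "indep (fac {a1, b1}) {u}"
        using ne neq E by (auto intro!: fac_indep[OF D])
    qed simp
    finally show ?thesis using neq sides by (simp add: Av_sing fac_eq H_def mult.assoc)
  qed
  define kap where "kap y = avg n (\<lambda>y'. (codeg s y y')\<^sup>2)" for y
  have kap0: "0 \<le> kap y" for y by (simp add: kap_def avg_nonneg)
  have Q1a: "Av n {a0, a1} (\<lambda>z. (Q1 z)\<^sup>2) z \<le> avg n (\<lambda>y. \<bar>G (z(b1 := y))\<bar> * kap y)" for z
  proof -
    have tw: "H (z(a0 := x, a1 := x', b1 := y)) = H (z(b1 := y))" for x x' y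
      using Hi unfolding fun_upd_twist[OF neq(5)] fun_upd_twist[OF neq(2)] by (simp add: indep_def)
    have "Av n {a0, a1} (\<lambda>z. (Q1 z)\<^sup>2) z
      = avg n (\<lambda>x. avg n (\<lambda>x'. (avg n (\<lambda>y. M s x y * M s x' y * H (z(b1 := y))))\<^sup>2))"
      using ne tw by (simp add: Av_insert Av_sing Q1_eq)
    also have "\<dots> \<le> avg n (\<lambda>y. \<bar>H (z(b1 := y))\<bar> * kap y)"
      unfolding kap_def by (rule path2_sq_bound) (meson HG G1 order_trans)
    also have "\<dots> \<le> avg n (\<lambda>y. \<bar>G (z(b1 := y))\<bar> * kap y)"
      using HG kap0 by (intro avg_mono mult_right_mono) auto
    finally show ?thesis .
  qed
  have Gb2: "Av n {b2} (\<lambda>z. \<bar>G z\<bar>) z \<le> eta" for z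
    unfolding G_def
    by (rule conditional_average_small[OF incu, of b2 u]) (use u neq in \<open>auto simp: inc_def insert_commute\<close>)
  \<comment> \<open>The coordinate of \<open>b2\<close> enters only through \<open>G\<close>, so it can be averaged under the outer mean.\<close>
  have Q1b: "Av n {b2} (\<lambda>z. avg n (\<lambda>y. \<bar>G (z(b1 := y))\<bar> * kap y)) z \<le> eta * g" for z
  proof -
    have "Av n {b2} (\<lambda>z. avg n (\<lambda>y. \<bar>G (z(b1 := y))\<bar> * kap y)) z
       = avg n (\<lambda>y. Av n {b2} (\<lambda>z. \<bar>G z\<bar>) (z(b1 := y)) * kap y)"
      unfolding Av_sing fun_upd_twist[OF u(4)] by (subst avg_swap) (simp add: avg_multc)
    also have "\<dots> \<le> avg n (\<lambda>y. eta * kap y)"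
      using Gb2 kap0 by (intro avg_mono mult_right_mono) auto
    also have "\<dots> = eta * path_sq s [\<lambda>_. 1]"
      by (simp only: avg_cmult kap_def codeg_sq_eq)
    also have "\<dots> \<le> eta * g" using g eta_nonneg by (intro mult_left_mono) auto
    finally show ?thesis .
  qed
  have Q1: "Av n R (\<lambda>z. (Q1 z)\<^sup>2) z \<le> eta * g" for z
  proof -
    have "Av n R (\<lambda>z. (Q1 z)\<^sup>2) z = Av n (R - {a0, a1, b2}) (Av n {b2} (Av n {a0, a1} (\<lambda>z. (Q1 z)\<^sup>2))) z"
    proof -
      have RR: "R = (R - {a0, a1, b2}) \<union> ({b2} \<union> {a0, a1})" using inR by auto
      show ?thesis using finR neq
        by (subst RR, subst Av_Un, (auto)[3]) (subst Av_Un, auto)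
    qed
    also have "\<dots> \<le> Av n (R - {a0, a1, b2}) (\<lambda>_. eta * g) z"
      by (rule Av_mono, rule order_trans[OF Av_mono Q1b], rule Q1a)
    finally show ?thesis using finR by (simp add: Av_const n_pos)
  qed
  have "(t D)\<^sup>2 \<le> Av n R (\<lambda>z. (edge_prod E2 z * Q0 z)\<^sup>2) (\<lambda>_. 0) * Av n R (\<lambda>z. (Q1 z)\<^sup>2) (\<lambda>_. 0)"
    unfolding tD by (rule Av_CS)
  also have "\<dots> \<le> g * (eta * g)"
  proof (rule mult_mono[OF _ Q1 g0])
    have "(edge_prod E2 z * Q0 z)\<^sup>2 \<le> (Q0 z)\<^sup>2" for z
      using edge_prod_bound[of E2 z] by (simp add: power_mult_distrib mult_left_le_one_le abs_square_le_1)
    then have "Av n R (\<lambda>z. (edge_prod E2 z * Q0 z)\<^sup>2) (\<lambda>_. 0) \<le> Av n R (\<lambda>z. (Q0 z)\<^sup>2) (\<lambda>_. 0)"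
      by (rule Av_mono)
    also have "\<dots> \<le> g" by (rule Q0)
    finally show "Av n R (\<lambda>z. (edge_prod E2 z * Q0 z)\<^sup>2) (\<lambda>_. 0) \<le> g" .
    show "0 \<le> Av n R (\<lambda>z. (Q1 z)\<^sup>2) (\<lambda>_. 0)" by (rule Av_nonneg) simp
  qed
  finally show ?thesis by (simp add: mult_ac)
qed

end

section \<open>Cycles in bigraphs\<close>

text \<open>A cycle is a list of distinct vertices in cyclic order, so that arcs are sublists and rotations can
  be used to choose the starting point.\<close>

definition cyc :: "'v set set \<Rightarrow> 'v list \<Rightarrow> bool" where
  "cyc D vs \<longleftrightarrow> distinct vs \<and> 3 \<le> length vs \<and> path_edges (vs @ [hd vs]) \<subseteq> D"

definition shortest_cyc :: "'v set set \<Rightarrow> 'v list \<Rightarrow> bool" where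
  "shortest_cyc D vs \<longleftrightarrow> cyc D vs \<and> (\<forall>ws. cyc D ws \<longrightarrow> length vs \<le> length ws)"

lemma path_edges_closed_rotate:
  "path_edges (x # xs @ y # ys @ [x]) = path_edges (y # ys @ x # xs @ [y])"
  using path_edges_append[of "x # xs" y "ys @ [x]"] path_edges_append[of "y # ys" x "xs @ [y]"] by auto

lemma cyc_rotate_to:
  assumes "cyc D vs" "x \<in> set vs"
  obtains ws where "cyc D (x # ws)" "set (x # ws) = set vs" "length (x # ws) = length vs"
    "path_edges (x # ws @ [x]) = path_edges (vs @ [hd vs])"
proof -
  obtain as bs where vs: "vs = as @ x # bs" using assms(2) by (meson split_list)
  show ?thesis
  proof (cases as)
    case Nil
    then show ?thesis using that[of bs] assms vs by simp
  next
    case (Cons a as')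
    have e: "path_edges (x # (bs @ as) @ [x]) = path_edges (vs @ [hd vs])"
      using path_edges_closed_rotate[of a as' x bs] vs Cons by simp
    show ?thesis
      by (rule that[of "bs @ as"]) (use assms(1) e vs Cons in \<open>auto simp: cyc_def\<close>)
  qed
qed

lemma shortest_cyc_exists: "cyc D vs \<Longrightarrow> \<exists>ws. shortest_cyc D ws"
  unfolding shortest_cyc_def
  using ex_has_least_nat[of "cyc D" vs length] by blast

lemma shortest_cyc_rotate:
  assumes "shortest_cyc D vs" "x \<in> set vs"
  obtains ws where "shortest_cyc D (x # ws)" "set (x # ws) = set vs" "length (x # ws) = length vs"
    "path_edges (x # ws @ [x]) = path_edges (vs @ [hd vs])"
proof -
  have c: "cyc D vs" using assms(1) by (simp add: shortest_cyc_def)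
  obtain ws where w: "cyc D (x # ws)" "set (x # ws) = set vs" "length (x # ws) = length vs"
    "path_edges (x # ws @ [x]) = path_edges (vs @ [hd vs])" by (rule cyc_rotate_to[OF c assms(2)])
  have "shortest_cyc D (x # ws)" using w assms(1) unfolding shortest_cyc_def by metis
  then show ?thesis using that w by blast
qed

text \<open>A chord would cut off a strictly shorter cycle.\<close>

lemma chord_impossible:
  assumes s: "shortest_cyc D vs" and xy: "x \<in> set vs" "y \<in> set vs" "x \<noteq> y" and e: "{x, y} \<in> D"
  shows "{x, y} \<in> path_edges (vs @ [hd vs])"
proof -
  obtain ws where w: "shortest_cyc D (x # ws)" "set (x # ws) = set vs" "length (x # ws) = length vs"
    "path_edges (x # ws @ [x]) = path_edges (vs @ [hd vs])" by (rule shortest_cyc_rotate[OF s xy(1)])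
  then have "y \<in> set ws" using xy by auto
  then obtain as bs where ws: "ws = as @ y # bs" by (meson split_list)
  have E: "path_edges (x # ws @ [x]) = path_edges (x # as @ [y]) \<union> path_edges (y # bs @ [x])"
    using path_edges_append[of "x # as" y "bs @ [x]"] ws by simp
  show ?thesis
  proof (cases "as = [] \<or> bs = []")
    case True
    then show ?thesis unfolding w(4)[symmetric] E by (auto simp: insert_commute)
  next
    case False
    have c: "cyc D (x # ws)" using w(1) by (simp add: shortest_cyc_def)
    have "path_edges ((x # as @ [y]) @ [x]) = path_edges (x # as @ [y]) \<union> {{y, x}}"
      using path_edges_append[of "x # as" y "[x]"] by simp
    then have "cyc D (x # as @ [y])"
      using c e E ws False unfolding cyc_def by (auto simp: insert_commute Suc_le_eq)
    then have "length (x # ws) \<le> length (x # as @ [y])" using w(1) unfolding shortest_cyc_def by blast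
    then show ?thesis using False ws by simp
  qed
qed

lemma cyc_close:
  assumes "distinct (u # x # as @ [y])" "path_edges (x # as @ [y]) \<subseteq> D" "{u, x} \<in> D" "{u, y} \<in> D"
  shows "cyc D (u # x # as @ [y])"
proof -
  have "path_edges (x # as @ [y, u]) = path_edges (x # as @ [y]) \<union> {{y, u}}"
    using path_edges_append[of "x # as" y "[u]"] by simp
  moreover have "{y, u} \<in> D" using assms(4) by (simp add: insert_commute)
  ultimately show ?thesis using assms(1-3) unfolding cyc_def by simp
qed

lemma cyc_close2:
  assumes "distinct (u # x # as @ [y, v])" "path_edges (x # as @ [y]) \<subseteq> D" "{u, x} \<in> D" "{v, y} \<in> D" "{u, v} \<in> D"
  shows "cyc D (u # x # as @ [y, v])"
proof -
  have "path_edges (x # as @ [y, v, u]) = path_edges (x # as @ [y]) \<union> {{y, v}, {v, u}}"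
    using path_edges_append[of "x # as" y "[v, u]"] by auto
  moreover have "{y, v} \<in> D" "{v, u} \<in> D" using assms(4,5) by (simp_all add: insert_commute)
  ultimately show ?thesis using assms(1-3) unfolding cyc_def by simp
qed

text \<open>Two neighbours of \<open>u\<close> on the cycle split it into two arcs, and each arc closes up through \<open>u\<close>. One
  of the two resulting cycles is shorter if the length is at least six.\<close>

lemma outside_nbr_unique:
  assumes s: "shortest_cyc D vs" and len: "6 \<le> length vs" and u: "u \<notin> set vs"
    and xy: "x \<in> set vs" "y \<in> set vs" and e: "{u, x} \<in> D" "{u, y} \<in> D"
  shows "x = y"
proof (rule ccontr)
  assume ne: "x \<noteq> y"
  obtain ws where w: "shortest_cyc D (x # ws)" "set (x # ws) = set vs" "length (x # ws) = length vs"
    by (rule shortest_cyc_rotate[OF s xy(1)])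
  then have "y \<in> set ws" using xy ne by auto
  then obtain as bs where ws: "ws = as @ y # bs" by (meson split_list)
  have c: "cyc D (x # ws)" using w(1) by (simp add: shortest_cyc_def)
  have E: "path_edges (x # as @ [y]) \<union> path_edges (y # bs @ [x]) \<subseteq> D"
    using path_edges_append[of "x # as" y "bs @ [x]"] ws c unfolding cyc_def by simp
  have un: "u \<notin> set (x # ws)" using u w(2) by simp
  have "cyc D (u # x # as @ [y])"
    by (rule cyc_close) (use c E e un ws in \<open>auto simp: cyc_def\<close>)
  then have 1: "length (x # ws) \<le> length (u # x # as @ [y])" using w(1) unfolding shortest_cyc_def by blast
  have "cyc D (u # y # bs @ [x])"
    by (rule cyc_close) (use c E e un ws in \<open>auto simp: cyc_def\<close>)
  then have 2: "length (x # ws) \<le> length (u # y # bs @ [x])" using w(1) unfolding shortest_cyc_def by blast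
  show False using 1 2 len w(3) ws by simp
qed

text \<open>As for a single vertex, with a detour of length three: both arcs must have at least half of the
  length of the cycle, so they are equal.\<close>

lemma outside_edge_opposite:
  assumes s: "shortest_cyc D (x # as @ y # bs)" and len: "6 \<le> length (x # as @ y # bs)"
    and uv: "u \<notin> set (x # as @ y # bs)" "v \<notin> set (x # as @ y # bs)" "u \<noteq> v"
    and e: "{u, v} \<in> D" "{u, x} \<in> D" "{v, y} \<in> D"
  shows "length as = length bs"
proof -
  have c: "cyc D (x # as @ y # bs)" using s by (simp add: shortest_cyc_def)
  have E: "path_edges (x # as @ [y]) \<union> path_edges (y # bs @ [x]) \<subseteq> D"
    using path_edges_append[of "x # as" y "bs @ [x]"] c unfolding cyc_def by simp
  have "cyc D (u # x # as @ [y, v])"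
    by (rule cyc_close2) (use c E e uv in \<open>auto simp: cyc_def\<close>)
  then have 1: "length (x # as @ y # bs) \<le> length (u # x # as @ [y, v])" using s unfolding shortest_cyc_def by blast
  have "cyc D (v # y # bs @ [x, u])"
    by (rule cyc_close2) (use c E e uv in \<open>auto simp: cyc_def insert_commute[of v u]\<close>)
  then have 2: "length (x # as @ y # bs) \<le> length (v # y # bs @ [x, u])" using s unfolding shortest_cyc_def by blast
  show ?thesis using 1 2 len by simp
qed

context bip_kernel
begin

lemma alt_last: "alt xs \<Longrightarrow> xs \<noteq> [] \<Longrightarrow> side (last xs) = (if odd (length xs) then side (hd xs) else \<not> side (hd xs))"
  by (induction xs rule: path_edges.induct) auto

lemma cyc_even: assumes "bip D" "cyc D vs" shows "even (length vs)"
proof -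
  have "alt (vs @ [hd vs])" using assms by (intro alt_bip[of D]) (auto simp: cyc_def)
  from alt_last[OF this] show ?thesis using assms(2) by (cases vs) (auto simp: cyc_def split: if_splits)
qed

text \<open>Bipartiteness makes the length even, so the starting vertex has an antipode.\<close>

lemma cyc_split:
  assumes "bip D" "cyc D (p # ws)"
  obtains "is" q js where "p # ws = p # is @ q # rev js" "length is = length js" "is \<noteq> []"
    "distinct (p # q # is @ js)"
    "path_edges (p # ws @ [p]) = path_edges (p # is @ [q]) \<union> path_edges (p # js @ [q])"
proof -
  define k where "k = (length ws - 1) div 2"
  have "even (length (p # ws))" by (rule cyc_even[OF assms])
  moreover have "3 \<le> length (p # ws)" using assms(2) by (simp add: cyc_def)
  ultimately have len: "length ws = 2 * k + 1" "k \<ge> 1" by (auto simp: k_def) presburger+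
  define "is" where "is = take k ws"
  define q where "q = ws ! k"
  define js where "js = rev (drop (Suc k) ws)"
  have ws: "ws = is @ q # rev js"
    using id_take_nth_drop[of k ws] len by (simp add: is_def q_def js_def)
  have l: "length is = k" "length js = k" using len by (auto simp: is_def js_def)
  have "path_edges (p # ws @ [p]) = path_edges (p # is @ [q]) \<union> path_edges (q # rev js @ [p])"
    using path_edges_append[of "p # is" q "rev js @ [p]"] ws by simp
  also have "path_edges (q # rev js @ [p]) = path_edges (p # js @ [q])"
    using path_edges_rev[of "p # js @ [q]"] by simp
  finally show ?thesis
  proof (intro that[of "is" q js])
    show "distinct (p # q # is @ js)" using assms(2) ws by (auto simp: cyc_def)
    show "is \<noteq> []" using l(1) len(2) by auto
  qed (use ws l in auto)
qed

lemma shortest_chordless: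
  assumes "bip D" "shortest_cyc D (p # ws)"
  obtains "is" q js where "p # ws = p # is @ q # rev js" "chordless_cycle D p is q js"
    "path_edges (p # ws @ [p]) = path_edges (p # is @ [q]) \<union> path_edges (p # js @ [q])"
proof -
  have c: "cyc D (p # ws)" using assms(2) by (simp add: shortest_cyc_def)
  obtain "is" q js where s: "p # ws = p # is @ q # rev js" "length is = length js" "is \<noteq> []"
    "distinct (p # q # is @ js)"
    "path_edges (p # ws @ [p]) = path_edges (p # is @ [q]) \<union> path_edges (p # js @ [q])"
    by (rule cyc_split[OF assms(1) c])
  have "chordless_cycle D p is q js"
    unfolding chordless_cycle_def
  proof (intro conjI ballI impI)
    show "path_edges (p # is @ [q]) \<union> path_edges (p # js @ [q]) \<subseteq> D" using c s(5) unfolding cyc_def by simp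
    fix e assume e: "e \<in> D" "e \<subseteq> set (p # q # is @ js)"
    obtain x y where xy: "e = {x, y}" "side x" "\<not> side y" using assms(1) e(1) unfolding bip_def by blast
    have set: "set (p # ws) = set (p # q # is @ js)" using s(1) by auto
    have "{x, y} \<in> path_edges ((p # ws) @ [hd (p # ws)])"
      by (rule chord_impossible[OF assms(2)]) (use xy e set in auto)
    then show "e \<in> path_edges (p # is @ [q]) \<union> path_edges (p # js @ [q])" using xy s(5) by simp
  qed (use s in auto)
  then show ?thesis using that s by blast
qed

text \<open>Both ends of a longest path have all their neighbours on the path. An end that has a neighbour other
  than its predecessor would close a cycle.\<close>

lemma two_leaves_or_cycle:
  assumes D: "bip D" "D \<noteq> {}" and no: "\<not> (\<exists>vs. cyc D vs)"
  obtains w w' a a' where "w \<noteq> w'" "inc D w = {{a, w}}" "inc D w' = {{a', w'}}"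
proof -
  define pth where "pth xs \<longleftrightarrow> distinct xs \<and> 2 \<le> length xs \<and> path_edges xs \<subseteq> D" for xs
  obtain e where "e \<in> D" using D by auto
  then obtain u v where uv: "{u, v} \<in> D" "u \<noteq> v" using D(1) unfolding bip_def by metis
  have p0: "pth [u, v]" using uv by (simp add: pth_def)
  have bound: "length xs \<le> card (\<Union>D)" if "pth xs" for xs
  proof -
    have "set xs \<subseteq> \<Union>D" using path_edges_cover[of _ xs] that unfolding pth_def by blast
    then show ?thesis using card_mono[OF bip_finite_Un[OF D(1)]] that by (simp add: pth_def distinct_card[symmetric])
  qed
  obtain xs where xs: "pth xs" and max: "\<And>ys. pth ys \<Longrightarrow> length ys \<le> length xs"
    using ex_has_greatest_nat[of pth "[u, v]" length "Suc (card (\<Union>D))"] p0 bound le_imp_less_Suc by blast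
  have leaf: "\<exists>a. inc D (last ys) = {{a, last ys}}" if ys: "pth ys" "length ys = length xs" for ys
  proof -
    obtain zs y x where z: "ys = zs @ [y, x]"
    proof -
      have "ys \<noteq> []" using ys(1) by (auto simp: pth_def)
      then obtain us x where 1: "ys = us @ [x]" by (metis rev_exhaust)
      then have "us \<noteq> []" using ys(1) by (auto simp: pth_def)
      then obtain zs y where "us = zs @ [y]" by (metis rev_exhaust)
      then show ?thesis using that[of zs y x] 1 by simp
    qed
    have yx: "{y, x} \<in> D" using ys(1) z path_edges_append[of zs y "[x]"] by (auto simp: pth_def)
    have "e = {y, x}" if e: "e \<in> D" "x \<in> e" for e
    proof (rule ccontr)
      assume ne: "e \<noteq> {y, x}"
      obtain w where w: "e = {x, w}" "x \<noteq> w" by (rule bip_edgeE[OF D(1) e])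
      show False
      proof (cases "w \<in> set ys")
        case False
        have "path_edges (ys @ [w]) = path_edges ys \<union> {{x, w}}"
          using path_edges_append[of "zs @ [y]" x "[w]"] z by simp
        then have "pth (ys @ [w])" using ys(1) e w False by (auto simp: pth_def)
        then show False using max ys(2) by fastforce
      next
        case True
        then have "w \<in> set zs" using w ne z by (auto simp: insert_commute)
        then obtain as bs where zs: "zs = as @ w # bs" by (meson split_list)
        have "path_edges ys = path_edges (as @ [w]) \<union> path_edges (w # bs @ [y, x])"
          using path_edges_append[of as w "bs @ [y, x]"] z zs by simp
        moreover have "path_edges ((w # bs @ [y, x]) @ [w]) = path_edges (w # bs @ [y, x]) \<union> {{x, w}}"
          using path_edges_append[of "w # bs @ [y]" x "[w]"] by simp
        ultimately have "cyc D (w # bs @ [y, x])"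
          using ys(1) e w z zs by (auto simp: pth_def cyc_def)
        then show False using no by blast
      qed
    qed
    then have "inc D x = {{y, x}}" using yx unfolding inc_def by blast
    then show ?thesis using z by auto
  qed
  have rev: "pth (rev xs)" using xs by (simp add: pth_def path_edges_rev)
  obtain a where a: "inc D (last xs) = {{a, last xs}}" using leaf[OF xs] by auto
  obtain a' where a': "inc D (last (rev xs)) = {{a', last (rev xs)}}" using leaf[OF rev] by auto
  have "last xs \<noteq> last (rev xs)"
  proof -
    obtain x y zs where "xs = x # y # zs" using xs by (cases xs; cases "tl xs") (auto simp: pth_def)
    then show ?thesis using xs by (auto simp: pth_def last_rev)
  qed
  then show ?thesis using that a a' by blast
qed

end

section \<open>Charging a subgraph to a cherry or a cycle\<close>

context bip_kernel
begin

definition biclique :: "'v set \<Rightarrow> 'v set \<Rightarrow> 'v set set" where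
  "biclique A B = (\<lambda>(a, b). {a, b}) ` (A \<times> B)"

text \<open>The quantity \<open>P\<close> dominates what the estimates produce as main factors: mean squares of degree
  functions at nodes of degree at least two, and densities of even cycles.\<close>

definition charged :: "'v set set \<Rightarrow> real \<Rightarrow> bool" where
  "charged D P \<longleftrightarrow> 0 \<le> P \<and> (\<forall>a. 2 \<le> card (inc D a) \<longrightarrow> alpha (side a) \<le> P) \<and>
     (\<forall>D' p is q js. D' \<subseteq> D \<longrightarrow> chordless_cycle D' p is q js \<longrightarrow>
        t (path_edges (p # is @ [q]) \<union> path_edges (p # js @ [q])) \<le> P)"

text \<open>A cycle has the same density read from either side, so a bound for its density bounds the path norms
  for both values of \<open>s\<close>.\<close>

lemma charged_cycle:
  assumes "charged D P" "bip D" "D' \<subseteq> D" "chordless_cycle D' p is q js"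
  shows "path_sq s (replicate (length is) (\<lambda>_. 1)) \<le> P"
proof -
  have "t (path_edges (p # is @ [q]) \<union> path_edges (p # js @ [q])) \<le> P"
    using assms(1,3,4) unfolding charged_def by blast
  then show ?thesis using chordless_cycle_t[OF bip_subset[OF assms(2,3)] assms(4)] by metis
qed

lemma inc_card2:
  assumes "bip D" "{a, w} \<in> D" "inc D a \<noteq> {{a, w}}"
  shows "2 \<le> card (inc D a)" "\<exists>w'. {a, w'} \<in> D \<and> w' \<noteq> w"
proof -
  have fin: "finite (inc D a)" using bip_finite[OF assms(1)] by (simp add: inc_def)
  have "{a, w} \<in> inc D a" using assms(2) by (simp add: inc_def)
  then obtain e where e: "e \<in> inc D a" "e \<noteq> {a, w}" using assms(3) by blast
  have "card {e, {a, w}} \<le> card (inc D a)"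
    using e \<open>{a, w} \<in> inc D a\<close> by (intro card_mono[OF fin]) auto
  then show "2 \<le> card (inc D a)" using e by simp
  have e': "e \<in> D" "a \<in> e" using e by (auto simp: inc_def)
  obtain w' where "e = {a, w'}" by (rule bip_edgeE[OF assms(1) e'])
  then show "\<exists>w'. {a, w'} \<in> D \<and> w' \<noteq> w" using e e' by auto
qed

lemma abs_le_of_square:
  assumes "x\<^sup>2 \<le> eta * (P * P)" "kappa\<^sup>2 = eta" "0 \<le> kappa" "0 \<le> P"
  shows "\<bar>x\<bar> \<le> kappa * P"
proof -
  have "x\<^sup>2 \<le> (kappa * P)\<^sup>2" using assms by (simp add: power2_eq_square mult_ac)
  then show ?thesis using assms by (metis abs_le_square_iff abs_of_nonneg mult_nonneg_nonneg)
qed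

text \<open>A leaf \<open>w\<close> at \<open>a\<close> is given. If removing it leaves a cycle, the leaf and the cycle are used together.
  Otherwise the rest is a forest with two leaves, one of which differs from \<open>a\<close> and is therefore a
  leaf \<open>w'\<close> of the whole graph. The two leaves have a common neighbour, or different neighbours with
  enough edges elsewhere, or the graph is a path with three edges.\<close>

lemma leaf_case:
  assumes D: "bip D" and ch: "charged D P" and w: "inc D w = {{a, w}}"
    and kap: "0 \<le> kappa" "kappa \<le> 1" "kappa\<^sup>2 = eta"
    and star: "\<And>a. \<exists>e\<in>D. a \<notin> e"
  shows "\<bar>t D\<bar> \<le> kappa * P"
proof -
  have P0: "0 \<le> P" using ch by (simp add: charged_def)
  have al: "alpha (side a) \<le> P" if "2 \<le> card (inc D a)" for a using ch that unfolding charged_def by blast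
  have etak: "eta \<le> kappa" using kap by (metis power2_eq_square mult_left_le)
  have weak: "\<bar>t D\<bar> \<le> kappa * P" if "\<bar>t D\<bar> \<le> eta * x" "x \<le> P" for x
  proof -
    have "eta * x \<le> eta * P" using that eta_nonneg by (intro mult_left_mono)
    also have "\<dots> \<le> kappa * P" using etak P0 by (rule mult_right_mono)
    finally show ?thesis using that by simp
  qed
  have aw: "{a, w} \<in> D" using w unfolding inc_def by blast
  note saw = bip_edge(2)[OF D aw]
  show ?thesis
  proof (cases "inc D a = {{a, w}}")
    case True
    then show ?thesis using t_isolated_edge[OF D w True] kap P0 by simp
  next
    case nA: False
    have alA: "alpha (side a) \<le> P" using al inc_card2(1)[OF D aw nA] by simp
    let ?D' = "D - {{a, w}}"
    have D': "bip ?D'" using D by (rule bip_subset) auto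
    have two: "\<bar>t D\<bar> \<le> kappa * P" if l: "inc D w' = {{a, w'}}" "w \<noteq> w'" for w'
    proof -
      obtain e where "e \<in> D" "a \<notin> e" using star by blast
      from two_leaves_bound[OF D w l this] show ?thesis using weak alA by blast
    qed
    show ?thesis
    proof (cases "\<exists>vs. cyc ?D' vs")
      case True
      then obtain vs where vs: "shortest_cyc ?D' vs" using shortest_cyc_exists by blast
      then have "vs \<noteq> []" by (auto simp: shortest_cyc_def cyc_def)
      obtain p ws where pw: "shortest_cyc ?D' (p # ws)" "a \<in> set (p # ws) \<Longrightarrow> p = a"
      proof (cases "a \<in> set vs")
        case True
        from shortest_cyc_rotate[OF vs this] that show ?thesis by metis
      next
        case False
        from \<open>vs \<noteq> []\<close> obtain p ws where "vs = p # ws" by (cases vs) auto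
        then show ?thesis using that[of p ws] vs False by simp
      qed
      obtain "is" q js where C: "p # ws = p # is @ q # rev js" "chordless_cycle ?D' p is q js"
        by (rule shortest_chordless[OF D' pw(1)])
      have "distinct (p # ws)" using pw(1) by (simp add: shortest_cyc_def cyc_def)
      then have a: "a \<notin> set is \<union> set js" using pw(2) C(1) by auto
      obtain e where e: "e \<in> D" "a \<notin> e" using star by blast
      have g: "path_sq s (replicate (length is) (\<lambda>_. 1)) \<le> P" for s
        by (rule charged_cycle[OF ch D _ C(2)]) auto
      have "(t D)\<^sup>2 \<le> alpha (side a) * (eta * P)"
        by (rule leaf_cycle_bound[OF D w e C(2) a g])
      also have "\<dots> \<le> P * (eta * P)"
        using alA eta_nonneg P0 by (intro mult_right_mono) auto
      finally show ?thesis using kap P0 by (intro abs_le_of_square) (auto simp: mult_ac)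
    next
      case noc: False
      obtain w2 where aw2: "{a, w2} \<in> D" "w2 \<noteq> w" using inc_card2(2)[OF D aw nA] by blast
      then have "?D' \<noteq> {}" using saw by (auto simp: doubleton_eq_iff)
      then obtain x x' b b' where x: "x \<noteq> x'" "inc ?D' x = {{b, x}}" "inc ?D' x' = {{b', x'}}"
        by (rule two_leaves_or_cycle[OF D' _ noc])
      obtain w' a' where w': "w' \<noteq> a" "inc ?D' w' = {{a', w'}}"
        using x by (cases "x = a") metis+
      have a'w': "{a', w'} \<in> D" "{a', w'} \<noteq> {a, w}" using w'(2) unfolding inc_def by blast+
      have noW: "w \<notin> e" if "e \<in> ?D'" for e using that w unfolding inc_def by blast
      have a'w'2: "{a', w'} \<in> ?D'" using a'w' by blast
      have ww': "w \<noteq> w'" "a' \<noteq> w" using noW[OF a'w'2] by auto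
      have l': "inc D w' = {{a', w'}}"
        using w' ww' unfolding inc_def by auto
      note s' = bip_edge(2)[OF D a'w'(1)]
      show ?thesis
      proof (cases "a = a'")
        case True
        then show ?thesis using two l' ww' by simp
      next
        case aa': False
        show ?thesis
        proof (cases "inc D a' = {{a', w'}}")
          case True
          then show ?thesis using t_isolated_edge[OF D l' True] kap P0 by simp
        next
          case nA': False
          have alA': "alpha (side a') \<le> P" using al inc_card2(1)[OF D a'w'(1) nA'] by simp
          let ?D2 = "D - {{a, w}, {a', w'}}"
          \<comment> \<open>If every remaining edge contains \<open>b\<close>, then \<open>c\<close> is adjacent to \<open>b\<close>, and any further edge at \<open>b\<close> ends in a second leaf at \<open>b\<close>.\<close>
          have star_in: "\<bar>t D\<bar> \<le> kappa * P"
            if ab: "inc D x = {{b, x}}" "inc D y = {{c, y}}" "b \<noteq> c" "x \<noteq> y" "b \<noteq> y" "c \<noteq> x" "b \<noteq> x" "c \<noteq> y"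
              and al: "alpha (side b) \<le> P" "alpha (side c) \<le> P"
              and nc: "inc D c \<noteq> {{c, y}}" "{c, y} \<in> D" "{b, x} \<in> D"
              and all: "\<And>e. e \<in> D - {{b, x}, {c, y}} \<Longrightarrow> b \<in> e" for b c x y
          proof -
            obtain z where z: "{c, z} \<in> D" "z \<noteq> y" using inc_card2(2)[OF D nc(2,1)] by blast
            have cz: "{c, z} \<in> D - {{b, x}, {c, y}}"
              using z ab by (auto simp: doubleton_eq_iff)
            have "b \<in> {c, z}" by (rule all[OF cz])
            then have zb: "z = b" using ab by auto
            show ?thesis
            proof (cases "D - {{b, x}, {c, y}} = {{b, c}}")
              case True
              have "(t D)\<^sup>2 \<le> eta * alpha (side b) * alpha (side c)"
                by (rule three_edge_path_bound[OF D ab(1,2) ab(4) ab(3) ab(5,6) True])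
              also have "\<dots> \<le> eta * P * P"
                using al alpha_nonneg eta_nonneg P0 by (intro mult_mono mult_nonneg_nonneg) auto
              finally show ?thesis using kap P0 by (intro abs_le_of_square) (auto simp: mult_ac)
            next
              case False
              have "{b, c} \<in> D - {{b, x}, {c, y}}" using cz zb by (simp add: insert_commute)
              then obtain e where e: "e \<in> D - {{b, x}, {c, y}}" "e \<noteq> {b, c}" using False by blast
              then have "e \<in> D" "b \<in> e" using all by blast+
              then obtain u where u: "e = {b, u}" by (rule bip_edgeE[OF D])
              have uD: "{b, u} \<in> D" "u \<noteq> x" "u \<noteq> c" using e u \<open>e \<in> D\<close> by auto
              have uy: "u \<noteq> y"
              proof
                assume "u = y"
                then have "{b, y} \<in> inc D y" using uD by (simp add: inc_def)
                then show False using ab by (auto simp: doubleton_eq_iff)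
              qed
              note sb = bip_edge(2)[OF D uD(1)]
              have leafu: "inc D u = {{b, u}}"
              proof -
                have "f = {b, u}" if f: "f \<in> D" "u \<in> f" for f
                proof -
                  have "f \<in> D - {{b, x}, {c, y}}" using f uD uy sb by auto
                  then have "b \<in> f" by (rule all)
                  obtain v where v: "f = {u, v}" by (rule bip_edgeE[OF D f])
                  then show ?thesis using \<open>b \<in> f\<close> sb by auto
                qed
                then have "inc D u \<subseteq> {{b, u}}" unfolding inc_def by blast
                moreover have "{b, u} \<in> inc D u" using uD(1) by (simp add: inc_def)
                ultimately show ?thesis by blast
              qed
              obtain e' where e': "e' \<in> D" "b \<notin> e'" using star by blast
              have "\<bar>t D\<bar> \<le> eta * alpha (side b)"
                by (rule two_leaves_bound[OF D ab(1) leafu uD(2)[symmetric] e'])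
              then show ?thesis by (rule weak[OF _ al(1)])
            qed
          qed
          show ?thesis
          proof (cases "\<exists>e\<in>?D2. a \<notin> e")
            case False
            then show ?thesis
              using star_in[OF w l' aa' ww'(1) _ ww'(2) saw s' alA alA' nA' a'w'(1) aw] w' by blast
          next
            case e1: True
            show ?thesis
            proof (cases "\<exists>e\<in>?D2. a' \<notin> e")
              case False
              then show ?thesis
                using star_in[OF l' w aa'[symmetric] ww'(1)[symmetric] ww'(2) _ s' saw alA' alA nA aw a'w'(1)] w'
                by (simp add: insert_commute)
            next
              case True
              with e1 obtain e e' where e: "e \<in> ?D2" "a \<notin> e" "e' \<in> ?D2" "a' \<notin> e'" by blast
              have "\<bar>t D\<bar> \<le> eta * (alpha (side a) + alpha (side a')) / 2"
                by (rule separate_leaves_bound[OF D w l' ww'(1) aa' _ ww'(2) e]) (use w' in auto)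
              then show ?thesis using weak[of "(alpha (side a) + alpha (side a')) / 2"] alA alA' by simp
            qed
          qed
        qed
      qed
    qed
  qed
qed

text \<open>Some edge is not on the shortest cycle. Either no vertex off the cycle is adjacent to it, and this
  edge is far from the cycle. Or some vertex \<open>u\<close> off the cycle is adjacent to a vertex \<open>c\<close> of it. Then
  \<open>u\<close> has another neighbour \<open>v\<close>, which is also off the cycle, and by minimality the edge \<open>uv\<close> can see
  only \<open>c\<close> and the antipode of \<open>c\<close>.\<close>

lemma long_cycle_case:
  assumes D: "bip D" and ch: "charged D P" and s: "shortest_cyc D vs" "6 \<le> length vs"
    and deg: "\<And>v w. inc D w \<noteq> {{v, w}}"
    and kap: "0 \<le> kappa" "kappa \<le> 1" "kappa\<^sup>2 = eta"
    and ncyc: "path_edges (vs @ [hd vs]) \<noteq> D"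
  shows "\<bar>t D\<bar> \<le> kappa * P"
proof -
  have P0: "0 \<le> P" using ch by (simp add: charged_def)
  have etak: "eta \<le> kappa" using kap by (metis power2_eq_square mult_left_le)
  have fin: "\<bar>t D\<bar> \<le> kappa * P"
    if "chordless_cycle D p is q js" "{u, v} \<in> D" "u \<notin> set (p # q # is @ js)" "v \<notin> set (p # q # is @ js)"
      "\<And>e. e \<in> D \<Longrightarrow> u \<in> e \<or> v \<in> e \<Longrightarrow> e \<inter> (set is \<union> set js) = {}" for p "is" q js u v
  proof -
    have g: "path_sq s (replicate (length is) (\<lambda>_. 1)) \<le> P" for s
      by (rule charged_cycle[OF ch D _ that(1)]) auto
    have "\<bar>t D\<bar> \<le> eta * P" by (rule far_edge_bound[OF D that g])
    also have "\<dots> \<le> kappa * P" using etak P0 by (rule mult_right_mono)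
    finally show ?thesis .
  qed
  have c: "cyc D vs" using s by (simp add: shortest_cyc_def)
  then have "path_edges (vs @ [hd vs]) \<subseteq> D" by (simp add: cyc_def)
  then obtain e where e: "e \<in> D" "e \<notin> path_edges (vs @ [hd vs])" using ncyc by blast
  obtain x y where xy: "e = {x, y}" "side x" "\<not> side y" using D e(1) unfolding bip_def by blast
  have out: "x \<notin> set vs \<or> y \<notin> set vs"
    using chord_impossible[OF s(1), of x y] e xy by auto
  show ?thesis
  proof (cases "\<exists>u c. u \<notin> set vs \<and> c \<in> set vs \<and> {u, c} \<in> D")
    case True
    then obtain u c where uc: "u \<notin> set vs" "c \<in> set vs" "{u, c} \<in> D" by blast
    obtain v where v: "{u, v} \<in> D" "v \<noteq> c"
    proof -
      have "inc D u \<noteq> {{u, c}}" using deg[of u c] by (simp add: insert_commute)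
      then show ?thesis using inc_card2(2)[OF D uc(3)] that by blast
    qed
    have vout: "v \<notin> set vs" using outside_nbr_unique[OF s uc(1,2) _ uc(3) v(1)] v(2) by auto
    obtain ws where w: "shortest_cyc D (c # ws)" "set (c # ws) = set vs" "length (c # ws) = length vs"
      by (rule shortest_cyc_rotate[OF s(1) uc(2)])
    obtain "is" q js where C: "c # ws = c # is @ q # rev js" "chordless_cycle D c is q js"
      by (rule shortest_chordless[OF D w(1)])
    have len: "length is = length js" using C(2) by (simp add: chordless_cycle_def)
    have setC: "set (c # q # is @ js) = set vs" using w(2) C(1) by auto
    have dist: "distinct (c # q # is @ js)" using C(2) by (simp add: chordless_cycle_def)
    note sd = bip_edge[OF D uc(3)] bip_edge[OF D v(1)]
    have vq: "y = q" if y: "{v, y} \<in> D" "y \<in> set vs" for y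
    proof -
      have "y \<noteq> c" using bip_edge(1)[OF D y(1)] sd by auto
      then have "y \<in> set (is @ q # rev js)" using y(2) w(2) C(1) by auto
      then obtain as bs where ab: "is @ q # rev js = as @ y # bs" by (meson split_list)
      have "length as = length bs"
        by (rule outside_edge_opposite[of D c as y bs u v])
           (use w s(2) uc vout v y sd C(1) ab in \<open>auto simp: insert_commute\<close>)
      then have "length as = length is" using arg_cong[OF ab, of length] len by simp
      then show ?thesis using ab by (simp add: append_eq_append_conv)
    qed
    show ?thesis
    proof (rule fin[OF C(2) v(1)])
      show "u \<notin> set (c # q # is @ js)" "v \<notin> set (c # q # is @ js)" using uc vout setC by simp_all
      fix f assume f: "f \<in> D" "u \<in> f \<or> v \<in> f"
      show "f \<inter> (set is \<union> set js) = {}"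
      proof (cases "u \<in> f")
        case True
        obtain z where z: "f = {u, z}" by (rule bip_edgeE[OF D f(1) True])
        have "z = c" if "z \<in> set vs"
          using outside_nbr_unique[OF s uc(1) that uc(2)] uc(3) f(1) z by simp
        then show ?thesis using z uc setC dist by auto
      next
        case False
        then have "v \<in> f" using f by simp
        obtain z where z: "f = {v, z}" by (rule bip_edgeE[OF D f(1) \<open>v \<in> f\<close>])
        have "z = q" if "z \<in> set vs" using vq that f(1) z by simp
        then show ?thesis using z vout setC dist by auto
      qed
    qed
  next
    case False
    have xo: "x \<notin> set vs" "y \<notin> set vs" using False out e(1) xy(1) by (auto simp: insert_commute)
    obtain p ws where vs: "vs = p # ws" using c by (cases vs) (auto simp: cyc_def)
    obtain "is" q js where C: "p # ws = p # is @ q # rev js" "chordless_cycle D p is q js"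
      by (rule shortest_chordless[OF D s(1)[unfolded vs]])
    have setC: "set (p # q # is @ js) = set vs" using C(1) vs by auto
    show ?thesis
    proof (rule fin[OF C(2)])
      show "{x, y} \<in> D" "x \<notin> set (p # q # is @ js)" "y \<notin> set (p # q # is @ js)"
        using e xy xo setC by auto
      fix f assume f: "f \<in> D" "x \<in> f \<or> y \<in> f"
      then obtain u where u: "u \<in> f" "u \<notin> set vs" using xo by auto
      obtain z where z: "f = {u, z}" by (rule bip_edgeE[OF D f(1) u(1)])
      have "z \<notin> set vs" using False u z f(1) by auto
      then show "f \<inter> (set is \<union> set js) = {}" using z u setC by auto
    qed
  qed
qed

end

lemma path_edges_first: "e \<in> path_edges (p # x # xs) \<Longrightarrow> p \<notin> set (x # xs) \<Longrightarrow> p \<in> e \<Longrightarrow> e = {p, x}"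
  using path_edges_subset[of e "x # xs"] by auto

context bip_kernel
begin

lemma mem_biclique: "e \<in> biclique A B \<longleftrightarrow> (\<exists>a\<in>A. \<exists>b\<in>B. e = {a, b})"
  by (auto simp: biclique_def)

lemma bicliqueD: "biclique A B \<subseteq> D \<Longrightarrow> a \<in> A \<Longrightarrow> b \<in> B \<Longrightarrow> {a, b} \<in> D"
  by (auto simp: biclique_def)
lemma bicliqueI: "(\<And>a b. a \<in> A \<Longrightarrow> b \<in> B \<Longrightarrow> {a, b} \<in> D) \<Longrightarrow> biclique A B \<subseteq> D"
  by (auto simp: biclique_def)
lemma mem_bicliqueI: "a \<in> A \<Longrightarrow> b \<in> B \<Longrightarrow> {a, b} \<in> biclique A B"
  by (auto simp: biclique_def)

lemma biclique_commute: "biclique A B = biclique B A"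
proof -
  have "biclique S T \<subseteq> biclique T S" for S T :: "'v set"
  proof
    fix e assume "e \<in> biclique S T"
    then obtain a b where "a \<in> S" "b \<in> T" "e = {b, a}" unfolding mem_biclique by (metis insert_commute)
    then show "e \<in> biclique T S" unfolding mem_biclique by blast
  qed
  then show ?thesis by (intro equalityI)
qed

lemma four_cycle_chordless:
  assumes "a0 \<noteq> a1" "b0 \<noteq> b1" "side a0 = s" "side a1 = s" "side b0 = (\<not> s)" "side b1 = (\<not> s)"
  shows "chordless_cycle (biclique {a0, a1} {b0, b1}) a0 [b0] a1 [b1]"
    and "path_edges (a0 # [b0] @ [a1]) \<union> path_edges (a0 # [b1] @ [a1]) = biclique {a0, a1} {b0, b1}"
proof -
  show 1: "path_edges (a0 # [b0] @ [a1]) \<union> path_edges (a0 # [b1] @ [a1]) = biclique {a0, a1} {b0, b1}"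
    unfolding biclique_def by (auto simp: insert_commute)
  show "chordless_cycle (biclique {a0, a1} {b0, b1}) a0 [b0] a1 [b1]"
    unfolding chordless_cycle_def 1 using assms by auto
qed

text \<open>Take a largest biclique \<open>A \<times> B\<close> with at least two vertices on each side. A vertex outside it that is
  adjacent to some vertex of the biclique on the other side is not adjacent to all of them, which is the
  situation of \<open>four_cycle_bound\<close>. If there is no such vertex, an edge that does not belong to the
  biclique is not adjacent to it at all.\<close>

lemma short_cycle_case:
  assumes D: "bip D" and ch: "charged D P" and s: "cyc D vs" "length vs = 4"
    and deg: "\<And>v w. inc D w \<noteq> {{v, w}}"
    and kap: "0 \<le> kappa" "kappa \<le> 1" "kappa\<^sup>2 = eta"
    and nbic: "\<And>A B. (\<forall>a\<in>A. side a) \<Longrightarrow> (\<forall>b\<in>B. \<not> side b) \<Longrightarrow> 2 \<le> card A \<Longrightarrow> 2 \<le> card B \<Longrightarrow> D \<noteq> biclique A B"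
  shows "\<bar>t D\<bar> \<le> kappa * P"
proof -
  have P0: "0 \<le> P" using ch by (simp add: charged_def)
  have etak: "eta \<le> kappa" using kap by (metis power2_eq_square mult_left_le)
  define Q where "Q X \<longleftrightarrow> (\<forall>a\<in>fst X. side a) \<and> (\<forall>b\<in>snd X. \<not> side b) \<and> 2 \<le> card (fst X) \<and> 2 \<le> card (snd X) \<and> biclique (fst X) (snd X) \<subseteq> D"
    for X :: "'v set \<times> 'v set"
  obtain x0 x1 x2 x3 where vs: "vs = [x0, x1, x2, x3]"
    using s(2) by (auto simp: numeral_eq_Suc length_Suc_conv)
  have E: "{x0, x1} \<in> D" "{x1, x2} \<in> D" "{x2, x3} \<in> D" "{x3, x0} \<in> D" and dist: "distinct [x0, x1, x2, x3]"
    using s(1) vs unfolding cyc_def by auto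
  have E': "{x1, x0} \<in> D" "{x2, x1} \<in> D" "{x3, x2} \<in> D" "{x0, x3} \<in> D"
    using E by (simp_all add: insert_commute)
  note sds = bip_edge(1)[OF D E(1)] bip_edge(1)[OF D E(2)] bip_edge(1)[OF D E(3)] bip_edge(1)[OF D E(4)]
  have "\<exists>X. Q X"
  proof (cases "side x0")
    case True
    have "Q ({x0, x2}, {x1, x3})"
      using E E' dist sds True by (auto simp: Q_def intro!: bicliqueI)
    then show ?thesis by blast
  next
    case False
    have "Q ({x1, x3}, {x0, x2})"
      using E E' dist sds False by (auto simp: Q_def intro!: bicliqueI)
    then show ?thesis by blast
  qed
  then obtain X0 where X0: "Q X0" by blast
  define sz where "sz X = card (fst X) + card (snd X)" for X :: "'v set \<times> 'v set"
  have finX: "finite (\<Union>D)" by (rule bip_finite_Un[OF D])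
  have "sz X < Suc (card (\<Union>D) + card (\<Union>D))" if X: "Q X" for X
  proof -
    have bic: "{a, b} \<in> D" if "a \<in> fst X" "b \<in> snd X" for a b
      using bicliqueD[OF _ that] X unfolding Q_def by blast
    have "fst X \<noteq> {}" "snd X \<noteq> {}" using X by (auto simp: Q_def)
    then have "fst X \<subseteq> \<Union>D" "snd X \<subseteq> \<Union>D" using bic by blast+
    then have "card (fst X) \<le> card (\<Union>D)" "card (snd X) \<le> card (\<Union>D)" by (simp_all add: card_mono[OF finX])
    then show ?thesis by (simp add: sz_def)
  qed
  then obtain X where X: "Q X" and max: "\<And>Y. Q Y \<Longrightarrow> sz Y \<le> sz X"
    using ex_has_greatest_nat[of Q X0 sz, OF X0] by blast
  obtain A B where AB: "X = (A, B)" by (cases X)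
  have sA: "side a" if "a \<in> A" for a using X AB that by (simp add: Q_def)
  have sB: "\<not> side b" if "b \<in> B" for b using X AB that by (simp add: Q_def)
  have cA: "2 \<le> card A" and cB: "2 \<le> card B" using X AB by (auto simp: Q_def)
  then have fAB: "finite A" "finite B" by (auto intro: card_ge_0_finite)
  have bic: "{a, b} \<in> D" if "a \<in> A" "b \<in> B" for a b
    using bicliqueD[OF _ that] X unfolding Q_def AB by simp
  have two: "\<exists>x\<in>S. x \<noteq> y" if "2 \<le> card S" for S :: "'v set" and y
  proof (rule ccontr)
    assume "\<not> (\<exists>x\<in>S. x \<noteq> y)"
    then have "S \<subseteq> {y}" by blast
    then have "card S \<le> 1" using card_mono[of "{y}" S] by simp
    then show False using that by simp
  qed
  have step: "\<bar>t D\<bar> \<le> kappa * P"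
    if ST: "\<And>x y. x \<in> S \<Longrightarrow> y \<in> T \<Longrightarrow> {x, y} \<in> D" "2 \<le> card S"
      and u: "u \<notin> S" "b1 \<in> T" "b0 \<in> T" "{u, b1} \<in> D" "{u, b0} \<notin> D" for S T u b0 b1
  proof -
    obtain a0 where a0: "a0 \<in> S" using two[OF ST(2)] by blast
    obtain a1 where a1: "a1 \<in> S" "a1 \<noteq> a0" using two[OF ST(2)] by blast
    have E4: "{a0, b0} \<in> D" "{a1, b0} \<in> D" "{a0, b1} \<in> D" "{a1, b1} \<in> D" using ST(1) a0 a1 u by auto
    have "inc D u \<noteq> {{u, b1}}" using deg[of u b1] by (simp add: insert_commute)
    then obtain b2 where b2: "{u, b2} \<in> D" "b2 \<noteq> b1" using inc_card2(2)[OF D u(4)] by blast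
    have b01: "b0 \<noteq> b1" using u by auto
    have sd: "side a0 = side a0" "side a1 = side a0" "side b0 = (\<not> side a0)" "side b1 = (\<not> side a0)"
      using bip_edge(1)[OF D E4(1)] bip_edge(1)[OF D E4(2)] bip_edge(1)[OF D E4(3)] by auto
    have sub: "biclique {a0, a1} {b0, b1} \<subseteq> D" using E4 by (intro bicliqueI) auto
    have "path_sq s (replicate (length [b0]) (\<lambda>_. 1)) \<le> P" for s
      by (rule charged_cycle[OF ch D sub four_cycle_chordless(1)[OF a1(2)[symmetric] b01 sd]])
    then have "(t D)\<^sup>2 \<le> eta * (P * P)"
      by (intro four_cycle_bound[OF D E4 a1(2)[symmetric] b01 _ _ u(4,5) b2]) (use u(1) a0 a1 in auto)
    then show ?thesis using kap P0 by (intro abs_le_of_square) auto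
  qed
  show ?thesis
  proof (cases "\<exists>u b. u \<notin> A \<and> b \<in> B \<and> {u, b} \<in> D")
    case True
    then obtain u b where u: "u \<notin> A" "b \<in> B" "{u, b} \<in> D" by blast
    have su: "side u" using bip_edge(1)[OF D u(3)] sB[OF u(2)] by simp
    have "\<exists>b0\<in>B. {u, b0} \<notin> D"
    proof (rule ccontr)
      assume "\<not> (\<exists>b0\<in>B. {u, b0} \<notin> D)"
      then have "Q (insert u A, B)"
        using sA sB su cA cB fAB u bic by (auto simp: Q_def intro!: bicliqueI)
      from max[OF this] show False using u fAB by (simp add: sz_def AB)
    qed
    then obtain b0 where "b0 \<in> B" "{u, b0} \<notin> D" by blast
    then show ?thesis using step[of A B u b b0] bic cA u by blast
  next
    case noA: False
    show ?thesis
    proof (cases "\<exists>v a. v \<notin> B \<and> a \<in> A \<and> {v, a} \<in> D")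
      case True
      then obtain v a where v: "v \<notin> B" "a \<in> A" "{v, a} \<in> D" by blast
      have sv: "\<not> side v" using bip_edge(1)[OF D v(3)] sA[OF v(2)] by simp
      have "\<exists>a0\<in>A. {a0, v} \<notin> D"
      proof (rule ccontr)
        assume "\<not> (\<exists>a0\<in>A. {a0, v} \<notin> D)"
        then have "Q (A, insert v B)"
          using sA sB sv cA cB fAB v bic by (auto simp: Q_def intro!: bicliqueI)
        from max[OF this] show False using v fAB by (simp add: sz_def AB)
      qed
      then obtain a0 where a0: "a0 \<in> A" "{v, a0} \<notin> D" by (auto simp: insert_commute)
      have "{x, y} \<in> D" if "x \<in> B" "y \<in> A" for x y using bic[OF that(2,1)] by (simp add: insert_commute)
      from step[OF this cB v(1,2) a0(1) v(3) a0(2)] show ?thesis by blast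
    next
      case noB: False
      have "D \<noteq> biclique A B" using nbic[of A B] sA sB cA cB by blast
      moreover have "biclique A B \<subseteq> D" using X AB by (simp add: Q_def)
      ultimately obtain e where e: "e \<in> D" "e \<notin> biclique A B" by blast
      obtain u v where uv: "e = {u, v}" "side u" "\<not> side v" using D e(1) unfolding bip_def by blast
      have out: "u \<notin> A" "v \<notin> B"
      proof -
        have 1: "u \<in> A \<and> v \<in> B \<Longrightarrow> False" using e(2) mem_bicliqueI[of u A v B] uv(1) by blast
        have 2: "u \<notin> A \<Longrightarrow> v \<notin> B" using noA e(1) uv(1) by blast
        have 3: "{v, u} \<in> D" using e(1) uv(1) by (simp add: insert_commute)
        then have "v \<notin> B \<Longrightarrow> u \<notin> A" using noB by blast
        then show "u \<notin> A" "v \<notin> B" using 1 2 by blast+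
      qed
      obtain a0 where a0: "a0 \<in> A" using two[OF cA] by blast
      obtain a1 where a1: "a1 \<in> A" "a1 \<noteq> a0" using two[OF cA] by blast
      obtain b0 where b0: "b0 \<in> B" using two[OF cB] by blast
      obtain b1 where b1: "b1 \<in> B" "b1 \<noteq> b0" using two[OF cB] by blast
      have sd: "side a0 = True" "side a1 = True" "side b0 = (\<not> True)" "side b1 = (\<not> True)"
        using sA sB a0 a1 b0 b1 by auto
      note C4 = four_cycle_chordless[OF a1(2)[symmetric] b1(2)[symmetric] sd]
      have sub: "biclique {a0, a1} {b0, b1} \<subseteq> D" using bic a0 a1 b0 b1 by (intro bicliqueI) auto
      have C: "chordless_cycle D a0 [b0] a1 [b1]"
        unfolding chordless_cycle_def C4(2)
      proof (intro conjI ballI impI sub)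
        fix f assume f: "f \<in> D" "f \<subseteq> set (a0 # a1 # [b0] @ [b1])"
        obtain x y where xy: "f = {x, y}" "side x" "\<not> side y" using D f(1) unfolding bip_def by blast
        then have "x \<in> {a0, a1}" "y \<in> {b0, b1}" using f(2) sd by auto
        then show "f \<in> biclique {a0, a1} {b0, b1}" unfolding xy(1) by (rule mem_bicliqueI)
      qed (use C4(1) in \<open>auto simp: chordless_cycle_def\<close>)
      have g: "path_sq s (replicate (length [b0]) (\<lambda>_. 1)) \<le> P" for s
        by (rule charged_cycle[OF ch D _ C]) auto
      have out2: "u \<notin> B" "v \<notin> A" using uv sA sB by auto
      have "\<bar>t D\<bar> \<le> eta * P"
      proof (rule far_edge_bound[OF D C _ _ _ _ g])
        show "{u, v} \<in> D" using e uv by simp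
        show "u \<notin> set (a0 # a1 # [b0] @ [b1])" "v \<notin> set (a0 # a1 # [b0] @ [b1])"
          using out out2 a0 a1 b0 b1 by auto
        fix f assume f: "f \<in> D" "u \<in> f \<or> v \<in> f"
        show "f \<inter> (set [b0] \<union> set [b1]) = {}"
        proof (cases "u \<in> f")
          case True
          obtain z where z: "f = {u, z}" by (rule bip_edgeE[OF D f(1) True])
          then have "z \<notin> B" using noA out(1) f(1) by blast
          then show ?thesis using z out2 b0 b1 by auto
        next
          case False
          then have vf: "v \<in> f" using f by simp
          obtain z where z: "f = {v, z}" "side v \<noteq> side z" by (rule bip_edgeE[OF D f(1) vf])
          then have "z \<notin> B" using sB uv by auto
          then show ?thesis using z out b0 b1 by auto
        qed
      qed
      also have "\<dots> \<le> kappa * P" using etak P0 by (rule mult_right_mono)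
      finally show ?thesis .
    qed
  qed
qed

text \<open>Cycles of length at least six. Four-cycles are bicliques and are counted as such.\<close>

definition long_cycle :: "'v set set \<Rightarrow> bool" where
  "long_cycle D \<longleftrightarrow> (\<exists>p is q js. chordless_cycle D p is q js \<and> 2 \<le> length is \<and>
     D = path_edges (p # is @ [q]) \<union> path_edges (p # js @ [q]))"

text \<open>Without a leaf there is a cycle by \<open>two_leaves_or_cycle\<close>, and the length of a shortest one is even, so it
  is four or at least six.\<close>

theorem charged_bound:
  assumes D: "bip D" "D \<noteq> {}" and ch: "charged D P"
    and kap: "0 \<le> kappa" "kappa \<le> 1" "kappa\<^sup>2 = eta"
    and star: "\<And>a. \<exists>e\<in>D. a \<notin> e"
    and nbic: "\<And>A B. (\<forall>a\<in>A. side a) \<Longrightarrow> (\<forall>b\<in>B. \<not> side b) \<Longrightarrow> 2 \<le> card A \<Longrightarrow> 2 \<le> card B \<Longrightarrow> D \<noteq> biclique A B"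
    and ncyc: "\<not> long_cycle D"
  shows "\<bar>t D\<bar> \<le> kappa * P"
proof (cases "\<exists>v w. inc D w = {{v, w}}")
  case True
  then obtain v w where "inc D w = {{v, w}}" by blast
  from leaf_case[OF D(1) ch this kap star] show ?thesis .
next
  case False
  then have deg: "\<And>v w. inc D w \<noteq> {{v, w}}" by blast
  have "\<exists>vs. cyc D vs"
  proof (rule ccontr)
    assume no: "\<not> (\<exists>vs. cyc D vs)"
    show False by (rule two_leaves_or_cycle[OF D no]) (use deg in blast)
  qed
  then obtain vs where vs: "shortest_cyc D vs" using shortest_cyc_exists by blast
  then have c: "cyc D vs" by (simp add: shortest_cyc_def)
  have "even (length vs)" "3 \<le> length vs" using cyc_even[OF D(1) c] c by (auto simp: cyc_def)
  then have "length vs = 4 \<or> 6 \<le> length vs" by presburger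
  then consider "length vs = 4" | "6 \<le> length vs" by blast
  then show ?thesis
  proof cases
    case 1
    from short_cycle_case[OF D(1) ch c this deg kap nbic] show ?thesis .
  next
    case 2
    obtain p ws where pw: "vs = p # ws" using c by (cases vs) (auto simp: cyc_def)
    obtain "is" q js where C: "p # ws = p # is @ q # rev js" "chordless_cycle D p is q js"
      "path_edges (p # ws @ [p]) = path_edges (p # is @ [q]) \<union> path_edges (p # js @ [q])"
      by (rule shortest_chordless[OF D(1) vs[unfolded pw]])
    have "length is = length js" using C(2) by (simp add: chordless_cycle_def)
    then have "2 \<le> length is" using arg_cong[OF C(1), of length] 2 pw by simp
    then have "path_edges (vs @ [hd vs]) \<noteq> D" using ncyc C pw unfolding long_cycle_def by auto
    from long_cycle_case[OF D(1) ch vs 2 deg kap this] show ?thesis .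
  qed
qed

end

section \<open>Stars and bicliques\<close>

lemma sum_power_card_Pow:
  assumes "finite N" shows "(\<Sum>B\<in>Pow N. (x::real) ^ card B) = (1 + x) ^ card N"
  using prod_add[OF assms, of "\<lambda>_. x" "\<lambda>_. 1"] by (simp add: add.commute)

lemma sum_power_card_ge2:
  assumes "finite N"
  shows "(\<Sum>B\<in>{B. B \<subseteq> N \<and> 2 \<le> card B}. (x::real) ^ card B) = (1 + x) ^ card N - 1 - real (card N) * x"
proof -
  have P: "Pow N = insert {} ((\<lambda>b. {b}) ` N \<union> {B. B \<subseteq> N \<and> 2 \<le> card B})"
  proof (intro equalityI subsetI)
    fix B assume B: "B \<in> Pow N"
    show "B \<in> insert {} ((\<lambda>b. {b}) ` N \<union> {B. B \<subseteq> N \<and> 2 \<le> card B})"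
    proof (cases "2 \<le> card B")
      case False
      then have "card B = 0 \<or> card B = 1" by linarith
      moreover have "finite B" using B assms by (auto intro: finite_subset)
      ultimately show ?thesis using B by (auto simp: card_1_singleton_iff)
    qed (use B in auto)
  qed auto
  have "(\<Sum>B\<in>Pow N. x ^ card B) = 1 + ((\<Sum>B\<in>(\<lambda>b. {b}) ` N. x ^ card B) + (\<Sum>B\<in>{B. B \<subseteq> N \<and> 2 \<le> card B}. x ^ card B))"
    unfolding P using assms
    by (subst sum.insert, (auto)[2]) (subst sum.union_disjoint, auto)
  also have "(\<Sum>B\<in>(\<lambda>b. {b}) ` N. x ^ card B) = real (card N) * x"
    by (subst sum.reindex) (auto simp: inj_on_def)
  finally show ?thesis using sum_power_card_Pow[OF assms, of x] by simp
qed

text \<open>Bernoulli's inequality with a quadratic gain, for exponents that are at least two. The induction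
  multiplies by \<open>1 + x\<close>.\<close>

lemma Bernoulli_square:
  assumes "-1 \<le> (x::real)" shows "x\<^sup>2 \<le> (1 + x) ^ (c + 2) - 1 - real (c + 2) * x"
proof (induction c)
  case (Suc c)
  have "x\<^sup>2 * (1 + x) \<le> ((1 + x) ^ (c + 2) - 1 - real (c + 2) * x) * (1 + x)"
    using Suc assms by (intro mult_right_mono) auto
  moreover have "x\<^sup>2 + x\<^sup>2 * (1 + x) \<ge> x\<^sup>2 * (1 + x)" by simp
  moreover have "(1 + x) ^ (Suc c + 2) - 1 - real (Suc c + 2) * x
     = ((1 + x) ^ (c + 2) - 1 - real (c + 2) * x) * (1 + x) + real (c + 2) * x\<^sup>2"
    by (simp add: algebra_simps power2_eq_square)
  moreover have "x\<^sup>2 \<le> x\<^sup>2 * (1 + x) + real (c + 2) * x\<^sup>2"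
  proof -
    have "0 \<le> x\<^sup>2 * (1 + x)" using assms by simp
    moreover have "1 * x\<^sup>2 \<le> real (c + 2) * x\<^sup>2" by (intro mult_right_mono) auto
    ultimately show ?thesis by simp
  qed
  ultimately show ?case by linarith
qed (simp add: power2_eq_square algebra_simps)

context bip_kernel
begin

text \<open>The normalised common degree of the vertices in \<open>A\<close>, with signs.\<close>

definition common :: "bool \<Rightarrow> 'v set \<Rightarrow> ('v \<Rightarrow> nat) \<Rightarrow> real" where
  "common s A z = avg n (\<lambda>y. \<Prod>a\<in>A. M s (z a) y)"

lemma common_bound: "\<bar>common s A z\<bar> \<le> 1"
  unfolding common_def by (rule avg_bound) (simp add: abs_prod M_bound prod_le_1)

text \<open>With all other coordinates fixed, those in \<open>B\<close> are independent and identically distributed.\<close>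

lemma Av_power:
  assumes "finite B" "\<And>y. indep (H y) B"
  shows "Av n B (\<lambda>z. \<Prod>b\<in>B. H (z b) z) z = (avg n (\<lambda>y. H y z)) ^ card B"
  using assms
proof (induction B arbitrary: z rule: finite_induct)
  case (insert b B)
  have iB: "indep (H y) B" for y by (rule indep_mono[OF insert.prems]) auto
  have ib: "H y (z(b := x)) = H y z" for x y z using insert.prems[of y] by (simp add: indep_def)
  have i: "indep (\<lambda>z. H (z b) z) B"
    unfolding indep_def
  proof (intro allI ballI)
    fix z v x assume "v \<in> B"
    then have "v \<noteq> b" using insert.hyps by auto
    then show "H ((z(v := x)) b) (z(v := x)) = H (z b) z" using iB \<open>v \<in> B\<close> by (simp add: indep_def)
  qed
  have "Av n (insert b B) (\<lambda>z. \<Prod>b\<in>insert b B. H (z b) z) z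
     = avg n (\<lambda>x. Av n B (\<lambda>z. H (z b) z * (\<Prod>b\<in>B. H (z b) z)) (z(b := x)))"
    using insert.hyps by (simp add: Av_insert)
  also have "\<dots> = avg n (\<lambda>x. H x (z(b := x)) * Av n B (\<lambda>z. \<Prod>b\<in>B. H (z b) z) (z(b := x)))"
    using i insert.hyps by (simp add: Av_mult_indep)
  also have "\<dots> = avg n (\<lambda>x. H x z * (avg n (\<lambda>y. H y z)) ^ card B)"
    by (simp del: fun_upd_apply add: insert.IH[OF iB] ib)
  finally show ?case using insert.hyps by (simp add: avg_multc)
qed simp

lemma bip_biclique:
  assumes "finite A" "finite B" "\<And>a. a \<in> A \<Longrightarrow> side a = s" "\<And>b. b \<in> B \<Longrightarrow> side b = (\<not> s)"
  shows "bip (biclique A B)"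
  unfolding bip_def
proof (intro conjI ballI)
  show "finite (biclique A B)" using assms by (simp add: biclique_def)
  fix e assume "e \<in> biclique A B"
  then obtain a b where e: "a \<in> A" "b \<in> B" "e = {a, b}" unfolding mem_biclique by blast
  show "\<exists>u v. e = {u, v} \<and> side u \<and> \<not> side v"
  proof (cases s)
    case True then show ?thesis using e assms(3,4) by blast
  next
    case False
    then have "side b" "\<not> side a" using e assms(3)[of a] assms(4)[of b] by auto
    then show ?thesis using e(3) by (metis insert_commute)
  qed
qed

lemma t_biclique:
  assumes fin: "finite A" "finite B" and sides: "\<And>a. a \<in> A \<Longrightarrow> side a = s" "\<And>b. b \<in> B \<Longrightarrow> side b = (\<not> s)"
  shows "t (biclique A B) = Av n A (\<lambda>z. common s A z ^ card B) (\<lambda>_. 0)"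
proof -
  have disj: "A \<inter> B = {}" using sides by auto
  have inj: "inj_on (\<lambda>(a, b). {a, b}) (A \<times> B)"
  proof (rule inj_onI, clarify)
    fix a b a' b' assume *: "a \<in> A" "b \<in> B" "a' \<in> A" "b' \<in> B" "{a, b} = {a', b'}"
    then show "a = a' \<and> b = b'" using disj by (auto simp: doubleton_eq_iff)
  qed
  have p: "edge_prod (biclique A B) z = (\<Prod>b\<in>B. \<Prod>a\<in>A. M s (z a) (z b))" for z
  proof -
    have "edge_prod (biclique A B) z = (\<Prod>(a,b)\<in>A \<times> B. fac {a, b} z)"
      unfolding edge_prod_def biclique_def using inj by (subst prod.reindex) (auto simp: case_prod_unfold)
    also have "\<dots> = (\<Prod>a\<in>A. \<Prod>b\<in>B. fac {a, b} z)" by (simp add: prod.cartesian_product)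
    also have "\<dots> = (\<Prod>a\<in>A. \<Prod>b\<in>B. M s (z a) (z b))"
      using sides by (intro prod.cong refl) (simp add: fac_eq)
    finally show ?thesis by (subst prod.swap)
  qed
  have "\<Union>(biclique A B) \<subseteq> A \<union> B" by (auto simp: biclique_def)
  then have "t (biclique A B) = Av n (A \<union> B) (edge_prod (biclique A B)) (\<lambda>_. 0)"
    using t_eq[OF bip_biclique[OF fin sides]] fin by (metis finite_Un)
  also have "\<dots> = Av n A (Av n B (edge_prod (biclique A B))) (\<lambda>_. 0)"
    using fin disj by (simp add: Av_Un)
  also have "Av n B (edge_prod (biclique A B)) = (\<lambda>z. common s A z ^ card B)"
  proof
    fix z
    have "Av n B (\<lambda>z. \<Prod>b\<in>B. (\<lambda>y z. \<Prod>a\<in>A. M s (z a) y) (z b) z) z = (avg n (\<lambda>y. \<Prod>a\<in>A. M s (z a) y)) ^ card B"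
      by (rule Av_power[OF fin(2)]) (use disj in \<open>auto simp: indep_def intro!: prod.cong\<close>)
    then show "Av n B (edge_prod (biclique A B)) z = common s A z ^ card B"
      by (simp add: p[THEN ext] common_def)
  qed
  finally show ?thesis .
qed

definition star_sum :: "'v set \<Rightarrow> 'v set \<Rightarrow> real" where
  "star_sum A N = (\<Sum>B\<in>{B. B \<subseteq> N \<and> 2 \<le> card B}. t (biclique A B))"

text \<open>The density of \<open>A \<times> B\<close> is the average of \<open>L ^ card B\<close>, where \<open>L\<close> is the signed common degree of
  \<open>A\<close>. Summing over all \<open>B\<close> with at least two elements gives the two-sided binomial remainder to which
  Bernoulli's inequality applies, since \<open>L \<ge> -1\<close>.\<close>

lemma star_sum_bounds:
  assumes fin: "finite A" "finite N" and sides: "\<And>a. a \<in> A \<Longrightarrow> side a = s" "\<And>b. b \<in> N \<Longrightarrow> side b = (\<not> s)"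
  shows "0 \<le> star_sum A N"
    and "2 \<le> card N \<Longrightarrow> Av n A (\<lambda>z. (common s A z)\<^sup>2) (\<lambda>_. 0) \<le> star_sum A N"
proof -
  have "star_sum A N = (\<Sum>B\<in>{B. B \<subseteq> N \<and> 2 \<le> card B}. Av n A (\<lambda>z. common s A z ^ card B) (\<lambda>_. 0))"
    unfolding star_sum_def
    by (intro sum.cong refl t_biclique) (use fin sides in \<open>auto intro: finite_subset\<close>)
  also have "\<dots> = Av n A (\<lambda>z. \<Sum>B\<in>{B. B \<subseteq> N \<and> 2 \<le> card B}. common s A z ^ card B) (\<lambda>_. 0)"
    by (rule Av_sum[symmetric])
  finally have eq: "star_sum A N = Av n A (\<lambda>z. (1 + common s A z) ^ card N - 1 - real (card N) * common s A z) (\<lambda>_. 0)"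
    by (simp only: sum_power_card_ge2[OF fin(2)])
  have c: "-1 \<le> common s A z" for z using common_bound[of s A z] by linarith
  show "0 \<le> star_sum A N"
    unfolding eq
  proof (rule Av_nonneg)
    fix z show "0 \<le> (1 + common s A z) ^ card N - 1 - real (card N) * common s A z"
      using Bernoulli_inequality[OF c, of "card N" z] by linarith
  qed
  assume "2 \<le> card N"
  then obtain k where k: "card N = k + 2" by (metis add.commute le_Suc_ex)
  show "Av n A (\<lambda>z. (common s A z)\<^sup>2) (\<lambda>_. 0) \<le> star_sum A N"
    unfolding eq k by (intro Av_mono Bernoulli_square c)
qed

definition nbrs :: "'v set set \<Rightarrow> 'v set \<Rightarrow> 'v set" where
  "nbrs E A = {b. \<forall>a\<in>A. {a, b} \<in> E}"

lemma nbrs_props: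
  assumes "bip E" "a \<in> A" "\<And>a. a \<in> A \<Longrightarrow> side a = s"
  shows "finite (nbrs E A)" "\<And>b. b \<in> nbrs E A \<Longrightarrow> side b = (\<not> s)"
proof -
  have "nbrs E A \<subseteq> \<Union>E" using assms(2) unfolding nbrs_def by auto
  then show "finite (nbrs E A)" using bip_finite_Un[OF assms(1)] by (rule finite_subset)
  fix b assume "b \<in> nbrs E A"
  then have "{a, b} \<in> E" using assms(2) by (simp add: nbrs_def)
  then show "side b = (\<not> s)" using bip_edge(1)[OF assms(1)] assms(3)[OF assms(2)] by auto
qed

lemma biclique_parts:
  assumes "A \<noteq> {}" "B \<noteq> {}" "\<And>a. a \<in> A \<Longrightarrow> side a = s" "\<And>b. b \<in> B \<Longrightarrow> side b = (\<not> s)"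
  shows "{a \<in> \<Union>(biclique A B). side a = s} = A" "{b \<in> \<Union>(biclique A B). side b = (\<not> s)} = B"
proof -
  have U: "\<Union>(biclique A B) = A \<union> B" using assms(1,2) by (auto simp: biclique_def)
  show "{a \<in> \<Union>(biclique A B). side a = s} = A" "{b \<in> \<Union>(biclique A B). side b = (\<not> s)} = B"
    unfolding U using assms(3,4) by auto
qed

text \<open>In a cycle of length at least six there are two vertices on different sides that are not adjacent.
  This keeps the long cycles apart from the bicliques when the nonnegative groups are summed.\<close>

lemma long_cycle_not_biclique:
  assumes "bip D" "long_cycle D" and sides: "\<And>a. a \<in> A \<Longrightarrow> side a = s" "\<And>b. b \<in> B \<Longrightarrow> side b = (\<not> s)"
  shows "D \<noteq> biclique A B"
proof
  assume DB: "D = biclique A B"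
  obtain p "is" q js where C: "chordless_cycle D p is q js" "2 \<le> length is"
    "D = path_edges (p # is @ [q]) \<union> path_edges (p # js @ [q])"
    using assms(2) unfolding long_cycle_def by blast
  obtain i1 i2 is' where i: "is = i1 # i2 # is'" using C(2) by (cases "is"; cases "tl is") auto
  have "length is = length js" "distinct (p # q # is @ js)" using C(1) by (auto simp: chordless_cycle_def)
  then obtain j1 js' where j: "js = j1 # js'" using i by (cases js) auto
  obtain x ws where x: "is' @ [q] = x # ws" by (cases "is'") auto
  have xs: "x \<in> set is' \<union> {q}" using arg_cong[OF x, of set] by auto
  have d: "p \<noteq> i1" "p \<noteq> x" "x \<noteq> i1" "x \<noteq> j1" "p \<noteq> i2" "p \<noteq> j1" "p \<notin> set is'" "p \<notin> set js'" "p \<noteq> q"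
    using \<open>distinct _\<close> i j xs by auto
  have e: "{p, i1} \<in> D" "{i1, i2} \<in> D" "{i2, x} \<in> D" using C(3) i x by auto
  have sx: "side x \<noteq> side p"
    using bip_edge(1)[OF assms(1) e(1)] bip_edge(1)[OF assms(1) e(2)] bip_edge(1)[OF assms(1) e(3)] by auto
  have mem: "v \<in> A \<union> B" if "f \<in> D" "v \<in> f" for f v using that unfolding DB mem_biclique by auto
  have pAB: "p \<in> A \<union> B" "x \<in> A \<union> B" using mem[OF e(1), of p] mem[OF e(3), of x] by auto
  have "{p, x} \<in> D"
  proof (cases "p \<in> A")
    case True
    then have "x \<in> B" using sx sides pAB by auto
    then show ?thesis using True DB mem_bicliqueI by auto
  next
    case False
    then have "p \<in> B" using pAB by auto
    then have "x \<in> A" using sx sides pAB by auto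
    then show ?thesis using \<open>p \<in> B\<close> DB mem_bicliqueI[of x A p B] by (simp add: insert_commute)
  qed
  then consider "{p, x} \<in> path_edges (p # i1 # i2 # is' @ [q])" | "{p, x} \<in> path_edges (p # j1 # js' @ [q])"
    using C(3) i j by auto
  then show False
  proof cases
    case 1
    from path_edges_first[OF this] show False using d by (auto simp: doubleton_eq_iff)
  next
    case 2
    from path_edges_first[OF this] show False using d by (auto simp: doubleton_eq_iff)
  qed
qed

lemma long_cycle_nonneg:
  assumes "bip D" "long_cycle D" shows "0 \<le> t D"
proof -
  obtain p "is" q js where C: "chordless_cycle D p is q js" "2 \<le> length is"
    "D = path_edges (p # is @ [q]) \<union> path_edges (p # js @ [q])"
    using assms(2) unfolding long_cycle_def by blast
  then show ?thesis using chordless_cycle_t[OF assms(1) C(1)] path_sq_nonneg by metis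
qed

lemma alpha_common: "side a = s \<Longrightarrow> Av n {a} (\<lambda>z. (common s {a} z)\<^sup>2) z0 = alpha (side a)"
  by (simp add: Av_sing common_def alpha_def deg_fun_def)

lemma t_single: assumes "bip {e}" shows "t {e} = 0"
proof -
  obtain u v where e: "e = {u, v}" using assms unfolding bip_def by blast
  show ?thesis by (rule t_isolated_edge[OF assms, of v u]) (auto simp: inc_def e)
qed

lemma star_biclique:
  assumes "bip D" "\<And>e. e \<in> D \<Longrightarrow> a \<in> e"
  shows "D = biclique {a} {b. {a, b} \<in> D}"
proof (intro equalityI subsetI)
  fix e assume e: "e \<in> D"
  obtain b where "e = {a, b}" by (rule bip_edgeE[OF assms(1) e assms(2)[OF e]])
  then show "e \<in> biclique {a} {b. {a, b} \<in> D}" using e by (auto simp: mem_biclique)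
qed (auto simp: mem_biclique)

end

section \<open>The inequality for finite averages\<close>

context bip_kernel
begin

text \<open>The sum splits into the empty set, the nonnegative groups with total \<open>P\<close>, and at most
  \<open>2 ^ card E\<close> terms of size at most \<open>\<kappa> P\<close>. The groups \<open>F1\<close> are the bicliques with at least two
  right nodes, \<open>F2\<close> the stars with a right centre and at least two leaves, and \<open>F3\<close> the long cycles. A
  biclique determines its two sides, so these families are disjoint and injectively indexed.\<close>

theorem sum_t_nonneg:
  assumes E: "bip E" and kap: "0 \<le> kappa" "kappa\<^sup>2 = eta" "2 ^ card E * kappa \<le> 1"
  shows "1 \<le> (\<Sum>D\<in>Pow E. t D)"
proof -
  have finE: "finite E" and finU: "finite (\<Union>E)" using bip_finite[OF E] bip_finite_Un[OF E] by auto
  have kap1: "kappa \<le> 1"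
  proof -
    have "1 * kappa \<le> 2 ^ card E * kappa" using kap(1) by (intro mult_right_mono) auto
    then show ?thesis using kap(3) by simp
  qed
  define AA where "AA = {A. A \<subseteq> \<Union>E \<and> A \<noteq> {} \<and> (\<forall>a\<in>A. side a)}"
  define BB where "BB = {b \<in> \<Union>E. \<not> side b}"
  define I1 where "I1 = Sigma AA (\<lambda>A. {B. B \<subseteq> nbrs E A \<and> 2 \<le> card B})"
  define I2 where "I2 = Sigma BB (\<lambda>b. {A. A \<subseteq> nbrs E {b} \<and> 2 \<le> card A})"
  define F1 where "F1 = (\<lambda>(A, B). biclique A B) ` I1"
  define F2 where "F2 = (\<lambda>(b, A). biclique {b} A) ` I2"
  define F3 where "F3 = {D. D \<subseteq> E \<and> long_cycle D}"
  have finAA: "finite AA" "finite BB" using finU unfolding AA_def BB_def by (auto simp del: Union_iff)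
  have nA: "finite (nbrs E A)" "\<And>b. b \<in> nbrs E A \<Longrightarrow> \<not> side b" if A: "A \<in> AA" for A
  proof -
    obtain a where a: "a \<in> A" using A by (auto simp: AA_def)
    have sA: "side a' = True" if "a' \<in> A" for a' using A that by (simp add: AA_def)
    show "finite (nbrs E A)" by (rule nbrs_props(1)[OF E a sA])
    show "\<not> side b" if "b \<in> nbrs E A" for b using nbrs_props(2)[OF E a sA that] by simp
  qed
  have nB: "finite (nbrs E {b})" "\<And>a. a \<in> nbrs E {b} \<Longrightarrow> side a" if b: "b \<in> BB" for b
  proof -
    have sB: "side b' = False" if "b' \<in> {b}" for b' using b that by (simp add: BB_def)
    show "finite (nbrs E {b})" by (rule nbrs_props(1)[OF E _ sB]) simp
    show "side a" if "a \<in> nbrs E {b}" for a using nbrs_props(2)[OF E _ sB that] by simp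
  qed
  have finA: "finite A" if "A \<in> AA" for A using that finU by (auto simp: AA_def intro: finite_subset)
  have i1: "A \<noteq> {}" "B \<noteq> {}" "\<And>a. a \<in> A \<Longrightarrow> side a = True" "\<And>b. b \<in> B \<Longrightarrow> side b = (\<not> True)" "2 \<le> card B"
    if AB: "(A, B) \<in> I1" for A B
  proof -
    have *: "A \<in> AA" "B \<subseteq> nbrs E A" "2 \<le> card B" using AB by (simp_all add: I1_def)
    show "A \<noteq> {}" using *(1) by (simp add: AA_def)
    show "B \<noteq> {}" "2 \<le> card B" using *(3) by auto
    show "side a = True" if "a \<in> A" for a using *(1) that by (simp add: AA_def)
    show "side b = (\<not> True)" if "b \<in> B" for b using nA(2)[OF *(1)] *(2) that by blast
  qed
  have i2: "A \<noteq> {}" "\<And>a. a \<in> A \<Longrightarrow> side a = (\<not> False)" "\<And>b'. b' \<in> {b} \<Longrightarrow> side b' = False" "2 \<le> card A"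
    if AB: "(b, A) \<in> I2" for A b
  proof -
    have *: "b \<in> BB" "A \<subseteq> nbrs E {b}" "2 \<le> card A" using AB by (simp_all add: I2_def)
    show "A \<noteq> {}" "2 \<le> card A" using *(3) by auto
    show "side b' = False" if "b' \<in> {b}" for b' using *(1) that by (simp add: BB_def)
    show "side a = (\<not> False)" if "a \<in> A" for a using nB(2)[OF *(1)] *(2) that by blast
  qed
  have parts1: "{a \<in> \<Union>(biclique A B). side a} = A" "{b \<in> \<Union>(biclique A B). \<not> side b} = B" if "(A, B) \<in> I1" for A B
    using biclique_parts[OF i1(1-4)[OF that]] by simp_all
  have parts2: "{b' \<in> \<Union>(biclique {b} A). \<not> side b'} = {b}" "{a \<in> \<Union>(biclique {b} A). side a} = A" if "(b, A) \<in> I2" for A b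
    using biclique_parts[of "{b}" A False] i2[OF that] by simp_all
  have inj1: "inj_on (\<lambda>(A, B). biclique A B) I1"
  proof (rule inj_onI, clarify)
    fix A B A' B' assume *: "(A, B) \<in> I1" "(A', B') \<in> I1" "biclique A B = biclique A' B'"
    show "A = A' \<and> B = B'" using parts1[OF *(1)] parts1[OF *(2)] *(3) by simp
  qed
  have inj2: "inj_on (\<lambda>(b, A). biclique {b} A) I2"
  proof (rule inj_onI, clarify)
    fix b A b' A' assume *: "(b, A) \<in> I2" "(b', A') \<in> I2" "biclique {b} A = biclique {b'} A'"
    have "{b} = {b'}" "A = A'" using parts2[OF *(1)] parts2[OF *(2)] *(3) by simp_all
    then show "b = b' \<and> A = A'" by simp
  qed
  have disj12: "F1 \<inter> F2 = {}"
  proof (rule ccontr)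
    assume "F1 \<inter> F2 \<noteq> {}"
    then obtain A B b A' where *: "(A, B) \<in> I1" "(b, A') \<in> I2" "biclique A B = biclique {b} A'"
      unfolding F1_def F2_def by auto
    have "B = {b}" using parts1(2)[OF *(1)] parts2(1)[OF *(2)] *(3) by simp
    then show False using i1(5)[OF *(1)] by simp
  qed
  have disj3: "(F1 \<union> F2) \<inter> F3 = {}"
  proof (rule ccontr)
    assume "(F1 \<union> F2) \<inter> F3 \<noteq> {}"
    then obtain D where D: "D \<in> F1 \<union> F2" "D \<subseteq> E" "long_cycle D" unfolding F3_def by blast
    have bD: "bip D" by (rule bip_subset[OF E D(2)])
    show False
    proof (cases "D \<in> F1")
      case True
      then obtain A B where *: "(A, B) \<in> I1" "D = biclique A B" unfolding F1_def by auto
      have "D \<noteq> biclique A B"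
        by (rule long_cycle_not_biclique[OF bD D(3), of A True]) (fact i1(3)[OF *(1)] i1(4)[OF *(1)])+
      then show False using *(2) by simp
    next
      case False
      then obtain b A where *: "(b, A) \<in> I2" "D = biclique {b} A" using D(1) unfolding F2_def by auto
      have "D \<noteq> biclique {b} A"
        by (rule long_cycle_not_biclique[OF bD D(3), of "{b}" False]) (fact i2(3)[OF *(1)] i2(2)[OF *(1)])+
      then show False using *(2) by simp
    qed
  qed
  have F1E: "F1 \<subseteq> Pow E"
  proof
    fix D assume "D \<in> F1"
    then obtain A B where "(A, B) \<in> I1" "D = biclique A B" unfolding F1_def by auto
    then show "D \<in> Pow E" by (auto simp: I1_def nbrs_def intro!: bicliqueI)
  qed
  have F2E: "F2 \<subseteq> Pow E"
  proof
    fix D assume "D \<in> F2"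
    then obtain b A where "(b, A) \<in> I2" "D = biclique {b} A" unfolding F2_def by auto
    then show "D \<in> Pow E" by (auto simp: I2_def nbrs_def intro!: bicliqueI)
  qed
  have F3E: "F3 \<subseteq> Pow E" by (auto simp: F3_def)
  have fins: "finite F1" "finite F2" "finite F3"
    using F1E F2E F3E finE by (auto intro: finite_subset)
  define P where "P = (\<Sum>A\<in>AA. star_sum A (nbrs E A)) + (\<Sum>b\<in>BB. star_sum {b} (nbrs E {b})) + (\<Sum>D\<in>F3. t D)"
  have S1: "sum t F1 = (\<Sum>A\<in>AA. star_sum A (nbrs E A))"
  proof -
    have "sum t F1 = (\<Sum>(A, B)\<in>I1. t (biclique A B))"
      unfolding F1_def by (subst sum.reindex[OF inj1]) (simp add: case_prod_unfold)
    also have "\<dots> = (\<Sum>A\<in>AA. star_sum A (nbrs E A))"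
      unfolding I1_def star_sum_def
      by (rule sum.Sigma[symmetric]) (use finAA nA(1) in auto)
    finally show ?thesis .
  qed
  have S2: "sum t F2 = (\<Sum>b\<in>BB. star_sum {b} (nbrs E {b}))"
  proof -
    have "sum t F2 = (\<Sum>(b, A)\<in>I2. t (biclique {b} A))"
      unfolding F2_def by (subst sum.reindex[OF inj2]) (simp add: case_prod_unfold)
    also have "\<dots> = (\<Sum>b\<in>BB. star_sum {b} (nbrs E {b}))"
      unfolding I2_def star_sum_def
      by (rule sum.Sigma[symmetric]) (use finAA nB(1) in auto)
    finally show ?thesis .
  qed
  have SP: "sum t (F1 \<union> F2 \<union> F3) = P"
  proof -
    have "finite (F1 \<union> F2)" using fins by simp
    then have "sum t (F1 \<union> F2 \<union> F3) = sum t (F1 \<union> F2) + sum t F3"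
      using fins(3) disj3 by (rule sum.union_disjoint)
    moreover have "sum t (F1 \<union> F2) = sum t F1 + sum t F2"
      using fins(1,2) disj12 by (rule sum.union_disjoint)
    ultimately show ?thesis unfolding P_def S1 S2 by simp
  qed
  have sAA: "side a = True" if "A \<in> AA" "a \<in> A" for A a using that by (simp add: AA_def)
  have nAs: "side b = (\<not> True)" if "A \<in> AA" "b \<in> nbrs E A" for A b using nA(2)[OF that] by simp
  have sBB: "side b' = False" if "b \<in> BB" "b' \<in> {b}" for b b' using that by (simp add: BB_def)
  have nBs: "side a = (\<not> False)" if "b \<in> BB" "a \<in> nbrs E {b}" for b a using nB(2)[OF that] by simp
  have n1: "0 \<le> star_sum A (nbrs E A)" if "A \<in> AA" for A
    by (rule star_sum_bounds(1)[OF finA[OF that] nA(1)[OF that] sAA[OF that] nAs[OF that]])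
  have n2: "0 \<le> star_sum {b} (nbrs E {b})" if "b \<in> BB" for b
    by (rule star_sum_bounds(1)[OF _ nB(1)[OF that] sBB[OF that] nBs[OF that]]) auto
  have n3: "0 \<le> t D" if "D \<in> F3" for D
    using that long_cycle_nonneg[OF bip_subset[OF E]] by (simp add: F3_def)
  have N: "0 \<le> (\<Sum>A\<in>AA. star_sum A (nbrs E A))" "0 \<le> (\<Sum>b\<in>BB. star_sum {b} (nbrs E {b}))" "0 \<le> (\<Sum>D\<in>F3. t D)"
    by (intro sum_nonneg n1 n2 n3; assumption)+
  have P0: "0 \<le> P" using N by (simp add: P_def)
  have P1: "star_sum A (nbrs E A) \<le> P" if "A \<in> AA" for A
    using member_le_sum[of A AA "\<lambda>A. star_sum A (nbrs E A)"] that finAA n1 N by (simp add: P_def)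
  have P2: "star_sum {b} (nbrs E {b}) \<le> P" if "b \<in> BB" for b
    using member_le_sum[of b BB "\<lambda>b. star_sum {b} (nbrs E {b})"] that finAA n2 N by (simp add: P_def)
  have P3: "t D \<le> P" if "D \<in> F3" for D
    using member_le_sum[of D F3 t] that fins n3 N by (simp add: P_def)
  \<comment> \<open>A four-cycle is the biclique of two left nodes and two of their common neighbours.\<close>
  have Pbic: "t (biclique A B) \<le> P"
    if "A \<in> AA" "B \<subseteq> nbrs E A" "card B = 2" for A B
  proof -
    have fB: "finite B" using that(2) nA(1)[OF that(1)] by (rule finite_subset)
    have sB: "side b = (\<not> True)" if "b \<in> B" for b using nAs[OF \<open>A \<in> AA\<close>] \<open>B \<subseteq> _\<close> that by blast
    have "t (biclique A B) = Av n A (\<lambda>z. (common True A z)\<^sup>2) (\<lambda>_. 0)"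
      using t_biclique[OF finA[OF that(1)] fB sAA[OF that(1)] sB] that(3) by simp
    also have "\<dots> \<le> star_sum A (nbrs E A)"
    proof (rule star_sum_bounds(2)[OF finA[OF that(1)] nA(1)[OF that(1)] sAA[OF that(1)] nAs[OF that(1)]])
      show "2 \<le> card (nbrs E A)" using card_mono[OF nA(1)[OF that(1)] that(2)] that(3) by simp
    qed
    finally show ?thesis using P1[OF that(1)] by simp
  qed
  have ch: "charged D P" if DE: "D \<subseteq> E" for D
    unfolding charged_def
  proof (intro conjI allI impI P0)
    fix a assume a: "2 \<le> card (inc D a)"
    have bD: "bip D" by (rule bip_subset[OF E DE])
    \<comment> \<open>Every edge of \<open>D\<close> at \<open>a\<close> leads to a neighbour of \<open>a\<close> in \<open>E\<close>, so \<open>a\<close> has at least two neighbours there.\<close>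
    have img: "inc D a \<subseteq> (\<lambda>b. {a, b}) ` nbrs E {a}"
    proof
      fix e assume "e \<in> inc D a"
      then have e: "e \<in> D" "a \<in> e" by (auto simp: inc_def)
      obtain b where "e = {a, b}" by (rule bip_edgeE[OF bD e])
      then show "e \<in> (\<lambda>b. {a, b}) ` nbrs E {a}" using e DE by (auto simp: nbrs_def)
    qed
    have "inc D a \<noteq> {}" using a by auto
    then have aU: "a \<in> \<Union>E" using DE by (auto simp: inc_def)
    have fN: "finite (nbrs E {a})" "\<And>b. b \<in> nbrs E {a} \<Longrightarrow> side b = (\<not> side a)"
      using nbrs_props(1)[OF E, of a "{a}" "side a"] nbrs_props(2)[OF E, of a "{a}" "side a"] by blast+
    have c2: "2 \<le> card (nbrs E {a})"
      using a card_mono[OF _ img] card_image_le[OF fN(1), of "\<lambda>b. {a, b}"] fN(1) by (meson finite_imageI order_trans)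
    have "Av n {a} (\<lambda>z. (common (side a) {a} z)\<^sup>2) (\<lambda>_. 0) \<le> star_sum {a} (nbrs E {a})"
      by (rule star_sum_bounds(2)[OF _ fN(1) _ fN(2) c2]) auto
    then have "alpha (side a) \<le> star_sum {a} (nbrs E {a})" by (simp only: alpha_common)
    also have "\<dots> \<le> P"
    proof (cases "side a")
      case True then show ?thesis using P1[of "{a}"] aU by (simp add: AA_def)
    next
      case False then show ?thesis using P2[of a] aU by (simp add: BB_def)
    qed
    finally show "alpha (side a) \<le> P" .
  next
    fix D' p "is" q js assume D': "D' \<subseteq> D" "chordless_cycle D' p is q js"
    let ?C = "path_edges (p # is @ [q]) \<union> path_edges (p # js @ [q])"
    have CD: "?C \<subseteq> D'" using D'(2) by (simp add: chordless_cycle_def)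
    have bD': "bip D'" using bip_subset[OF E] D'(1) DE by blast
    have len: "length is = length js" "is \<noteq> []" and dist: "distinct (p # q # is @ js)"
      using D'(2) by (auto simp: chordless_cycle_def)
    show "t ?C \<le> P"
    proof (cases "2 \<le> length is")
      case True
      have "chordless_cycle ?C p is q js" by (rule chordless_cycle_subset[OF D'(2) CD]) simp
      then have "long_cycle ?C" unfolding long_cycle_def using True by blast
      then show ?thesis using P3[of ?C] CD D'(1) DE by (auto simp: F3_def)
    next
      case False
      obtain i where i: "is = [i]" using False len by (cases "is"; cases "tl is") auto
      obtain j where j: "js = [j]" using len i by (cases js; cases "tl js") auto
      have e: "{p, i} \<in> E" "{i, q} \<in> E" "{p, j} \<in> E" "{j, q} \<in> E" using CD i j D'(1) DE by auto
      have ne: "p \<noteq> q" "i \<noteq> j" using dist i j by auto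
      have sd: "side p = side p" "side q = side p" "side i = (\<not> side p)" "side j = (\<not> side p)"
        using bip_edge(1)[OF E e(1)] bip_edge(1)[OF E e(2)] bip_edge(1)[OF E e(3)] by auto
      have C: "?C = biclique {p, q} {i, j}" using four_cycle_chordless(2)[OF ne sd] i j by simp
      have e': "{i, p} \<in> E" "{q, i} \<in> E" "{j, p} \<in> E" "{q, j} \<in> E" using e by (simp_all add: insert_commute)
      show ?thesis
      proof (cases "side p")
        case True
        have "t (biclique {p, q} {i, j}) \<le> P"
        proof (rule Pbic)
          show "{p, q} \<in> AA" using True sd e unfolding AA_def by auto
          show "{i, j} \<subseteq> nbrs E {p, q}" using e e' by (auto simp: nbrs_def)
        qed (use ne in auto)
        then show ?thesis using C by simp
      next
        case False
        have "t (biclique {i, j} {p, q}) \<le> P"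
        proof (rule Pbic)
          show "{i, j} \<in> AA" using False sd e unfolding AA_def by auto
          show "{p, q} \<subseteq> nbrs E {i, j}" using e e' by (auto simp: nbrs_def)
        qed (use ne in auto)
        then show ?thesis using C biclique_commute by metis
      qed
    qed
  qed
  define F where "F = F1 \<union> F2 \<union> F3"
  have bad: "\<bar>t D\<bar> \<le> kappa * P" if D: "D \<subseteq> E" "D \<noteq> {}" "D \<notin> F" for D
  proof -
    have bD: "bip D" by (rule bip_subset[OF E D(1)])
    show ?thesis
    proof (cases "\<exists>a. \<forall>e\<in>D. a \<in> e")
      case True
      then obtain a where a: "\<And>e. e \<in> D \<Longrightarrow> a \<in> e" by blast
      define N where "N = {b. {a, b} \<in> D}"
      have DN: "D = biclique {a} N" unfolding N_def by (rule star_biclique[OF bD a])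
      have N: "N \<noteq> {}" "N \<subseteq> nbrs E {a}"
      proof -
        obtain e where "e \<in> biclique {a} N" using D(2) DN by blast
        then show "N \<noteq> {}" unfolding mem_biclique by blast
        show "N \<subseteq> nbrs E {a}" using D(1) unfolding N_def nbrs_def by blast
      qed
      have aU: "a \<in> \<Union>E" using D a by blast
      show ?thesis
      proof (cases "2 \<le> card N")
        case True
        have "D \<in> F1 \<union> F2"
        proof (cases "side a")
          case s: True
          then have "({a}, N) \<in> I1" using True N aU by (auto simp: I1_def AA_def)
          then show ?thesis unfolding F1_def using DN by force
        next
          case s: False
          then have "(a, N) \<in> I2" using True N aU by (auto simp: I2_def BB_def)
          then show ?thesis unfolding F2_def using DN by force
        qed
        then show ?thesis using D(3) F_def by blast
      next
        case False
        have "finite N" by (rule finite_subset[OF N(2)]) (rule nbrs_props[OF E, of a _ "side a"], auto)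
        then have "card N \<noteq> 0" using N(1) by simp
        then have "card N = 1" using False by linarith
        then obtain b where "N = {b}" by (auto simp: card_1_singleton_iff)
        then have "D = {{a, b}}" using DN by (simp add: biclique_def)
        then have "t D = 0" using t_single bD by simp
        then show ?thesis using kap P0 by simp
      qed
    next
      case False
      then have st: "\<And>a. \<exists>e\<in>D. a \<notin> e" by blast
      have nb: "D \<noteq> biclique A B"
        if AB: "\<forall>a\<in>A. side a" "\<forall>b\<in>B. \<not> side b" "2 \<le> card A" "2 \<le> card B" for A B
      proof
        assume DB: "D = biclique A B"
        have ne: "A \<noteq> {}" "B \<noteq> {}" using AB by auto
        have e: "{a, b} \<in> E" if "a \<in> A" "b \<in> B" for a b using that D(1) DB mem_bicliqueI[of a A b B] by auto
        have "A \<subseteq> \<Union>E" using e ne by blast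
        then have "(A, B) \<in> I1" using AB ne e by (auto simp: I1_def AA_def nbrs_def)
        then have "D \<in> F1" unfolding F1_def using DB by force
        then show False using D(3) by (simp add: F_def)
      qed
      have nc: "\<not> long_cycle D" using D by (auto simp: F_def F3_def)
      show ?thesis by (rule charged_bound[OF bD D(2) ch[OF D(1)] kap(1) kap1 kap(2) st nb nc])
    qed
  qed
  have FE: "F \<subseteq> Pow E - {{}}"
  proof -
    have "{} \<notin> F1" "{} \<notin> F2" using parts1(1) i1(1) parts2(1)
      by (fastforce simp: F1_def F2_def)+
    moreover have "{} \<notin> F3" by (auto simp: F3_def long_cycle_def)
       (metis append_Cons insert_not_empty neq_Nil_conv path_edges.simps(1) append_Nil)
    ultimately show ?thesis using F1E F2E F3E by (auto simp: F_def)
  qed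
  let ?B = "Pow E - {{}} - F"
  have finP: "finite (Pow E)" using finE by simp
  have "(\<Sum>D\<in>Pow E. t D) = t {} + (\<Sum>D\<in>Pow E - {{}}. t D)"
    using sum.remove[OF finP, of "{}" t] by simp
  also have "(\<Sum>D\<in>Pow E - {{}}. t D) = (\<Sum>D\<in>?B. t D) + sum t F"
    using sum.subset_diff[OF FE, of t] finP by simp
  also have "sum t F = P" unfolding F_def by (rule SP)
  also have "t {} = 1" by (simp add: t_def)
  finally have tot: "(\<Sum>D\<in>Pow E. t D) = 1 + ((\<Sum>D\<in>?B. t D) + P)" .
  have "\<bar>\<Sum>D\<in>?B. t D\<bar> \<le> (\<Sum>D\<in>?B. \<bar>t D\<bar>)" by (rule sum_abs)
  also have "\<dots> \<le> (\<Sum>D\<in>?B. kappa * P)" by (rule sum_mono) (use bad in auto)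
  also have "\<dots> = real (card ?B) * (kappa * P)" by simp
  also have "\<dots> \<le> 2 ^ card E * (kappa * P)"
  proof (rule mult_right_mono)
    have "card ?B \<le> card (Pow E)" by (rule card_mono[OF finP]) auto
    then show "real (card ?B) \<le> 2 ^ card E" using finE by (simp add: card_Pow) 
  qed (use kap P0 in auto)
  also have "\<dots> = (2 ^ card E * kappa) * P" by simp
  also have "\<dots> \<le> 1 * P" using kap(3) P0 by (rule mult_right_mono)
  finally show ?thesis unfolding tot by linarith
qed

corollary density_ge_1:
  assumes E: "bip E" and kap: "0 \<le> kappa" "kappa\<^sup>2 = eta" "2 ^ card E * kappa \<le> 1"
    and X: "finite X" "\<Union>E \<subseteq> X"
  shows "1 \<le> Av n X (\<lambda>z. \<Prod>e\<in>E. 1 + fac e z) z0"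
proof -
  have "(\<lambda>z. \<Prod>e\<in>E. 1 + fac e z) = (\<lambda>z. \<Sum>D\<in>Pow E. edge_prod D z)"
    using prod_add[OF bip_finite[OF E], of "\<lambda>e. fac e _" "\<lambda>_. 1"] by (simp add: edge_prod_def add.commute)
  then have "Av n X (\<lambda>z. \<Prod>e\<in>E. 1 + fac e z) z0 = (\<Sum>D\<in>Pow E. Av n X (edge_prod D) z0)"
    by (simp add: Av_sum)
  also have "\<dots> = (\<Sum>D\<in>Pow E. t D)"
    by (intro sum.cong refl t_eq bip_subset[OF E]) (use X in auto)
  finally show ?thesis using sum_t_nonneg[OF E kap] by simp
qed

end

section \<open>The unit square and the unit cube\<close>

abbreviation unit_measure :: "real measure" where
  "unit_measure \<equiv> restrict_space lborel {0..1}"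

abbreviation square_measure :: "(real \<times> real) measure" where
  "square_measure \<equiv> unit_measure \<Otimes>\<^sub>M unit_measure"

lemma space_unit: "space unit_measure = {0..1}"
  by (simp add: space_restrict_space)
lemma emeasure_unit: "A \<in> sets unit_measure \<Longrightarrow> emeasure unit_measure A = emeasure lborel A"
  by (subst emeasure_restrict_space) (auto simp: sets_restrict_space)
lemma emeasure_unit_space: "emeasure unit_measure {0..1} = 1"
  by (subst emeasure_restrict_space) auto

interpretation unit: finite_measure unit_measure
  by standard (simp add: space_unit emeasure_unit_space)

lemma space_square: "space square_measure = unit_square"
  by (simp add: space_pair_measure space_unit)

lemma square_measure_eq: "square_measure = restrict_space lborel unit_square"
proof (rule pair_measure_eqI)
  show "sigma_finite_measure unit_measure" by standard
  then show "sigma_finite_measure unit_measure" .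
  have sp: "space (restrict_space lborel unit_square) = unit_square" by (simp add: space_restrict_space)
  show "sets square_measure = sets (restrict_space lborel unit_square)"
  proof (intro equalityI subsetI)
    fix A :: "(real \<times> real) set" assume A: "A \<in> sets (restrict_space lborel unit_square)"
    have f: "(\<lambda>x. x) \<in> unit_measure \<rightarrow>\<^sub>M borel"
      by (simp add: measurable_restrict_space1)
    have "(\<lambda>p. p) \<in> square_measure \<rightarrow>\<^sub>M restrict_space (lborel :: (real \<times> real) measure) unit_square"
    proof (rule measurable_restrict_space2)
      show "(\<lambda>p. p) \<in> space square_measure \<rightarrow> unit_square" by (auto simp: space_square)
      have "(\<lambda>p. (fst p, snd p)) \<in> square_measure \<rightarrow>\<^sub>M borel \<Otimes>\<^sub>M borel"
        by (rule measurable_Pair) (use f in \<open>auto intro: measurable_compose[OF measurable_fst] measurable_compose[OF measurable_snd]\<close>)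
      then show "(\<lambda>p. p) \<in> square_measure \<rightarrow>\<^sub>M (lborel :: (real \<times> real) measure)"
        by (simp add: borel_prod)
    qed
    from measurable_sets[OF this A] show "A \<in> sets square_measure"
      using sets.sets_into_space[OF A] by (simp add: space_square sp Int_absorb2)
  next
    fix A assume A: "A \<in> sets square_measure"
    have m: "(fst :: real \<times> real \<Rightarrow> real) \<in> borel \<rightarrow>\<^sub>M borel" "(snd :: real \<times> real \<Rightarrow> real) \<in> borel \<rightarrow>\<^sub>M borel"
      by (intro borel_measurable_continuous_onI continuous_intros)+
    have fm: "f \<in> restrict_space lborel unit_square \<rightarrow>\<^sub>M unit_measure"
      if "f \<in> borel \<rightarrow>\<^sub>M borel" "f \<in> unit_square \<rightarrow> {0..1}" for f :: "real \<times> real \<Rightarrow> real"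
      by (rule measurable_restrict_space2) (use that in \<open>auto simp: space_restrict_space intro: measurable_restrict_space1\<close>)
    have "(\<lambda>p. (fst p, snd p)) \<in> restrict_space lborel unit_square \<rightarrow>\<^sub>M square_measure"
      by (rule measurable_Pair; rule fm[OF m(1)] fm[OF m(2)]; auto)
    then have "(\<lambda>p. p) \<in> restrict_space lborel unit_square \<rightarrow>\<^sub>M square_measure" by simp
    from measurable_sets[OF this A] show "A \<in> sets (restrict_space lborel unit_square)"
      using sets.sets_into_space[OF A] by (simp add: space_square sp Int_absorb2)
  qed
  fix A B assume A: "A \<in> sets unit_measure" and B: "B \<in> sets unit_measure"
  have sub: "A \<subseteq> {0..1}" "B \<subseteq> {0..1}" using sets.sets_into_space[OF A] sets.sets_into_space[OF B] by (auto simp: space_unit)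
  have bor: "A \<in> sets borel" "B \<in> sets borel"
    using A B by (auto simp: sets_restrict_space)
  have "emeasure unit_measure A * emeasure unit_measure B = emeasure lborel A * emeasure lborel B"
    using emeasure_unit A B by simp
  also have "\<dots> = emeasure (lborel \<Otimes>\<^sub>M lborel) (A \<times> B)"
    using bor by (intro lborel.emeasure_pair_measure_Times[symmetric]) auto
  also have "\<dots> = emeasure lborel (A \<times> B)" by (simp add: lborel_prod)
  also have "\<dots> = emeasure (restrict_space lborel unit_square) (A \<times> B)"
    by (rule emeasure_restrict_space[symmetric]) (use sub in \<open>auto intro!: borel_closed closed_Times\<close>)
  finally show "emeasure unit_measure A * emeasure unit_measure B = emeasure (restrict_space lborel unit_square) (A \<times> B)" .
qed

lemma emeasure_square_space: "emeasure square_measure (space square_measure) = 1"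
proof -
  have "emeasure square_measure ({0..1} \<times> {0..1}) = emeasure unit_measure {0..1} * emeasure unit_measure {0..1}"
    by (rule unit.emeasure_pair_measure_Times) (auto simp: sets_restrict_space intro!: image_eqI[of _ _ "{0..1}"])
  then show ?thesis by (simp add: space_square emeasure_unit_space)
qed

interpretation square: finite_measure square_measure
  by standard (simp add: emeasure_square_space)

interpretation cube: product_sigma_finite "\<lambda>_. unit_measure"
  by standard

lemma cube_finite_measure: "finite V \<Longrightarrow> finite_measure (\<Pi>\<^sub>M v\<in>V. unit_measure)"
proof
  assume V: "finite V"
  have "emeasure (\<Pi>\<^sub>M v\<in>V. unit_measure) (PiE V (\<lambda>_. {0..1})) = (\<Prod>v\<in>V. emeasure unit_measure {0..1})"
    using sets.top[of unit_measure] by (intro cube.emeasure_PiM[OF V]) (simp add: space_unit)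
  then show "emeasure (\<Pi>\<^sub>M v\<in>V. unit_measure) (space (\<Pi>\<^sub>M v\<in>V. unit_measure)) \<noteq> \<infinity>"
    by (simp add: space_PiM space_unit emeasure_unit_space)
qed

text \<open>An edge sees only two coordinates of the cube, so integrals and null sets that involve one edge
  reduce to the square.\<close>

lemma distr_two_coordinates:
  assumes V: "finite V" "a \<in> V" "b \<in> V" "a \<noteq> b"
  shows "distr (\<Pi>\<^sub>M v\<in>V. unit_measure) square_measure (\<lambda>z. (z a, z b)) = square_measure"
proof (rule pair_measure_eqI[symmetric])
  show "sigma_finite_measure unit_measure" by standard
  then show "sigma_finite_measure unit_measure" .
  show "sets square_measure = sets (distr (\<Pi>\<^sub>M v\<in>V. unit_measure) square_measure (\<lambda>z. (z a, z b)))" by simp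
  fix A B assume A: "A \<in> sets unit_measure" and B: "B \<in> sets unit_measure"
  have m: "(\<lambda>z. (z a, z b)) \<in> (\<Pi>\<^sub>M v\<in>V. unit_measure) \<rightarrow>\<^sub>M square_measure"
    using V by (intro measurable_Pair measurable_component_singleton)
  have AB: "A \<times> B \<in> sets square_measure" using A B by auto
  define C where "C v = (if v = a then A else if v = b then B else {0..1})" for v
  have subs: "A \<subseteq> {0..1}" "B \<subseteq> {0..1}" using sets.sets_into_space[OF A] sets.sets_into_space[OF B] by (auto simp: space_unit)
  have pre: "(\<lambda>z. (z a, z b)) -` (A \<times> B) \<inter> space (\<Pi>\<^sub>M v\<in>V. unit_measure) = PiE V C"
    using V subs by (auto simp: space_PiM space_unit C_def PiE_iff subset_iff split: if_splits)
  have C: "C v \<in> sets unit_measure" for v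
    using A B sets.top[of unit_measure] by (auto simp: C_def space_unit)
  have "emeasure (distr (\<Pi>\<^sub>M v\<in>V. unit_measure) square_measure (\<lambda>z. (z a, z b))) (A \<times> B)
     = emeasure (\<Pi>\<^sub>M v\<in>V. unit_measure) (PiE V C)"
    by (simp add: emeasure_distr[OF m AB] pre)
  also have "\<dots> = (\<Prod>v\<in>V. emeasure unit_measure (C v))"
    using V(1) C by (intro cube.emeasure_PiM) auto
  also have "\<dots> = emeasure unit_measure (C a) * (emeasure unit_measure (C b) * (\<Prod>v\<in>V - {a} - {b}. emeasure unit_measure (C v)))"
    using V by (subst prod.remove[of V a], simp, simp) (subst prod.remove[of _ b], auto)
  also have "(\<Prod>v\<in>V - {a} - {b}. emeasure unit_measure (C v)) = 1"
    by (intro prod.neutral) (auto simp: C_def emeasure_unit_space)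
  finally show "emeasure unit_measure A * emeasure unit_measure B
    = emeasure (distr (\<Pi>\<^sub>M v\<in>V. unit_measure) square_measure (\<lambda>z. (z a, z b))) (A \<times> B)"
    using V(4) by (simp add: C_def)
qed

lemma measurable_two_coordinates:
  assumes "a \<in> V" "b \<in> V"
  shows "(\<lambda>z. (z a, z b)) \<in> (\<Pi>\<^sub>M v\<in>V. unit_measure) \<rightarrow>\<^sub>M square_measure"
  using assms by (intro measurable_Pair measurable_component_singleton)

lemma integral_two_coordinates:
  fixes h :: "real \<times> real \<Rightarrow> real"
  assumes V: "finite V" "a \<in> V" "b \<in> V" "a \<noteq> b" and h: "h \<in> borel_measurable square_measure"
  shows "(\<integral>z. h (z a, z b) \<partial>(\<Pi>\<^sub>M v\<in>V. unit_measure)) = integral\<^sup>L square_measure h"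
  using integral_distr[OF measurable_two_coordinates[OF V(2,3)] h] distr_two_coordinates[OF V] by simp

lemma AE_two_coordinates:
  assumes V: "finite V" "a \<in> V" "b \<in> V" "a \<noteq> b" and P: "AE p in square_measure. P p"
  shows "AE z in (\<Pi>\<^sub>M v\<in>V. unit_measure). P (z a, z b)"
proof -
  have "AE p in distr (\<Pi>\<^sub>M v\<in>V. unit_measure) square_measure (\<lambda>z. (z a, z b)). P p"
    unfolding distr_two_coordinates[OF V] by (rule P)
  then show ?thesis by (rule AE_distrD[OF measurable_two_coordinates[OF V(2,3)]])
qed

text \<open>The number of the cell that contains \<open>x\<close>. The minimum puts the point 1 into the last cell, so the
  cells form a partition of the closed interval.\<close>

definition idx :: "nat \<Rightarrow> real \<Rightarrow> nat" where
  "idx n x = min (n - 1) (nat \<lfloor>real n * x\<rfloor>)"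

lemma idx_less: "n > 0 \<Longrightarrow> idx n x < n"
  by (auto simp: idx_def)

lemma idx_eq_iff:
  assumes "n > 0" "i < n" "x \<in> {0..1}"
  shows "idx n x = i \<longleftrightarrow> real i \<le> real n * x \<and> (real n * x < real i + 1 \<or> i = n - 1)"
proof -
  have nx: "0 \<le> real n * x" using assms by auto
  have "nat \<lfloor>real n * x\<rfloor> = i \<longleftrightarrow> real i \<le> real n * x \<and> real n * x < real i + 1"
  proof -
    have "nat \<lfloor>real n * x\<rfloor> = i \<longleftrightarrow> \<lfloor>real n * x\<rfloor> = int i" using nx by (auto simp: nat_eq_iff)
    then show ?thesis by (simp add: floor_eq_iff)
  qed
  moreover have "nat \<lfloor>real n * x\<rfloor> \<ge> i \<longleftrightarrow> real i \<le> real n * x"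
    using nx by (simp add: le_nat_floor le_nat_iff le_floor_iff)
  ultimately show ?thesis unfolding idx_def using assms(2) by linarith
qed

lemma measurable_idx: "idx n \<in> unit_measure \<rightarrow>\<^sub>M count_space UNIV"
proof (rule measurable_restrict_space1)
  show "idx n \<in> lborel \<rightarrow>\<^sub>M count_space UNIV" unfolding idx_def[abs_def] by measurable
qed

lemma measure_cell:
  assumes "n > 0" "i < n"
  shows "measure unit_measure {x \<in> {0..1}. idx n x = i} = 1 / real n"
proof -
  let ?a = "real i / real n" and ?b = "(real i + 1) / real n"
  have ab: "?a \<le> ?b" "0 \<le> ?a" "?b \<le> 1"
    using assms by (auto simp: divide_simps)
  have "{x \<in> {0..1}. idx n x = i} = {?a..<?b} \<or> {x \<in> {0..1}. idx n x = i} = {?a..?b}"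
  proof (cases "i = n - 1")
    case True
    then have b1: "?b = 1" using assms by (simp add: of_nat_diff)
    have "x \<in> {0..1} \<and> idx n x = i \<longleftrightarrow> x \<in> {?a..?b}" for x
    proof
      assume "x \<in> {0..1} \<and> idx n x = i"
      then show "x \<in> {?a..?b}" using assms True by (auto simp: b1 idx_eq_iff pos_divide_le_eq mult.commute)
    next
      assume x: "x \<in> {?a..?b}"
      then have "?a \<le> x" "x \<le> ?b" by auto
      then have "x \<in> {0..1}" using ab(2,3) by (meson atLeastAtMost_iff order_trans)
      then show "x \<in> {0..1} \<and> idx n x = i"
        using x assms True by (auto simp: idx_eq_iff pos_divide_le_eq mult.commute)
    qed
    then show ?thesis by blast
  next
    case False
    have "x \<in> {0..1} \<and> idx n x = i \<longleftrightarrow> x \<in> {?a..<?b}" for x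
    proof
      assume "x \<in> {0..1} \<and> idx n x = i"
      then have "real i \<le> real n * x \<and> real n * x < real i + 1"
        using idx_eq_iff[OF assms, of x] False by blast
      then show "x \<in> {?a..<?b}" using assms(1) by (simp add: pos_divide_le_eq pos_less_divide_eq mult.commute)
    next
      assume x: "x \<in> {?a..<?b}"
      then have "?a \<le> x" "x \<le> ?b" by auto
      then have "x \<in> {0..1}" using ab(2,3) by (meson atLeastAtMost_iff order_trans)
      then show "x \<in> {0..1} \<and> idx n x = i"
        using x assms False by (auto simp: idx_eq_iff pos_divide_le_eq pos_less_divide_eq mult.commute)
    qed
    then show ?thesis by blast
  qed
  moreover have "measure unit_measure S = measure lborel S" if "S = {?a..<?b} \<or> S = {?a..?b}" for S
  proof (rule measure_restrict_space)
    show "S \<subseteq> {0..1}"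
    proof
      fix x assume "x \<in> S"
      then have "?a \<le> x" "x \<le> ?b" using that by auto
      then show "x \<in> {0..1}" using ab(2,3) by (meson atLeastAtMost_iff order_trans)
    qed
  qed auto
  moreover have "?b - ?a = 1 / real n" by (simp add: divide_simps)
  ultimately show ?thesis using ab(1) by fastforce
qed

section \<open>Approximation by step functions\<close>

definition cell :: "nat \<Rightarrow> nat \<Rightarrow> nat \<Rightarrow> (real \<times> real) set" where
  "cell n i j = {x \<in> {0..1}. idx n x = i} \<times> {y \<in> {0..1}. idx n y = j}"

definition cell_mean :: "(real \<times> real \<Rightarrow> real) \<Rightarrow> nat \<Rightarrow> nat \<Rightarrow> nat \<Rightarrow> real" where
  "cell_mean f n i j = (real n)\<^sup>2 * (\<integral>p. indicator (cell n i j) p * f p \<partial>square_measure)"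

text \<open>The conditional expectation of \<open>f\<close> with respect to the partition of the square into cells.\<close>

definition step :: "(real \<times> real \<Rightarrow> real) \<Rightarrow> nat \<Rightarrow> real \<times> real \<Rightarrow> real" where
  "step f n p = cell_mean f n (idx n (fst p)) (idx n (snd p))"

lemma strip_sets: "{x \<in> {0..1}. idx n x \<in> S} \<in> sets unit_measure"
  using measurable_sets[OF measurable_idx, of S n] by (simp add: space_unit vimage_def Int_def conj_commute)

lemma strip_sets_single: "{x \<in> {0..1}. idx n x = i} \<in> sets unit_measure"
  using strip_sets[of n "{i}"] by simp

lemma cell_sets [measurable]: "cell n i j \<in> sets square_measure"
  unfolding cell_def using strip_sets_single by (intro pair_measureI)

lemma measure_times:
  assumes "A \<in> sets unit_measure" "B \<in> sets unit_measure"
  shows "measure square_measure (A \<times> B) = measure unit_measure A * measure unit_measure B"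
  unfolding measure_def using unit.emeasure_pair_measure_Times[OF assms] by (simp add: enn2real_mult)

lemma measure_cell2: "n > 0 \<Longrightarrow> i < n \<Longrightarrow> j < n \<Longrightarrow> measure square_measure (cell n i j) = 1 / (real n)\<^sup>2"
  unfolding cell_def measure_times[OF strip_sets_single strip_sets_single] measure_cell by (simp add: measure_cell power2_eq_square)

lemma mem_cell: "p \<in> cell n i j \<longleftrightarrow> p \<in> unit_square \<and> idx n (fst p) = i \<and> idx n (snd p) = j"
  by (cases p) (auto simp: cell_def)

lemma sum_cells:
  assumes "n > 0" "p \<in> unit_square"
  shows "(\<Sum>i<n. \<Sum>j<n. indicator (cell n i j) p * (h :: real)) = h"
proof -
  have "(\<Sum>i<n. \<Sum>j<n. indicator (cell n i j) p * h)
     = (\<Sum>i<n. \<Sum>j<n. if idx n (fst p) = i then (if idx n (snd p) = j then h else 0) else 0)"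
    using assms(2) by (intro sum.cong refl) (auto simp: indicator_def mem_cell)
  also have "\<dots> = (\<Sum>i<n. if idx n (fst p) = i then h else 0)"
    using idx_less[OF assms(1), of "snd p"] by (intro sum.cong refl) (simp add: sum.delta')
  also have "\<dots> = h" using idx_less[OF assms(1), of "fst p"] by (simp add: sum.delta')
  finally show ?thesis .
qed

lemma integrable_ind_mult:
  fixes h :: "real \<times> real \<Rightarrow> real"
  assumes "integrable square_measure h" "A \<in> sets square_measure"
  shows "integrable square_measure (\<lambda>p. indicator A p * h p)"
  using integrable_mult_indicator[OF assms(2,1)] by simp

lemma integral_cells:
  fixes h :: "real \<times> real \<Rightarrow> real"
  assumes "n > 0" "integrable square_measure h"
  shows "integral\<^sup>L square_measure h = (\<Sum>i<n. \<Sum>j<n. \<integral>p. indicator (cell n i j) p * h p \<partial>square_measure)"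
proof -
  have "integral\<^sup>L square_measure h = (\<integral>p. (\<Sum>i<n. \<Sum>j<n. indicator (cell n i j) p * h p) \<partial>square_measure)"
    by (intro Bochner_Integration.integral_cong refl) (simp only: space_square sum_cells[OF assms(1)])
  also have "\<dots> = (\<Sum>i<n. \<Sum>j<n. \<integral>p. indicator (cell n i j) p * h p \<partial>square_measure)"
    by (subst Bochner_Integration.integral_sum, intro Bochner_Integration.integrable_sum integrable_ind_mult[OF assms(2) cell_sets])
       (intro sum.cong refl Bochner_Integration.integral_sum integrable_ind_mult[OF assms(2) cell_sets])
  finally show ?thesis .
qed

lemma integral_ind_const: "n > 0 \<Longrightarrow> i < n \<Longrightarrow> j < n \<Longrightarrow>
   (\<integral>p. indicator (cell n i j) p * c \<partial>square_measure) = c / (real n)\<^sup>2"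
  using measure_cell2[of n i j] cell_sets[of n i j] sets.sets_into_space[OF cell_sets[of n i j]]
  by (simp add: Int_absorb2)

lemma measurable_step: "step f n \<in> borel_measurable square_measure"
proof -
  have 1: "(\<lambda>p. idx n (fst p)) \<in> square_measure \<rightarrow>\<^sub>M count_space UNIV"
    by (rule measurable_compose[OF measurable_fst measurable_idx])
  have 2: "(\<lambda>p. idx n (snd p)) \<in> square_measure \<rightarrow>\<^sub>M count_space UNIV"
    by (rule measurable_compose[OF measurable_snd measurable_idx])
  have "(\<lambda>p. (idx n (fst p), idx n (snd p))) \<in> square_measure \<rightarrow>\<^sub>M count_space UNIV"
    using measurable_Pair[OF 1 2] by (simp add: pair_measure_countable)
  then have "(\<lambda>p. (\<lambda>(i, j). cell_mean f n i j) (idx n (fst p), idx n (snd p))) \<in> borel_measurable square_measure"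
    by (rule measurable_compose) simp
  then show ?thesis by (simp add: step_def[abs_def])
qed

lemma integrable_bounded:
  fixes h :: "real \<times> real \<Rightarrow> real"
  assumes "h \<in> borel_measurable square_measure" "\<And>p. p \<in> unit_square \<Longrightarrow> \<bar>h p\<bar> \<le> c"
  shows "integrable square_measure h"
  by (rule square.integrable_const_bound[of _ c]) (use assms in \<open>auto simp: space_square intro!: AE_I2\<close>)

lemma abs_ind: "\<bar>indicator A x * (y::real)\<bar> = indicator A x * \<bar>y\<bar>"
  by (simp add: abs_mult indicator_def)

text \<open>Up to a factor two, the mean is the best constant approximation on a cell.\<close>

lemma cell_deviation:
  assumes n: "n > 0" "i < n" "j < n" and f: "integrable square_measure f"
  shows "(\<integral>p. indicator (cell n i j) p * \<bar>f p - step f n p\<bar> \<partial>square_measure)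
     \<le> 2 * (\<integral>p. indicator (cell n i j) p * \<bar>f p - c\<bar> \<partial>square_measure)"
proof -
  let ?I = "\<lambda>p. indicator (cell n i j) p :: real"
  define d where "d = cell_mean f n i j"
  have int: "integrable square_measure (\<lambda>p. ?I p * \<bar>f p - e\<bar>)" for e
    using f by (intro integrable_ind_mult cell_sets integrable_abs Bochner_Integration.integrable_diff square.integrable_const)
  have intc: "integrable square_measure (\<lambda>p. ?I p * e)" for e
    by (intro integrable_ind_mult cell_sets square.integrable_const)
  have intf: "integrable square_measure (\<lambda>p. ?I p * f p)" using f by (intro integrable_ind_mult cell_sets)
  have "(\<integral>p. ?I p * \<bar>f p - step f n p\<bar> \<partial>square_measure) = (\<integral>p. ?I p * \<bar>f p - d\<bar> \<partial>square_measure)"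
    by (intro Bochner_Integration.integral_cong refl) (auto simp: step_def d_def indicator_def mem_cell)
  also have "\<dots> \<le> (\<integral>p. ?I p * \<bar>f p - c\<bar> + ?I p * \<bar>c - d\<bar> \<partial>square_measure)"
    using int intc by (intro integral_mono Bochner_Integration.integrable_add) (auto simp: indicator_def)
  also have "\<dots> = (\<integral>p. ?I p * \<bar>f p - c\<bar> \<partial>square_measure) + \<bar>c - d\<bar> / (real n)\<^sup>2"
    by (subst Bochner_Integration.integral_add[OF int intc]) (simp only: integral_ind_const[OF n])
  also have "\<bar>c - d\<bar> / (real n)\<^sup>2 = \<bar>\<integral>p. ?I p * (c - f p) \<partial>square_measure\<bar>"
  proof -
    have "(\<integral>p. ?I p * (c - f p) \<partial>square_measure) = (\<integral>p. ?I p * c - ?I p * f p \<partial>square_measure)"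
      by (simp add: right_diff_distrib)
    also have "\<dots> = c / (real n)\<^sup>2 - (\<integral>p. ?I p * f p \<partial>square_measure)"
      by (subst Bochner_Integration.integral_diff[OF intc intf]) (simp only: integral_ind_const[OF n])
    also have "\<dots> = (c - d) / (real n)\<^sup>2"
      using n by (simp add: d_def cell_mean_def field_simps)
    finally show ?thesis by simp
  qed
  also have "\<dots> \<le> (\<integral>p. \<bar>?I p * (c - f p)\<bar> \<partial>square_measure)"
    by (rule integral_abs_bound)
  also have "\<dots> = (\<integral>p. ?I p * \<bar>f p - c\<bar> \<partial>square_measure)"
    by (intro Bochner_Integration.integral_cong refl) (simp add: abs_ind abs_minus_commute)
  finally show ?thesis by simp
qed

text \<open>A measurable function is the limit of continuous functions outside a null set. Clipping these to the
  range of \<open>f\<close> allows dominated convergence.\<close>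

lemma continuous_approximation:
  fixes f :: "real \<times> real \<Rightarrow> real"
  assumes f: "f \<in> borel_measurable square_measure" "\<And>p. 0 \<le> f p" "\<And>p. f p \<le> 2" and d: "d > 0"
  obtains g where "continuous_on UNIV g" "\<And>p. 0 \<le> g p \<and> g p \<le> 2" "(\<integral>p. \<bar>f p - g p\<bar> \<partial>square_measure) < d"
proof -
  let ?F = "\<lambda>p. indicator unit_square p * f p"
  have Q: "unit_square \<in> sets borel" by (intro borel_closed closed_Times) auto
  have "?F \<in> borel_measurable lborel"
    using f(1) Q unfolding square_measure_eq by (subst (asm) borel_measurable_restrict_space_iff) auto
  then have "?F \<in> borel_measurable lebesgue" by (rule measurable_completion)
  then have "?F measurable_on UNIV"
    by (intro lebesgue_measurable_imp_measurable_on) auto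
  then obtain N h where N: "negligible N" and h: "\<And>k. continuous_on UNIV (h k)"
    and lim: "\<And>p. p \<notin> N \<Longrightarrow> (\<lambda>k. h k p) \<longlonglongrightarrow> ?F p"
    unfolding measurable_on_def by auto
  define g where "g k p = max 0 (min 2 (h k p))" for k p
  have gc: "continuous_on UNIV (g k)" for k
    unfolding g_def[abs_def] by (intro continuous_intros h)
  have gb: "0 \<le> g k p \<and> g k p \<le> 2" for k p by (simp add: g_def)
  have gm: "g k \<in> borel_measurable square_measure" for k
    unfolding square_measure_eq using borel_measurable_continuous_onI[OF gc] by (simp add: measurable_restrict_space1)
  have "AE p in lebesgue. p \<notin> N"
    using N by (intro AE_not_in) (simp add: negligible_iff_null_sets)
  then have "AE p in lborel. p \<notin> N" by (simp add: AE_completion_iff)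
  then have AE: "AE p in square_measure. p \<notin> N"
    unfolding square_measure_eq using Q by (subst AE_restrict_space_iff) auto
  have limg: "(\<lambda>k. \<bar>f p - g k p\<bar>) \<longlonglongrightarrow> 0" if p: "p \<notin> N" "p \<in> unit_square" for p
  proof -
    have "(\<lambda>k. h k p) \<longlonglongrightarrow> f p" using lim[OF p(1)] p(2) by simp
    then have "(\<lambda>k. g k p) \<longlonglongrightarrow> max 0 (min 2 (f p))" unfolding g_def by (intro tendsto_intros)
    then have "(\<lambda>k. g k p) \<longlonglongrightarrow> f p" using f(2,3)[of p] by (simp add: max_def min_def)
    then have "(\<lambda>k. \<bar>f p - g k p\<bar>) \<longlonglongrightarrow> \<bar>f p - f p\<bar>" by (intro tendsto_intros)
    then show ?thesis by simp
  qed
  have "(\<lambda>k. \<integral>p. \<bar>f p - g k p\<bar> \<partial>square_measure) \<longlonglongrightarrow> (\<integral>p. 0 \<partial>square_measure)"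
  proof (rule integral_dominated_convergence[where w="\<lambda>_. 2"])
    show "AE p in square_measure. (\<lambda>k. \<bar>f p - g k p\<bar>) \<longlonglongrightarrow> 0"
      using AE AE_space by eventually_elim (use limg in \<open>auto simp: space_square\<close>)
    show "AE p in square_measure. norm \<bar>f p - g k p\<bar> \<le> 2" for k
    proof (intro AE_I2)
      fix p show "norm \<bar>f p - g k p\<bar> \<le> 2" using f(2)[of p] f(3)[of p] gb[of k p] by (simp add: abs_le_iff)
    qed
  qed (use f(1) gm in auto)
  then have "eventually (\<lambda>k. (\<integral>p. \<bar>f p - g k p\<bar> \<partial>square_measure) < d) sequentially"
    using d by (intro order_tendstoD) auto
  then obtain k where "(\<integral>p. \<bar>f p - g k p\<bar> \<partial>square_measure) < d"
    by (auto simp: eventually_sequentially)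
  then show ?thesis using that[of "g k"] gc gb by blast
qed

text \<open>A uniformly continuous \<open>g\<close> close to \<open>f\<close> is nearly constant on small cells, so in the mean \<open>f\<close> is
  close to constants on the cells, and then also to its cell means.\<close>

theorem step_approximation:
  fixes f :: "real \<times> real \<Rightarrow> real"
  assumes f: "f \<in> borel_measurable square_measure" "\<And>p. 0 \<le> f p" "\<And>p. f p \<le> 2" and d: "d > 0"
  obtains n where "n > 0" "(\<integral>p. \<bar>f p - step f n p\<bar> \<partial>square_measure) \<le> d"
proof -
  obtain g where g: "continuous_on UNIV g" "\<And>p. 0 \<le> g p \<and> g p \<le> 2" "(\<integral>p. \<bar>f p - g p\<bar> \<partial>square_measure) < d / 4"
    using continuous_approximation[OF f, of "d / 4"] d by auto
  have "uniformly_continuous_on unit_square g"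
    by (intro compact_uniformly_continuous compact_Times continuous_on_subset[OF g(1)]) auto
  then obtain r where r: "r > 0" "\<And>p p'. p \<in> unit_square \<Longrightarrow> p' \<in> unit_square \<Longrightarrow> dist p' p < r \<Longrightarrow> dist (g p') (g p) < d / 4"
    unfolding uniformly_continuous_on_def using d by (metis divide_pos_pos zero_less_numeral)
  obtain n0 where n0: "2 / r < real n0" using reals_Archimedean2 by blast
  define n where "n = Suc n0"
  have n: "n > 0" by (simp add: n_def)
  have rn: "2 / real n < r"
  proof -
    have "2 / r < real n" using n0 by (simp add: n_def)
    then show ?thesis using r(1) n by (simp add: field_simps)
  qed
  define c where "c i j = g (real i / real n, real j / real n)" for i j
  have near: "\<bar>g p - c i j\<bar> \<le> d / 4" if ij: "i < n" "j < n" and p: "p \<in> cell n i j" for i j p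
  proof -
    have coord: "\<bar>x - real k / real n\<bar> \<le> 1 / real n" "real k / real n \<in> {0..1}"
      if "k < n" "x \<in> {0..1}" "idx n x = k" for x k
    proof -
      have "real k \<le> real n * x" "real n * x \<le> real k + 1"
        using idx_eq_iff[OF n that(1,2)] that n by (auto simp: of_nat_diff mult_left_le)
      then have "real k / real n \<le> x" "x \<le> (real k + 1) / real n"
        using n by (simp_all add: pos_divide_le_eq pos_le_divide_eq mult.commute)
      then show "\<bar>x - real k / real n\<bar> \<le> 1 / real n" by (simp add: add_divide_distrib)
      show "real k / real n \<in> {0..1}" using that(1) n by simp
    qed
    obtain x y where xy: "p = (x, y)" "x \<in> {0..1}" "y \<in> {0..1}" "idx n x = i" "idx n y = j"
      using p by (cases p) (auto simp: cell_def)
    have "dist p (real i / real n, real j / real n) \<le> \<bar>x - real i / real n\<bar> + \<bar>y - real j / real n\<bar>"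
      unfolding xy(1) dist_Pair_Pair dist_real_def using sqrt_sum_squares_le_sum_abs[of "x - real i / real n" "y - real j / real n"] by simp
    also have "\<dots> \<le> 1 / real n + 1 / real n"
      by (intro add_mono coord) (use ij xy in auto)
    also have "\<dots> < r" using rn by simp
    finally have "dist (g p) (c i j) < d / 4"
      unfolding c_def using coord(2)[OF ij(1) xy(2,4)] coord(2)[OF ij(2) xy(3,5)] xy
      by (intro r(2)) auto
    then show ?thesis by (simp add: dist_real_def)
  qed
  have gm: "g \<in> borel_measurable square_measure"
    unfolding square_measure_eq using borel_measurable_continuous_onI[OF g(1)] by (simp add: measurable_restrict_space1)
  have fi: "integrable square_measure f" by (rule integrable_bounded[OF f(1), of 2]) (use f in auto)
  have gi: "integrable square_measure g" by (rule integrable_bounded[OF gm, of 2]) (use g(2) in auto)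
  have fg: "integrable square_measure (\<lambda>p. \<bar>f p - g p\<bar>)" using fi gi by auto
  have stepb: "integrable square_measure (step f n)"
  proof (rule integrable_bounded[OF measurable_step])
    fix p
    have "\<bar>cell_mean f n i j\<bar> \<le> (\<Sum>i<n. \<Sum>j<n. \<bar>cell_mean f n i j\<bar>)" if "i < n" "j < n" for i j
    proof -
      have "\<bar>cell_mean f n i j\<bar> \<le> (\<Sum>j<n. \<bar>cell_mean f n i j\<bar>)" using that by (intro member_le_sum) auto
      also have "\<dots> \<le> (\<Sum>i<n. \<Sum>j<n. \<bar>cell_mean f n i j\<bar>)"
        using that by (intro member_le_sum[of i "{..<n}" "\<lambda>i. \<Sum>j<n. \<bar>cell_mean f n i j\<bar>"]) (auto intro: sum_nonneg)
      finally show ?thesis .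
    qed
    then show "\<bar>step f n p\<bar> \<le> (\<Sum>i<n. \<Sum>j<n. \<bar>cell_mean f n i j\<bar>)"
      unfolding step_def by (simp add: idx_less n)
  qed
  have "(\<integral>p. \<bar>f p - step f n p\<bar> \<partial>square_measure)
      = (\<Sum>i<n. \<Sum>j<n. \<integral>p. indicator (cell n i j) p * \<bar>f p - step f n p\<bar> \<partial>square_measure)"
    using fi stepb by (intro integral_cells[OF n]) auto
  also have "\<dots> \<le> (\<Sum>i<n. \<Sum>j<n. 2 * (\<integral>p. indicator (cell n i j) p * \<bar>f p - c i j\<bar> \<partial>square_measure))"
    by (intro sum_mono cell_deviation[OF n _ _ fi]) auto
  also have "\<dots> \<le> (\<Sum>i<n. \<Sum>j<n. 2 * (\<integral>p. indicator (cell n i j) p * (\<bar>f p - g p\<bar> + d / 4) \<partial>square_measure))"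
  proof (intro sum_mono, rule mult_left_mono, rule integral_mono)
    fix i j assume ij: "i \<in> {..<n}" "j \<in> {..<n}"
    show "integrable square_measure (\<lambda>p. indicator (cell n i j) p * \<bar>f p - c i j\<bar>)"
      using fi by (intro integrable_ind_mult cell_sets integrable_abs Bochner_Integration.integrable_diff square.integrable_const)
    show "integrable square_measure (\<lambda>p. indicator (cell n i j) p * (\<bar>f p - g p\<bar> + d / 4))"
      using fg by (intro integrable_ind_mult cell_sets Bochner_Integration.integrable_add square.integrable_const)
    fix p
    show "indicator (cell n i j) p * \<bar>f p - c i j\<bar> \<le> indicator (cell n i j) p * (\<bar>f p - g p\<bar> + d / 4)"
    proof (cases "p \<in> cell n i j")
      case True
      have "\<bar>f p - c i j\<bar> \<le> \<bar>f p - g p\<bar> + \<bar>g p - c i j\<bar>" by simp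
      also have "\<bar>g p - c i j\<bar> \<le> d / 4" using near True ij by simp
      finally show ?thesis using True by simp
    qed simp
  qed auto
  also have "\<dots> = 2 * (\<Sum>i<n. \<Sum>j<n. \<integral>p. indicator (cell n i j) p * (\<bar>f p - g p\<bar> + d / 4) \<partial>square_measure)"
    by (simp only: sum_distrib_left)
  also have "\<dots> = 2 * (\<integral>p. \<bar>f p - g p\<bar> + d / 4 \<partial>square_measure)"
    using fg by (subst integral_cells[OF n]) auto
  also have "\<dots> = 2 * ((\<integral>p. \<bar>f p - g p\<bar> \<partial>square_measure) + d / 4)"
    using fg emeasure_square_space by (subst Bochner_Integration.integral_add) (auto simp: measure_def)
  also have "\<dots> \<le> d" using g(3) by simp
  finally show ?thesis using that n by blast
qed

section \<open>From finite averages to integrals\<close>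

text \<open>A function of the cell numbers of the coordinates is integrated by summing over all assignments of
  cell numbers, which are equally likely.\<close>

lemma integral_idx_cube:
  fixes G :: "('v \<Rightarrow> nat) \<Rightarrow> real"
  assumes V: "finite V" and n: "n > 0" and G: "\<And>y y'. (\<And>v. v \<in> V \<Longrightarrow> y v = y' v) \<Longrightarrow> G y = G y'"
  shows "(\<integral>z. G (\<lambda>v. idx n (z v)) \<partial>(\<Pi>\<^sub>M v\<in>V. unit_measure)) = Av n V G z0"
proof -
  let ?mu = "\<Pi>\<^sub>M v\<in>V. unit_measure" and ?Y = "PiE V (\<lambda>_. {..<n})"
  let ?I = "\<lambda>i x. indicator {x \<in> {0..1}. idx n x = i} x :: real"
  have finY: "finite ?Y" using V by (intro finite_PiE) auto
  have int1: "integrable unit_measure (?I i)" for i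
    using strip_sets_single[of n i] by (intro integrable_real_indicator) (auto simp: unit.emeasure_eq_measure)
  have val: "integral\<^sup>L unit_measure (?I i) = 1 / real n" if "i < n" for i
    using measure_cell[OF n that] strip_sets_single[of n i] sets.sets_into_space[OF strip_sets_single[of n i]]
    by (simp add: Int_absorb2)
  have eq: "G (\<lambda>v. idx n (z v)) = (\<Sum>y\<in>?Y. G y * (\<Prod>v\<in>V. ?I (y v) (z v)))" if z: "z \<in> space ?mu" for z
  proof -
    have z01: "z v \<in> {0..1}" if "v \<in> V" for v using z that by (auto simp: space_PiM space_unit)
    define y0 where "y0 = restrict (\<lambda>v. idx n (z v)) V"
    have y0: "y0 \<in> ?Y" using n by (auto simp: y0_def idx_less)
    have pr: "(\<Prod>v\<in>V. ?I (y v) (z v)) = (if y = y0 then 1 else 0)" if y: "y \<in> ?Y" for y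
    proof (cases "y = y0")
      case True
      have "?I (y v) (z v) = 1" if "v \<in> V" for v using that z01 True by (simp add: y0_def)
      then show ?thesis using True by simp
    next
      case False
      then obtain v where v: "y v \<noteq> y0 v" by blast
      then have "v \<in> V" using y y0 by (metis PiE_arb)
      then have "?I (y v) (z v) = 0" using v by (simp add: y0_def indicator_def)
      then have "(\<Prod>v\<in>V. ?I (y v) (z v)) = 0" using V \<open>v \<in> V\<close> by (metis (mono_tags, lifting) prod_zero)
      then show ?thesis using False by simp
    qed
    have "(\<Sum>y\<in>?Y. G y * (\<Prod>v\<in>V. ?I (y v) (z v))) = (\<Sum>y\<in>?Y. if y = y0 then G y else 0)"
    proof (intro sum.cong refl)
      fix y assume "y \<in> ?Y"
      from pr[OF this] show "G y * (\<Prod>v\<in>V. ?I (y v) (z v)) = (if y = y0 then G y else 0)"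
        by (simp only: mult_1_right mult_zero_right if_distrib[of "(*) (G y)"])
    qed
    also have "\<dots> = G y0" using finY y0 by (simp add: sum.delta)
    also have "G y0 = G (\<lambda>v. idx n (z v))" by (rule G) (simp add: y0_def)
    finally show ?thesis by simp
  qed
  have ip: "integrable ?mu (\<lambda>z. \<Prod>v\<in>V. ?I (y v) (z v))" for y
    by (rule cube.product_integrable_prod[OF V int1])
  have "(\<integral>z. G (\<lambda>v. idx n (z v)) \<partial>?mu) = (\<integral>z. (\<Sum>y\<in>?Y. G y * (\<Prod>v\<in>V. ?I (y v) (z v))) \<partial>?mu)"
    by (intro Bochner_Integration.integral_cong refl eq)
  also have "\<dots> = (\<Sum>y\<in>?Y. G y * (\<integral>z. (\<Prod>v\<in>V. ?I (y v) (z v)) \<partial>?mu))"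
    using ip by (subst Bochner_Integration.integral_sum) auto
  also have "\<dots> = (\<Sum>y\<in>?Y. G y * (1 / real n) ^ card V)"
  proof (intro sum.cong refl arg_cong2[of _ _ _ _ "(*)"])
    fix y assume y: "y \<in> ?Y"
    have "(\<integral>z. (\<Prod>v\<in>V. ?I (y v) (z v)) \<partial>?mu) = (\<Prod>v\<in>V. integral\<^sup>L unit_measure (?I (y v)))"
      by (rule cube.product_integral_prod[OF V int1])
    also have "\<dots> = (\<Prod>v\<in>V. 1 / real n)" using y by (intro prod.cong refl val) auto
    finally show "(\<integral>z. (\<Prod>v\<in>V. ?I (y v) (z v)) \<partial>?mu) = (1 / real n) ^ card V" by simp
  qed
  also have "\<dots> = Av n V G z0"
  proof -
    have "G (override_on z0 y V) = G y" for y by (rule G) simp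
    then show ?thesis by (simp add: Av_def power_one_over sum_divide_distrib)
  qed
  finally show ?thesis .
qed

text \<open>The worst weights are the signs of the coefficients. The positive and the negative coefficients are
  two sets of indices.\<close>

lemma weighted_sum_le:
  fixes c p :: "nat \<Rightarrow> real"
  assumes k: "\<And>S. S \<subseteq> {..<n} \<Longrightarrow> \<bar>\<Sum>x\<in>S. c x\<bar> \<le> k" and p: "\<And>x. \<bar>p x\<bar> \<le> 1"
  shows "\<bar>\<Sum>x<n. c x * p x\<bar> \<le> 2 * k"
proof -
  let ?P = "{x\<in>{..<n}. 0 \<le> c x}" and ?N = "{x\<in>{..<n}. c x < 0}"
  have "\<bar>\<Sum>x<n. c x * p x\<bar> \<le> (\<Sum>x<n. \<bar>c x * p x\<bar>)" by (rule sum_abs)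
  also have "\<dots> \<le> (\<Sum>x<n. \<bar>c x\<bar>)"
    using p by (intro sum_mono) (simp add: abs_mult mult_left_le)
  also have "\<dots> = (\<Sum>x\<in>?P. \<bar>c x\<bar>) + (\<Sum>x\<in>?N. \<bar>c x\<bar>)"
    by (subst sum.union_disjoint[symmetric]) (auto intro!: sum.cong)
  also have "(\<Sum>x\<in>?P. \<bar>c x\<bar>) = (\<Sum>x\<in>?P. c x)" by (intro sum.cong) auto
  also have "(\<Sum>x\<in>?N. \<bar>c x\<bar>) = - (\<Sum>x\<in>?N. c x)" by (simp add: sum_negf[symmetric])
  also have "(\<Sum>x\<in>?P. c x) + - (\<Sum>x\<in>?N. c x) \<le> k + k"
  proof -
    have "?P \<subseteq> {..<n}" "?N \<subseteq> {..<n}" by auto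
    from k[OF this(1)] k[OF this(2)] show ?thesis by linarith
  qed
  finally show ?thesis by simp
qed

lemma weighted_double_sum_le:
  fixes A :: "nat \<Rightarrow> nat \<Rightarrow> real"
  assumes k: "\<And>S T. S \<subseteq> {..<n} \<Longrightarrow> T \<subseteq> {..<n} \<Longrightarrow> \<bar>\<Sum>x\<in>S. \<Sum>y\<in>T. A x y\<bar> \<le> k"
    and p: "\<And>x. \<bar>p x\<bar> \<le> 1" and q: "\<And>y. \<bar>q y\<bar> \<le> 1"
  shows "\<bar>\<Sum>x<n. \<Sum>y<n. A x y * p x * q y\<bar> \<le> 4 * k"
proof -
  have "\<bar>\<Sum>x\<in>S. \<Sum>y<n. A x y * q y\<bar> \<le> 2 * k" if S: "S \<subseteq> {..<n}" for S
  proof -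
    have "(\<Sum>x\<in>S. \<Sum>y<n. A x y * q y) = (\<Sum>y<n. (\<Sum>x\<in>S. A x y) * q y)"
      by (subst sum.swap) (simp add: sum_distrib_right)
    also have "\<bar>\<dots>\<bar> \<le> 2 * k"
      using k[OF S] by (intro weighted_sum_le[OF _ q]) (subst sum.swap, simp)
    finally show ?thesis .
  qed
  then have "\<bar>\<Sum>x<n. (\<Sum>y<n. A x y * q y) * p x\<bar> \<le> 2 * (2 * k)" by (rule weighted_sum_le[OF _ p])
  moreover have "(\<Sum>x<n. (\<Sum>y<n. A x y * q y) * p x) = (\<Sum>x<n. \<Sum>y<n. A x y * p x * q y)"
    by (simp add: sum_distrib_left sum_distrib_right mult_ac)
  ultimately show ?thesis by simp
qed

text \<open>After division by two all factors are at most one, and replacing them one at a time is nonexpansive.\<close>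

lemma prod_diff_le:
  fixes a b :: "'e \<Rightarrow> real"
  assumes "finite E" "\<And>e. e \<in> E \<Longrightarrow> 0 \<le> a e \<and> a e \<le> 2" "\<And>e. e \<in> E \<Longrightarrow> 0 \<le> b e \<and> b e \<le> 2"
  shows "\<bar>(\<Prod>e\<in>E. a e) - (\<Prod>e\<in>E. b e)\<bar> \<le> 2 ^ card E * (\<Sum>e\<in>E. \<bar>a e - b e\<bar>)"
proof -
  have "\<bar>(\<Prod>e\<in>E. a e / 2) - (\<Prod>e\<in>E. b e / 2)\<bar> \<le> (\<Sum>e\<in>E. \<bar>a e / 2 - b e / 2\<bar>)"
    using norm_prod_diff[of E "\<lambda>e. a e / 2" "\<lambda>e. b e / 2"] assms by simp
  also have "\<dots> \<le> (\<Sum>e\<in>E. \<bar>a e - b e\<bar>)"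
    by (intro sum_mono) (simp add: diff_divide_distrib[symmetric])
  finally have *: "\<bar>(\<Prod>e\<in>E. a e / 2) - (\<Prod>e\<in>E. b e / 2)\<bar> \<le> (\<Sum>e\<in>E. \<bar>a e - b e\<bar>)" .
  have "(\<Prod>e\<in>E. c e) = 2 ^ card E * (\<Prod>e\<in>E. c e / 2)" for c :: "'e \<Rightarrow> real"
    using assms(1) by (simp add: prod_dividef)
  then have "\<bar>(\<Prod>e\<in>E. a e) - (\<Prod>e\<in>E. b e)\<bar> = 2 ^ card E * \<bar>(\<Prod>e\<in>E. a e / 2) - (\<Prod>e\<in>E. b e / 2)\<bar>"
    by (metis abs_mult abs_numeral power_abs right_diff_distrib)
  then show ?thesis using * by (simp add: mult_left_mono)
qed

text \<open>Outside the range of cell numbers the kernel is zero, so that its bound holds for all indices.\<close>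

definition cell_kernel :: "(real \<times> real \<Rightarrow> real) \<Rightarrow> nat \<Rightarrow> nat \<Rightarrow> nat \<Rightarrow> real" where
  "cell_kernel f n i j = (if i < n \<and> j < n then cell_mean f n i j - 1 else 0)"

lemma cell_mean_range:
  assumes n: "n > 0" "i < n" "j < n" and f: "integrable square_measure f" "\<And>p. 0 \<le> f p" "\<And>p. f p \<le> 2"
  shows "0 \<le> cell_mean f n i j" "cell_mean f n i j \<le> 2"
proof -
  show "0 \<le> cell_mean f n i j"
    unfolding cell_mean_def using f(2) by (intro mult_nonneg_nonneg Bochner_Integration.integral_nonneg) auto
  have "(\<integral>p. indicator (cell n i j) p * f p \<partial>square_measure) \<le> (\<integral>p. indicator (cell n i j) p * 2 \<partial>square_measure)"
    by (intro integral_mono integrable_ind_mult f(1) cell_sets square.integrable_const)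
       (use f(3) in \<open>auto simp: indicator_def\<close>)
  also have "\<dots> = 2 / (real n)\<^sup>2" by (rule integral_ind_const[OF n])
  finally have "(real n)\<^sup>2 * (\<integral>p. indicator (cell n i j) p * f p \<partial>square_measure) \<le> (real n)\<^sup>2 * (2 / (real n)\<^sup>2)"
    by (rule mult_left_mono) simp
  then show "cell_mean f n i j \<le> 2" using n(1) by (simp add: cell_mean_def)
qed

text \<open>A union of cells is a rectangle over unions of intervals, which turns a bound for rectangles into one
  for submatrices.\<close>

lemma sum_cell_kernel:
  assumes n: "n > 0" and f: "integrable square_measure f" and S: "S \<subseteq> {..<n}" "T \<subseteq> {..<n}"
  shows "(\<Sum>i\<in>S. \<Sum>j\<in>T. cell_kernel f n i j)
    = (real n)\<^sup>2 * (\<integral>p. indicator ({x \<in> {0..1}. idx n x \<in> S} \<times> {y \<in> {0..1}. idx n y \<in> T}) p * (f p - 1) \<partial>square_measure)"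
proof -
  let ?I = "\<lambda>i j p. indicator (cell n i j) p * (f p - 1) :: real"
  have fST: "finite S" "finite T" using S by (auto intro: finite_subset)
  have f1: "integrable square_measure (\<lambda>p. f p - 1)"
    by (intro Bochner_Integration.integrable_diff f square.integrable_const)
  have int: "integrable square_measure (?I i j)" for i j
    by (intro integrable_ind_mult cell_sets f1)
  have K: "cell_kernel f n i j = (real n)\<^sup>2 * integral\<^sup>L square_measure (?I i j)" if "i \<in> S" "j \<in> T" for i j
  proof -
    have ij: "i < n" "j < n" using that S by auto
    have "integral\<^sup>L square_measure (?I i j) = (\<integral>p. indicator (cell n i j) p * f p - indicator (cell n i j) p * 1 \<partial>square_measure)"
      by (simp add: right_diff_distrib)
    also have "\<dots> = (\<integral>p. indicator (cell n i j) p * f p \<partial>square_measure) - (\<integral>p. indicator (cell n i j) p * 1 \<partial>square_measure)"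
      by (intro Bochner_Integration.integral_diff integrable_ind_mult cell_sets f square.integrable_const)
    also have "\<dots> = (\<integral>p. indicator (cell n i j) p * f p \<partial>square_measure) - 1 / (real n)\<^sup>2"
      by (simp only: integral_ind_const[OF n ij])
    finally show ?thesis using ij n by (simp add: cell_kernel_def cell_mean_def right_diff_distrib)
  qed
  have "(\<Sum>i\<in>S. \<Sum>j\<in>T. cell_kernel f n i j) = (real n)\<^sup>2 * (\<Sum>i\<in>S. \<Sum>j\<in>T. integral\<^sup>L square_measure (?I i j))"
    unfolding sum_distrib_left by (intro sum.cong refl K)
  also have "(\<Sum>i\<in>S. \<Sum>j\<in>T. integral\<^sup>L square_measure (?I i j)) = (\<integral>p. (\<Sum>i\<in>S. \<Sum>j\<in>T. ?I i j p) \<partial>square_measure)"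
    by (subst Bochner_Integration.integral_sum, intro Bochner_Integration.integrable_sum int)
       (intro sum.cong refl Bochner_Integration.integral_sum[symmetric] int)
  also have "\<dots> = (\<integral>p. indicator ({x \<in> {0..1}. idx n x \<in> S} \<times> {y \<in> {0..1}. idx n y \<in> T}) p * (f p - 1) \<partial>square_measure)"
  proof (intro Bochner_Integration.integral_cong refl)
    fix p assume "p \<in> space square_measure"
    then have p: "p \<in> unit_square" by (simp only: space_square)
    have "(\<Sum>i\<in>S. \<Sum>j\<in>T. ?I i j p)
       = (\<Sum>i\<in>S. \<Sum>j\<in>T. if i = idx n (fst p) then (if j = idx n (snd p) then f p - 1 else 0) else 0)"
      using p by (intro sum.cong refl) (auto simp: indicator_def mem_cell)
    also have "\<dots> = (\<Sum>i\<in>S. if i = idx n (fst p) then (if idx n (snd p) \<in> T then f p - 1 else 0) else 0)"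
      using fST by (intro sum.cong refl) (simp add: sum.delta)
    also have "\<dots> = (if idx n (fst p) \<in> S then (if idx n (snd p) \<in> T then f p - 1 else 0) else 0)"
      using fST by (simp add: sum.delta)
    also have "\<dots> = indicator ({x \<in> {0..1}. idx n x \<in> S} \<times> {y \<in> {0..1}. idx n y \<in> T}) p * (f p - 1)"
      using p by (cases p) (auto simp: indicator_def)
    finally show "(\<Sum>i\<in>S. \<Sum>j\<in>T. ?I i j p) = indicator ({x \<in> {0..1}. idx n x \<in> S} \<times> {y \<in> {0..1}. idx n y \<in> T}) p * (f p - 1)" .
  qed
  finally show ?thesis .
qed

text \<open>The constant 4 comes from replacing sets by weights in \<open>[-1, 1]\<close> in each of the two variables.\<close>

lemma cell_kernel_signed_kernel:
  assumes n: "n > 0" and f: "f \<in> borel_measurable square_measure" "\<And>p. 0 \<le> f p" "\<And>p. f p \<le> 2"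
    and mean: "integral\<^sup>L square_measure f = 1"
    and cut: "\<And>A B. A \<in> sets unit_measure \<Longrightarrow> B \<in> sets unit_measure \<Longrightarrow>
       \<bar>\<integral>p. indicator (A \<times> B) p * (f p - 1) \<partial>square_measure\<bar> \<le> eps"
  shows "signed_kernel n (cell_kernel f n) (4 * eps)"
proof
  have fi: "integrable square_measure f" by (rule integrable_bounded[OF f(1), of 2]) (use f in auto)
  show "0 < n" by fact
  show "\<bar>cell_kernel f n x y\<bar> \<le> 1" for x y
    using cell_mean_range[OF n _ _ fi f(2,3), of x y] by (auto simp: cell_kernel_def)
  have tot: "avg n (\<lambda>x. avg n (\<lambda>y. A x y)) = (\<Sum>x<n. \<Sum>y<n. A x y) / (real n)\<^sup>2" for A
    by (simp add: avg_def sum_divide_distrib[symmetric] power2_eq_square)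
  have "(\<Sum>x<n. \<Sum>y<n. cell_kernel f n x y)
     = (real n)\<^sup>2 * (\<integral>p. indicator ({x \<in> {0..1}. idx n x \<in> {..<n}} \<times> {y \<in> {0..1}. idx n y \<in> {..<n}}) p * (f p - 1) \<partial>square_measure)"
    by (rule sum_cell_kernel[OF n fi]) auto
  also have "(\<integral>p. indicator ({x \<in> {0..1}. idx n x \<in> {..<n}} \<times> {y \<in> {0..1}. idx n y \<in> {..<n}}) p * (f p - 1) \<partial>square_measure)
     = (\<integral>p. f p - 1 \<partial>square_measure)"
    by (intro Bochner_Integration.integral_cong refl) (auto simp: space_square idx_less[OF n])
  also have "\<dots> = 0"
    using mean emeasure_square_space fi by (subst Bochner_Integration.integral_diff) (auto simp: measure_def)
  finally show "avg n (\<lambda>x. avg n (\<lambda>y. cell_kernel f n x y)) = 0" by (simp add: tot)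
  fix p q :: "nat \<Rightarrow> real" assume pq: "\<And>x. \<bar>p x\<bar> \<le> 1" "\<And>y. \<bar>q y\<bar> \<le> 1"
  have "\<bar>\<Sum>x\<in>S. \<Sum>y\<in>T. cell_kernel f n x y\<bar> \<le> (real n)\<^sup>2 * eps" if "S \<subseteq> {..<n}" "T \<subseteq> {..<n}" for S T
    unfolding sum_cell_kernel[OF n fi that] abs_mult abs_power2
    by (intro mult_left_mono cut strip_sets) auto
  from weighted_double_sum_le[OF this pq]
  have "\<bar>\<Sum>x<n. \<Sum>y<n. cell_kernel f n x y * p x * q y\<bar> \<le> 4 * ((real n)\<^sup>2 * eps)" .
  then show "\<bar>avg n (\<lambda>x. avg n (\<lambda>y. cell_kernel f n x y * p x * q y))\<bar> \<le> 4 * eps"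
    unfolding tot using n by (simp add: pos_divide_le_eq mult_ac)
qed

text \<open>For each grid the step function has density at least 1 by the inequality for matrices. Its density
  differs from that of \<open>f\<close> by at most a constant times the \<open>L\<^sup>1\<close> distance, which is arbitrarily small.\<close>

theorem square_density_ge_1:
  fixes f :: "real \<times> real \<Rightarrow> real" and l r :: "'e \<Rightarrow> 'v"
  assumes f: "f \<in> borel_measurable square_measure" "\<And>p. 0 \<le> f p" "\<And>p. f p \<le> 2"
    and mean: "integral\<^sup>L square_measure f = 1"
    and cut: "\<And>A B. A \<in> sets unit_measure \<Longrightarrow> B \<in> sets unit_measure \<Longrightarrow>
       \<bar>\<integral>p. indicator (A \<times> B) p * (f p - 1) \<partial>square_measure\<bar> \<le> 2 powr (- 8 * real (card E))"
    and V: "finite V" "finite E" "\<And>e. e \<in> E \<Longrightarrow> l e \<in> V \<and> r e \<in> V"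
    and side: "\<And>e. e \<in> E \<Longrightarrow> side (l e) \<and> \<not> side (r e)"
    and inj: "inj_on (\<lambda>e. (l e, r e)) E"
  shows "1 \<le> (\<integral>z. (\<Prod>e\<in>E. f (z (l e), z (r e))) \<partial>(\<Pi>\<^sub>M v\<in>V. unit_measure))"
proof -
  let ?mu = "\<Pi>\<^sub>M v\<in>V. unit_measure"
  let ?L = "\<integral>z. (\<Prod>e\<in>E. f (z (l e), z (r e))) \<partial>?mu"
  interpret mu: finite_measure ?mu by (rule cube_finite_measure[OF V(1)])
  have mu1: "measure ?mu (space ?mu) = 1"
  proof -
    have "emeasure ?mu (PiE V (\<lambda>_. {0..1})) = (\<Prod>v\<in>V. emeasure unit_measure {0..1})"
      using sets.top[of unit_measure] by (intro cube.emeasure_PiM[OF V(1)]) (simp add: space_unit)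
    then show ?thesis by (simp add: measure_def space_PiM space_unit emeasure_unit_space)
  qed
  have fi: "integrable square_measure f" by (rule integrable_bounded[OF f(1), of 2]) (use f in auto)
  have ne: "l e \<noteq> r e" if "e \<in> E" for e using side[OF that] by auto
  have meas: "(\<lambda>z. h (z (l e), z (r e))) \<in> borel_measurable ?mu"
    if "h \<in> borel_measurable square_measure" "e \<in> E" for h :: "real \<times> real \<Rightarrow> real" and e
    using measurable_compose[OF measurable_two_coordinates that(1)] V(3)[OF that(2)] by auto
  show ?thesis
  proof (cases "card E = 0")
    case True
    then have "E = {}" using V(2) by simp
    then show ?thesis using mu1 by simp
  next
    case False
    let ?m = "card E"
    define eps where "eps = (1 / 2 ^ (8 * ?m) :: real)"
    have "2 powr (- 8 * real ?m) = eps"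
    proof -
      have "2 powr (- 8 * real ?m) = inverse (2 powr real (8 * ?m))" by (simp add: powr_minus)
      also have "\<dots> = eps" unfolding eps_def by (subst powr_realpow) (simp_all add: inverse_eq_divide)
      finally show ?thesis .
    qed
    note cut' = cut[unfolded this]
    \<comment> \<open>This is the square root of \<open>4 * eps\<close>; it beats the number of edge subsets as soon as there is an edge.\<close>
    define kappa where "kappa = (2 / 2 ^ (4 * ?m) :: real)"
    have kap: "0 \<le> kappa" "kappa\<^sup>2 = 4 * eps" "2 ^ ?m * kappa \<le> 1"
    proof -
      show "0 \<le> kappa" by (simp add: kappa_def)
      show "kappa\<^sup>2 = 4 * eps"
        by (simp add: kappa_def eps_def power_divide power_mult[symmetric] mult.commute)
      have "(2::real) ^ ?m * 2 = 2 ^ (?m + 1)" by simp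
      also have "\<dots> \<le> 2 ^ (4 * ?m)" using False by (intro power_increasing) auto
      finally show "2 ^ ?m * kappa \<le> 1" by (simp add: kappa_def)
    qed
    define ED where "ED = (\<lambda>e. {l e, r e}) ` E"
    have injD: "inj_on (\<lambda>e. {l e, r e}) E"
    proof (rule inj_onI)
      fix e e' assume e: "e \<in> E" "e' \<in> E" "{l e, r e} = {l e', r e'}"
      then have "l e = l e' \<and> r e = r e'" using side[OF e(1)] side[OF e(2)] by (auto simp: doubleton_eq_iff)
      then show "e = e'" using inj e by (auto dest: inj_onD)
    qed
    have cardD: "card ED = ?m" unfolding ED_def by (rule card_image[OF injD])
    have main: "1 - 2 ^ ?m * (real ?m * d) \<le> ?L" if d: "d > 0" for d
    proof -
      obtain n where n: "n > 0" and ap: "(\<integral>p. \<bar>f p - step f n p\<bar> \<partial>square_measure) \<le> d"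
        by (rule step_approximation[OF f d])
      have "signed_kernel n (cell_kernel f n) (4 * eps)"
        by (rule cell_kernel_signed_kernel[OF n f mean cut'])
      then interpret bip_kernel n "cell_kernel f n" "4 * eps" side
        unfolding bip_kernel_def .
      have bipD: "bip ED" unfolding bip_def ED_def using V(2) side by blast
      have UD: "\<Union>ED \<subseteq> V" using V(3) by (auto simp: ED_def)
      have stepr: "0 \<le> step f n p \<and> step f n p \<le> 2" for p
        unfolding step_def using cell_mean_range[OF n _ _ fi f(2,3)] idx_less[OF n] by simp
      define G where "G z = (\<Prod>e\<in>ED. 1 + fac e z)" for z
      have G_eq: "G y = (\<Prod>e\<in>E. 1 + cell_kernel f n (y (l e)) (y (r e)))" for y
      proof -
        have "G y = (\<Prod>e\<in>E. 1 + fac {l e, r e} y)"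
          unfolding G_def ED_def by (subst prod.reindex[OF injD]) simp
        also have "\<dots> = (\<Prod>e\<in>E. 1 + cell_kernel f n (y (l e)) (y (r e)))"
          using side by (intro prod.cong refl) (simp add: fac_eq M_def)
        finally show ?thesis .
      qed
      have Gdep: "G y = G y'" if "\<And>v. v \<in> V \<Longrightarrow> y v = y' v" for y y'
        unfolding G_eq using that V(3) by (intro prod.cong refl) simp
      have "1 \<le> Av n V G (\<lambda>_. 0)"
        unfolding G_def using density_ge_1[OF bipD kap(1,2) _ V(1) UD] kap(3) cardD by simp
      also have "Av n V G (\<lambda>_. 0) = (\<integral>z. G (\<lambda>v. idx n (z v)) \<partial>?mu)"
        by (rule integral_idx_cube[OF V(1) n Gdep, symmetric])
      also have "\<dots> = (\<integral>z. (\<Prod>e\<in>E. step f n (z (l e), z (r e))) \<partial>?mu)"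
        unfolding G_eq by (intro Bochner_Integration.integral_cong prod.cong refl)
          (simp add: cell_kernel_def step_def idx_less[OF n])
      finally have one: "1 \<le> (\<integral>z. (\<Prod>e\<in>E. step f n (z (l e), z (r e))) \<partial>?mu)" .
      have bnd: "integrable ?mu h" if "h \<in> borel_measurable ?mu" "\<And>z. \<bar>h z\<bar> \<le> c" for h :: "_ \<Rightarrow> real" and c
        by (rule mu.integrable_const_bound[of _ c]) (use that in auto)
      have prodb: "\<bar>\<Prod>e\<in>E. h e\<bar> \<le> 2 ^ ?m" if "\<And>e. 0 \<le> h e \<and> h e \<le> 2" for h :: "'e \<Rightarrow> real"
      proof -
        have "\<bar>\<Prod>e\<in>E. h e\<bar> = (\<Prod>e\<in>E. h e)" using that by (simp add: prod_nonneg)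
        also have "\<dots> \<le> (\<Prod>e\<in>E. 2)" using that by (intro prod_mono) auto
        finally show ?thesis by simp
      qed
      have i1: "integrable ?mu (\<lambda>z. \<Prod>e\<in>E. step f n (z (l e), z (r e)))"
        by (rule bnd[of _ "2 ^ ?m"]) (use stepr prodb in \<open>auto intro!: borel_measurable_prod meas measurable_step\<close>)
      have i2: "integrable ?mu (\<lambda>z. \<Prod>e\<in>E. f (z (l e), z (r e)))"
        by (rule bnd[of _ "2 ^ ?m"]) (use f(2,3) prodb in \<open>auto intro!: borel_measurable_prod meas f(1)\<close>)
      have dm: "(\<lambda>p. \<bar>f p - step f n p\<bar>) \<in> borel_measurable square_measure"
        using f(1) measurable_step by (intro borel_measurable_abs borel_measurable_diff)
      have i3: "integrable ?mu (\<lambda>z. \<bar>f (z (l e), z (r e)) - step f n (z (l e), z (r e))\<bar>)" if "e \<in> E" for e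
      proof (rule bnd[OF meas[OF dm that], of 2])
        fix z show "\<bar>\<bar>f (z (l e), z (r e)) - step f n (z (l e), z (r e))\<bar>\<bar> \<le> 2"
          using f(2)[of "(z (l e), z (r e))"] f(3)[of "(z (l e), z (r e))"] stepr[of "(z (l e), z (r e))"]
          by (simp add: abs_le_iff)
      qed
      have "(\<integral>z. (\<Prod>e\<in>E. step f n (z (l e), z (r e))) \<partial>?mu) - ?L
         = (\<integral>z. (\<Prod>e\<in>E. step f n (z (l e), z (r e))) - (\<Prod>e\<in>E. f (z (l e), z (r e))) \<partial>?mu)"
        by (rule Bochner_Integration.integral_diff[OF i1 i2, symmetric])
      also have "\<dots> \<le> (\<integral>z. 2 ^ ?m * (\<Sum>e\<in>E. \<bar>f (z (l e), z (r e)) - step f n (z (l e), z (r e))\<bar>) \<partial>?mu)"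
      proof (rule integral_mono)
        show "integrable ?mu (\<lambda>z. 2 ^ ?m * (\<Sum>e\<in>E. \<bar>f (z (l e), z (r e)) - step f n (z (l e), z (r e))\<bar>))"
          using i3 by (intro integrable_mult_right Bochner_Integration.integrable_sum)
        fix z
        have "\<bar>(\<Prod>e\<in>E. f (z (l e), z (r e))) - (\<Prod>e\<in>E. step f n (z (l e), z (r e)))\<bar>
          \<le> 2 ^ ?m * (\<Sum>e\<in>E. \<bar>f (z (l e), z (r e)) - step f n (z (l e), z (r e))\<bar>)"
          by (rule prod_diff_le[OF V(2)]) (use f(2,3) stepr in auto)
        then show "(\<Prod>e\<in>E. step f n (z (l e), z (r e))) - (\<Prod>e\<in>E. f (z (l e), z (r e)))
          \<le> 2 ^ ?m * (\<Sum>e\<in>E. \<bar>f (z (l e), z (r e)) - step f n (z (l e), z (r e))\<bar>)" by linarith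
      qed (intro Bochner_Integration.integrable_diff i1 i2)
      also have "\<dots> = 2 ^ ?m * (\<Sum>e\<in>E. \<integral>z. \<bar>f (z (l e), z (r e)) - step f n (z (l e), z (r e))\<bar> \<partial>?mu)"
        using i3 by (subst Bochner_Integration.integral_mult_right_zero) (simp add: Bochner_Integration.integral_sum)
      also have "\<dots> \<le> 2 ^ ?m * (\<Sum>e\<in>E. d)"
      proof (intro mult_left_mono sum_mono)
        fix e assume e: "e \<in> E"
        have "(\<integral>z. \<bar>f (z (l e), z (r e)) - step f n (z (l e), z (r e))\<bar> \<partial>?mu)
          = (\<integral>p. \<bar>f p - step f n p\<bar> \<partial>square_measure)"
          using integral_two_coordinates[OF V(1) _ _ ne[OF e] dm] V(3)[OF e] by simp
        then show "(\<integral>z. \<bar>f (z (l e), z (r e)) - step f n (z (l e), z (r e))\<bar> \<partial>?mu) \<le> d" using ap by simp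
      qed auto
      finally show ?thesis using one by simp
    qed
    show ?thesis
    proof (rule field_le_epsilon)
      fix x :: real assume x: "0 < x"
      have m0: "0 < 2 ^ ?m * real ?m" using False by simp
      define d where "d = x / (2 ^ ?m * real ?m)"
      have "d > 0" using x m0 by (simp add: d_def)
      moreover have "2 ^ ?m * (real ?m * d) = x" using False by (simp add: d_def field_simps)
      ultimately show "1 \<le> ?L + x" using main[of d] by linarith
    qed
  qed
qed

section \<open>Lebesgue measurable kernels\<close>

text \<open>The two functions differ on a null set, all of whose subsets are measurable in the completion.\<close>

lemma measurable_completion_AE_eq:
  fixes h h' :: "'a \<Rightarrow> real"
  assumes h': "h' \<in> borel_measurable M" and eq: "AE x in M. h x = h' x"
  shows "h \<in> borel_measurable (completion M)"
proof (rule measurableI)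
  fix A :: "real set" assume A: "A \<in> sets borel"
  let ?N = "{x \<in> space M. h x \<noteq> h' x}"
  have 1: "{x \<in> space M. h x \<noteq> h' x \<and> h x \<in> A} \<in> sets (completion M)"
  proof -
    have "AE x in M. \<not> (h x \<noteq> h' x \<and> h x \<in> A)" using eq by eventually_elim simp
    from sets_completion_AE[OF this] show ?thesis by (simp add: pred_def)
  qed
  have 2: "?N \<in> sets (completion M)"
    using sets_completion_AE[where M=M and P="\<lambda>x. h x \<noteq> h' x"] eq by (simp add: pred_def)
  have 3: "h' -` A \<inter> space M \<in> sets (completion M)"
    using measurable_sets[OF measurable_completion[OF h'] A] by simp
  have "h -` A \<inter> space (completion M) = {x \<in> space M. h x \<noteq> h' x \<and> h x \<in> A} \<union> ((h' -` A \<inter> space M) - ?N)"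
    by auto
  then show "h -` A \<inter> space (completion M) \<in> sets (completion M)" using 1 2 3 by auto
qed simp

text \<open>A Lebesgue measurable function agrees almost everywhere with a Borel function, which can be clipped
  to \<open>[0, 2]\<close> without losing the agreement.\<close>

lemma kernel_borel_version:
  assumes W: "bounded_measurable_kernel W"
    and r: "\<And>x y. x \<in> {0..1} \<Longrightarrow> y \<in> {0..1} \<Longrightarrow> 0 \<le> W x y \<and> W x y \<le> 2"
  obtains f :: "real \<times> real \<Rightarrow> real" where "f \<in> borel_measurable lborel" "\<And>p. 0 \<le> f p" "\<And>p. f p \<le> 2"
    "AE p in lborel. p \<in> unit_square \<longrightarrow> f p = W (fst p) (snd p)"
proof -
  let ?f0 = "\<lambda>p. indicator unit_square p * (\<lambda>(x, y). W x y) p"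
  have Q: "unit_square \<in> sets lebesgue" by (intro sets_completionI_sets) (auto intro!: borel_closed closed_Times)
  have "(\<lambda>(x, y). W x y) \<in> borel_measurable (lebesgue_on unit_square)"
    using W by (simp add: bounded_measurable_kernel_def)
  then have "?f0 \<in> borel_measurable lebesgue"
    using Q by (subst (asm) borel_measurable_restrict_space_iff) auto
  then obtain g where g: "g \<in> borel_measurable lborel" "AE p in lborel. ?f0 p = g p"
    using completion_ex_borel_measurable_real by blast
  define f where "f p = max 0 (min 2 (g p))" for p
  have fm: "f \<in> borel_measurable lborel" unfolding f_def[abs_def] using g(1) by measurable
  have "AE p in lborel. p \<in> unit_square \<longrightarrow> f p = W (fst p) (snd p)"
    using g(2)
  proof eventually_elim
    case (elim p)
    show ?case
    proof
      assume p: "p \<in> unit_square"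
      have "g p = W (fst p) (snd p)" using elim p by (simp add: case_prod_unfold)
      moreover have "0 \<le> W (fst p) (snd p) \<and> W (fst p) (snd p) \<le> 2" using r p by (cases p) auto
      ultimately show "f p = W (fst p) (snd p)" by (simp add: f_def)
    qed
  qed
  then show ?thesis using that[of f] fm by (simp add: f_def)
qed

lemma integral_square_eq_lebesgue:
  fixes f :: "real \<times> real \<Rightarrow> real"
  assumes f: "f \<in> borel_measurable lborel" "AE p in lborel. p \<in> unit_square \<longrightarrow> f p = w p"
    and A: "A \<in> sets borel" "A \<subseteq> unit_square"
  shows "(\<integral>p. indicator A p * (f p - c) \<partial>square_measure) = set_lebesgue_integral lebesgue A (\<lambda>p. w p - c)"
proof -
  have Q: "unit_square \<in> sets borel" by (intro borel_closed closed_Times) auto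
  have m: "(\<lambda>p. indicator A p * (f p - c)) \<in> borel_measurable lborel" using A f(1) by simp
  have "(\<integral>p. indicator A p * (f p - c) \<partial>square_measure)
     = (\<integral>p. indicator unit_square p *\<^sub>R (indicator A p * (f p - c)) \<partial>lborel)"
    unfolding square_measure_eq using Q by (intro integral_restrict_space) auto
  also have "\<dots> = (\<integral>p. indicator A p * (f p - c) \<partial>lborel)"
    using A(2) by (intro Bochner_Integration.integral_cong refl) (auto simp: indicator_def)
  also have "\<dots> = (\<integral>p. indicator A p * (f p - c) \<partial>lebesgue)"
    using m by (rule integral_completion[symmetric])
  also have "\<dots> = (\<integral>p. indicator A p *\<^sub>R (w p - c) \<partial>lebesgue)"
  proof (rule integral_cong_AE)
    have AE: "AE p in lborel. indicator A p *\<^sub>R (w p - c) = indicator A p * (f p - c)"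
      using f(2) by eventually_elim (use A(2) in \<open>auto simp: indicator_def\<close>)
    show "(\<lambda>p. indicator A p * (f p - c)) \<in> borel_measurable lebesgue" by (rule measurable_completion[OF m])
    show "(\<lambda>p. indicator A p *\<^sub>R (w p - c)) \<in> borel_measurable lebesgue"
      by (rule measurable_completion_AE_eq[OF m AE])
    show "AE p in lebesgue. indicator A p * (f p - c) = indicator A p *\<^sub>R (w p - c)"
      using AE_completion[OF AE] by eventually_elim (rule sym)
  qed
  finally show ?thesis by (simp add: set_lebesgue_integral_def)
qed

text \<open>The supremum that defines the cut norm is over a bounded family. An integral over a nonmeasurable
  rectangle would be zero by convention and respects the same bound.\<close>

lemma set_integral_le_cut_norm:
  assumes u: "\<And>x y. x \<in> {0..1} \<Longrightarrow> y \<in> {0..1} \<Longrightarrow> \<bar>u x y\<bar> \<le> c"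
    and ST: "S \<in> sets lebesgue" "S \<subseteq> {0..1}" "T \<in> sets lebesgue" "T \<subseteq> {0..1}"
  shows "\<bar>set_lebesgue_integral lebesgue (S \<times> T) (\<lambda>(x, y). u x y)\<bar> \<le> cut_norm u"
  unfolding cut_norm_def
proof (rule cSUP_upper2[where x="(S, T)"])
  have Q: "unit_square \<in> sets (lborel :: (real \<times> real) measure)" by (auto intro!: borel_closed closed_Times)
  have cb: "unit_square = cbox (0, 0) (1, 1 :: real)" by (simp add: cbox_Pair_eq)
  have Q1: "measure lebesgue unit_square = 1" "emeasure lebesgue unit_square < \<infinity>"
    unfolding cb using emeasure_lborel_cbox_finite[of "(0, 0)" "(1, 1) :: real \<times> real"]
    by (simp_all add: content_Pair)
  have Ql: "unit_square \<in> sets lebesgue" using Q by (rule sets_completionI_sets)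
  have c0: "0 \<le> c" using u[of 0 0] by simp
  have bound: "\<bar>set_lebesgue_integral lebesgue (S \<times> T) (\<lambda>(x, y). u x y)\<bar> \<le> c"
    if "S \<subseteq> {0..1}" "T \<subseteq> {0..1}" for S T
  proof (cases "integrable lebesgue (\<lambda>p. indicator (S \<times> T) p *\<^sub>R (\<lambda>(x, y). u x y) p)")
    case True
    have int: "integrable lebesgue (\<lambda>p. indicator unit_square p * c)"
      using Ql Q1(2) by (intro integrable_mult_left integrable_real_indicator)
    have "\<bar>set_lebesgue_integral lebesgue (S \<times> T) (\<lambda>(x, y). u x y)\<bar>
       \<le> (\<integral>p. \<bar>indicator (S \<times> T) p *\<^sub>R (\<lambda>(x, y). u x y) p\<bar> \<partial>lebesgue)"
      unfolding set_lebesgue_integral_def by (rule integral_abs_bound)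
    also have "\<dots> \<le> (\<integral>p. indicator unit_square p * c \<partial>lebesgue)"
      using True int
    proof (intro integral_mono integrable_abs)
      fix p :: "real \<times> real"
      show "\<bar>indicator (S \<times> T) p *\<^sub>R (\<lambda>(x, y). u x y) p\<bar> \<le> indicator unit_square p * c"
        using that u c0 by (cases p) (auto simp: indicator_def)
    qed
    also have "\<dots> = c"
      using Q1(1) by (simp add: mult.commute)
    finally show ?thesis .
  qed (use c0 in \<open>simp add: set_lebesgue_integral_def not_integrable_integral_eq\<close>)
  then show "bdd_above ((\<lambda>(S, T). \<bar>set_lebesgue_integral lebesgue (S \<times> T) (\<lambda>(x, y). u x y)\<bar>) `
     ({S. S \<in> sets lebesgue \<and> S \<subseteq> {0..1}} \<times> {T. T \<in> sets lebesgue \<and> T \<subseteq> {0..1}}))"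
    by (intro bdd_aboveI[of _ c]) auto
qed (use ST in auto)

theorem theorem3p1:
  fixes F :: "('v, 'e) bigraph" and W :: "real \<Rightarrow> real \<Rightarrow> real" and m :: nat
  assumes "simple_bigraph F" and "m = card (edges F)"
    and "bounded_measurable_kernel W"
    and "integral\<^sup>L (lebesgue_on unit_square) (\<lambda>(x, y). W x y) = 1"
    and "\<And>x y. x \<in> {0..1} \<Longrightarrow> y \<in> {0..1} \<Longrightarrow> 0 \<le> W x y \<and> W x y \<le> 2"
    and "cut_norm (\<lambda>x y. W x y - 1) \<le> 2 powr (- 8 * real m)"
  shows "hom_density F W \<ge> 1"
proof -
  let ?V = "left_nodes F \<union> right_nodes F" and ?E = "edges F"
  let ?mu = "\<Pi>\<^sub>M v\<in>?V. unit_measure"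
  have fin: "finite ?V" "finite ?E" and ends: "\<And>e. e \<in> ?E \<Longrightarrow> left_end F e \<in> left_nodes F \<and> right_end F e \<in> right_nodes F"
    and disj: "left_nodes F \<inter> right_nodes F = {}"
    and inj: "inj_on (\<lambda>e. (left_end F e, right_end F e)) ?E"
    using assms(1) by (auto simp: simple_bigraph_def is_bigraph_def)
  obtain f :: "real \<times> real \<Rightarrow> real" where f: "f \<in> borel_measurable lborel" "\<And>p. 0 \<le> f p" "\<And>p. f p \<le> 2"
    and fW: "AE p in lborel. p \<in> unit_square \<longrightarrow> f p = W (fst p) (snd p)"
    using kernel_borel_version[OF assms(3,5)] by blast
  have Q: "unit_square \<in> sets borel" by (intro borel_closed closed_Times) auto
  have fs: "f \<in> borel_measurable square_measure"
    unfolding square_measure_eq using f(1) by (rule measurable_restrict_space1)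
  have mean: "integral\<^sup>L square_measure f = 1"
  proof -
    have "integral\<^sup>L square_measure f = (\<integral>p. indicator unit_square p * (f p - 0) \<partial>square_measure)"
      by (intro Bochner_Integration.integral_cong refl) (simp add: space_square del: mem_Times_iff)
    also have "\<dots> = set_lebesgue_integral lebesgue unit_square (\<lambda>p. W (fst p) (snd p) - 0)"
      by (rule integral_square_eq_lebesgue[OF f(1) fW Q]) simp
    also have "\<dots> = integral\<^sup>L (lebesgue_on unit_square) (\<lambda>(x, y). W x y)"
      unfolding set_lebesgue_integral_def using Q
      by (subst integral_restrict_space) (auto simp: case_prod_unfold)
    finally show ?thesis using assms(4) by simp
  qed
  have cut: "\<bar>\<integral>p. indicator (A \<times> B) p * (f p - 1) \<partial>square_measure\<bar> \<le> 2 powr (- 8 * real (card ?E))"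
    if AB: "A \<in> sets unit_measure" "B \<in> sets unit_measure" for A B
  proof -
    have sub: "A \<subseteq> {0..1}" "B \<subseteq> {0..1}"
      using sets.sets_into_space[OF AB(1)] sets.sets_into_space[OF AB(2)] by (auto simp: space_unit)
    have bor: "A \<in> sets borel" "B \<in> sets borel" using AB by (auto simp: sets_restrict_space)
    have ABb: "A \<times> B \<in> sets borel" using bor by (rule borel_Times)
    have "(\<integral>p. indicator (A \<times> B) p * (f p - 1) \<partial>square_measure)
      = set_lebesgue_integral lebesgue (A \<times> B) (\<lambda>p. W (fst p) (snd p) - 1)"
      by (rule integral_square_eq_lebesgue[OF f(1) fW ABb]) (use sub in auto)
    also have "\<dots> = set_lebesgue_integral lebesgue (A \<times> B) (\<lambda>(x, y). W x y - 1)"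
      by (simp add: case_prod_unfold)
    also have "\<bar>\<dots>\<bar> \<le> cut_norm (\<lambda>x y. W x y - 1)"
    proof (rule set_integral_le_cut_norm[of _ 1])
      show "\<bar>W x y - 1\<bar> \<le> 1" if "x \<in> {0..1}" "y \<in> {0..1}" for x y
        using assms(5)[OF that] by (simp add: abs_le_iff)
    qed (use sub bor in auto)
    finally show ?thesis using assms(2,6) by simp
  qed
  have "1 \<le> (\<integral>z. (\<Prod>e\<in>?E. f (z (left_end F e), z (right_end F e))) \<partial>?mu)"
  proof (rule square_density_ge_1[OF fs f(2,3) mean cut fin, where side="\<lambda>v. v \<in> left_nodes F"])
    show "left_end F e \<in> ?V \<and> right_end F e \<in> ?V" if "e \<in> ?E" for e using ends[OF that] by simp
    show "left_end F e \<in> left_nodes F \<and> right_end F e \<notin> left_nodes F" if "e \<in> ?E" for e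
      using ends[OF that] disj by blast
  qed (fact inj | assumption)+
  also have "\<dots> = hom_density F W"
  proof -
    let ?h = "\<lambda>z. \<Prod>e\<in>?E. W (z (left_end F e)) (z (right_end F e))"
    let ?h' = "\<lambda>z. \<Prod>e\<in>?E. f (z (left_end F e), z (right_end F e))"
    have fWs: "AE p in square_measure. f p = W (fst p) (snd p)"
      unfolding square_measure_eq using fW Q by (subst AE_restrict_space_iff) auto
    have "AE z in ?mu. \<forall>e\<in>?E. f (z (left_end F e), z (right_end F e)) = W (z (left_end F e)) (z (right_end F e))"
    proof (rule AE_finite_allI[OF fin(2)])
      fix e assume e: "e \<in> ?E"
      have "left_end F e \<noteq> right_end F e" using ends[OF e] disj by auto
      from AE_two_coordinates[OF fin(1) _ _ this fWs] ends[OF e]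
      show "AE z in ?mu. f (z (left_end F e), z (right_end F e)) = W (z (left_end F e)) (z (right_end F e))" by simp
    qed
    then have AE: "AE z in ?mu. ?h z = ?h' z" by eventually_elim (auto intro: prod.cong)
    have m: "?h' \<in> borel_measurable ?mu"
    proof (rule borel_measurable_prod)
      fix e assume e: "e \<in> ?E"
      show "(\<lambda>z. f (z (left_end F e), z (right_end F e))) \<in> borel_measurable ?mu"
        by (rule measurable_compose[OF measurable_two_coordinates fs]) (use ends[OF e] in auto)
    qed
    have "integral\<^sup>L ?mu ?h' = integral\<^sup>L (completion ?mu) ?h'"
      by (rule integral_completion[OF m, symmetric])
    also have "\<dots> = integral\<^sup>L (completion ?mu) ?h"
    proof (rule integral_cong_AE)
      show "?h' \<in> borel_measurable (completion ?mu)" by (rule measurable_completion[OF m])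
      show "?h \<in> borel_measurable (completion ?mu)" by (rule measurable_completion_AE_eq[OF m AE])
      show "AE z in completion ?mu. ?h' z = ?h z" using AE_completion[OF AE] by eventually_elim (rule sym)
    qed
    finally show ?thesis by (simp add: hom_density_def cube_measure_def)
  qed
  finally show ?thesis .
qed

end
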